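(* Let $\kappa\ge3$ and let $X_t$ be the walk with wall defined below. Then as $t\to\infty$, $X_t/t$ converges weakly (in distribution) to a random variable $Y$ whose law is: in Case (A) ($\gamma=0$), the absolutely continuous law with density $f_\kappa$; in Case (B) ($\gamma=\pi$), the law $C_\kappa\,\delta_0+(1-C_\kappa)\,f_\kappa(x)\,dx$, where $\delta_0$ is the Dirac mass at $0$ and $C_\kappa=\frac{\kappa-2}{\kappa-1}$. Here $$f_\kappa(x)=(\kappa-2)\,\frac{x^2\,I_{[0,a_\kappa)}(x)}{\pi(1-x^2)\sqrt{a_\kappa^2-x^2}},\qquad a_\kappa=\frac{2\sqrt{\kappa-1}}{\kappa},$$ and $I_{[0,a_\kappa)}$ is the indicator function of $[0,a_\kappa)$.
   Context: Walk with wall on $\mathbb{Z}_+=\{0,1,2,\dots\}$: fix $\kappa\ge3$, let $a_\kappa=2\sqrt{\kappa-1}/\kappa$, $b_\kappa=1-2/\kappa$, $\gamma\in\mathbb{R}$. Consider the Hilbert space with orthonormal basis $\{|0,L\rangle\}\cup\{|x,L\rangle,|x,R\rangle: x\ge1\}$ and the unitary $\widetilde U$ given by $\widetilde U|0,L\rangle=e^{i\gamma}|1,R\rangle$ and, for $x\ge1$, $\widetilde U|x,L\rangle=a_\kappa|x-1,L\rangle+b_\kappa|x+1,R\rangle$, $\widetilde U|x,R\rangle=-b_\kappa|x-1,L\rangle+a_\kappa|x+1,R\rangle$. With $\Phi_t=\widetilde U^t|0,L\rangle$, the random variable $X_t$ on $\mathbb{Z}_+$ has $P(X_t=0)=|\langle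 0,L|\Phi_t\rangle|^2$ and $P(X_t=x)=|\langle x,L|\Phi_t\rangle|^2+|\langle x,R|\Phi_t\rangle|^2$ for $x\ge1$. Case (A) is $\gamma=0$ and Case (B) is $\gamma=\pi$. (These correspond to the distance from the root of the Grover walk on the $\kappa$-regular Cayley tree started at the root with uniform coin state $(1/\sqrt\kappa,\dots,1/\sqrt\kappa)$, resp. coin state $(\omega_\kappa^j/\sqrt\kappa)_{j=0}^{\kappa-1}$, $\omega_\kappa=e^{2\pi i/\kappa}$.) *)

theory Defs
  imports "HOL-Probability.Probability"
begin

datatype chir = L | R

definition a_k :: "nat \<Rightarrow> real" where
  "a_k \<kappa> = 2 * sqrt (real \<kappa> - 1) / real \<kappa>"

definition b_k :: "nat \<Rightarrow> real" where
  "b_k \<kappa> = 1 - 2 / real \<kappa>"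

text \<open>One application of the unitary U~ to a state, written in coordinates
  psi (x, c) = <x,c|psi>.  The coordinate (0,R) is not a basis vector and is kept 0.
  U~|0,L> = e^{i gamma}|1,R>;  U~|x,L> = a|x-1,L> + b|x+1,R>;
  U~|x,R> = -b|x-1,L> + a|x+1,R>  (x >= 1).\<close>
fun wstep :: "nat \<Rightarrow> real \<Rightarrow> (nat \<times> chir \<Rightarrow> complex) \<Rightarrow> (nat \<times> chir \<Rightarrow> complex)" where
  "wstep \<kappa> \<gamma> psi (x, L) =
     complex_of_real (a_k \<kappa>) * psi (x + 1, L) - complex_of_real (b_k \<kappa>) * psi (x + 1, R)"
| "wstep \<kappa> \<gamma> psi (0, R) = 0"
| "wstep \<kappa> \<gamma> psi (Suc 0, R) = cis \<gamma> * psi (0, L)"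
| "wstep \<kappa> \<gamma> psi (Suc (Suc x), R) =
     complex_of_real (b_k \<kappa>) * psi (Suc x, L) + complex_of_real (a_k \<kappa>) * psi (Suc x, R)"

primrec Phi :: "nat \<Rightarrow> real \<Rightarrow> nat \<Rightarrow> (nat \<times> chir \<Rightarrow> complex)" where
  "Phi \<kappa> \<gamma> 0 = (\<lambda>(x, c). if x = 0 \<and> c = L then 1 else 0)"
| "Phi \<kappa> \<gamma> (Suc t) = wstep \<kappa> \<gamma> (Phi \<kappa> \<gamma> t)"

definition walk_prob :: "nat \<Rightarrow> real \<Rightarrow> nat \<Rightarrow> nat \<Rightarrow> real" where
  "walk_prob \<kappa> \<gamma> t x =
     (if x = 0 then (cmod (Phi \<kappa> \<gamma> t (0, L)))\<^sup>2
      else (cmod (Phi \<kappa> \<gamma> t (x, L)))\<^sup>2 + (cmod (Phi \<kappa> \<gamma> t (x, R)))\<^sup>2)"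

definition law_X :: "nat \<Rightarrow> real \<Rightarrow> nat \<Rightarrow> nat measure" where
  "law_X \<kappa> \<gamma> t = density (count_space UNIV) (\<lambda>x. ennreal (walk_prob \<kappa> \<gamma> t x))"

definition law_scaled :: "nat \<Rightarrow> real \<Rightarrow> nat \<Rightarrow> real measure" where
  "law_scaled \<kappa> \<gamma> t = distr (law_X \<kappa> \<gamma> t) borel (\<lambda>x. real x / real t)"

definition f_k :: "nat \<Rightarrow> real \<Rightarrow> real" where
  "f_k \<kappa> x = (real \<kappa> - 2) * (x\<^sup>2 * indicator {0..<a_k \<kappa>} x)
                / (pi * (1 - x\<^sup>2) * sqrt ((a_k \<kappa>)\<^sup>2 - x\<^sup>2))"

definition C_k :: "nat \<Rightarrow> real" where
  "C_k \<kappa> = (real \<kappa> - 2) / (real \<kappa> - 1)"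

definition limit_A :: "nat \<Rightarrow> real measure" where
  "limit_A \<kappa> = density lborel (\<lambda>x. ennreal (f_k \<kappa> x))"

definition limit_B :: "nat \<Rightarrow> real measure" where
  "limit_B \<kappa> = measure_of UNIV (sets borel)
     (\<lambda>A. ennreal (C_k \<kappa>) * indicator A 0
          + ennreal (1 - C_k \<kappa>) * emeasure (density lborel (\<lambda>x. ennreal (f_k \<kappa> x))) A)"

end

theory Submission
  imports Defs "HOL-Real_Asymp.Real_Asymp" "HOL-Library.Discrete_Functions"
begin

text \<open>
  Let \<open>U\<close> be the walk operator, \<open>X\<close> the distance from the wall (\<open>position\<close>), \<open>M = U + U\<^sup>-\<^sup>1\<close>, \<open>D = U - U\<^sup>-\<^sup>1\<close>, \<open>C = M / 2\<close>, and
  let \<open>E\<close> be the sign of the direction (\<open>direction\<close>). Then \<open>X U = U X + E U\<close>, and with \<open>K = X M - M X = E U - U\<^sup>-\<^sup>1 E\<close> the operator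
  \<open>X D - t K - U\<^sup>-\<^sup>1 E\<close> is conserved along the evolution up to terms \<open>t (K U - U K)\<close>, which live near the wall.
  On states \<open>D f\<close> the amplitude near the wall is summable in time, because the generating function
  of the return amplitudes is algebraic with square root singularities on the unit circle. Away from the
  wall \<open>K\<^sup>2 = M\<^sup>2 - 4 a\<^sup>2\<close>, so that \<open>X\<^sup>2 / t\<^sup>2\<close> behaves like the function \<open>(a\<^sup>2 - C\<^sup>2) / (1 - C\<^sup>2)\<close> of \<open>U\<close>.

  This gives a recursion for the limits of the moments of \<open>X\<^sup>2 / t\<^sup>2\<close>, which starts with the spectral measure of
  \<open>C\<close> at the initial state. The operator \<open>M\<close> is a nearest neighbour operator on the integers with constant weights
  except for one defect bond, so this measure is explicit: a density on \<open>[-a, a]\<close> and, for the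
  phase \<open>-1\<close>, two atoms at \<open>\<plusminus>1\<close>. The atoms are localized near the wall and produce the Dirac mass at \<open>0\<close>;
  the density is mapped to \<open>f\<^sub>\<kappa>\<close> by \<open>x\<^sup>2 = (a\<^sup>2 - c\<^sup>2) / (1 - c\<^sup>2)\<close>.
\<close>

section \<open>Finitely supported vectors\<close>

text \<open>The quotient (a^2 - C^2) / (1 - C^2) is never formed: 1 - C^2 has no inverse on finitely
  supported vectors, and for phase -1 it kills the localized eigenvectors. What can be proved is the
  relation multiplied by (1 - C^2)^2. One factor appears because the velocity law, which carries a
  \<open>D\<close>, is applied twice and D^2 = -4 (1 - C^2). The other restricts to states in the
  range of \<open>D\<close>, where decay near the wall is available; a second \<open>D\<close> is
  spent so that the result is again a polynomial in C. Paired with C^j applied to the state, the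
  relation becomes a second difference in j of the moments, which is why the moments carry the extra
  exponent j. Passing from m to m + 1 therefore means summing twice in j, and the boundary condition
  sits at j tending to infinity: C^(2j) applied to the initial state approaches its localized part,
  on which X / t is negligible. No completion and no spectral theorem enter. The spectral measure is
  an explicit functional on functions of c, checked against generalized eigenfunctions; and the
  phases 1 and -1 keep all amplitudes real.\<close>

typedef fsv = "{f :: int \<Rightarrow> real. finite {y. f y \<noteq> 0}}"
  morphisms coord Abs_fsv
  by (rule exI[of _ "\<lambda>_. 0"]) auto

setup_lifting type_definition_fsv

lemma finite_coord [simp]: "finite {y. coord f y \<noteq> 0}"
  using coord[of f] by simp

lemma fsv_eqI: "(\<And>y. coord f y = coord g y) \<Longrightarrow> f = g"
  by (metis coord_inject ext)

instantiation fsv :: real_vector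
begin

lift_definition zero_fsv :: fsv is "\<lambda>_. 0" by simp

lift_definition plus_fsv :: "fsv \<Rightarrow> fsv \<Rightarrow> fsv" is "\<lambda>f g y. f y + g y"
proof -
  fix f g :: "int \<Rightarrow> real"
  assume "finite {y. f y \<noteq> 0}" "finite {y. g y \<noteq> 0}"
  thus "finite {y. f y + g y \<noteq> 0}"
    by (intro finite_subset[of "{y. f y + g y \<noteq> 0}" "{y. f y \<noteq> 0} \<union> {y. g y \<noteq> 0}"]) auto
qed

lift_definition minus_fsv :: "fsv \<Rightarrow> fsv \<Rightarrow> fsv" is "\<lambda>f g y. f y - g y"
proof -
  fix f g :: "int \<Rightarrow> real"
  assume "finite {y. f y \<noteq> 0}" "finite {y. g y \<noteq> 0}"
  thus "finite {y. f y - g y \<noteq> 0}"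
    by (intro finite_subset[of "{y. f y - g y \<noteq> 0}" "{y. f y \<noteq> 0} \<union> {y. g y \<noteq> 0}"]) auto
qed

lift_definition uminus_fsv :: "fsv \<Rightarrow> fsv" is "\<lambda>f y. - f y" by simp

lift_definition scaleR_fsv :: "real \<Rightarrow> fsv \<Rightarrow> fsv" is "\<lambda>c f y. c * f y"
  by (rule finite_subset) auto

instance
  by (standard; transfer) (auto simp: algebra_simps)

end

lemma coord_simps [simp]:
  "coord 0 y = 0"
  "coord (f + g) y = coord f y + coord g y"
  "coord (f - g) y = coord f y - coord g y"
  "coord (- f) y = - coord f y"
  "coord (c *\<^sub>R f) y = c * coord f y"
  by (transfer; simp)+

instantiation fsv :: real_inner
begin

definition inner_fsv :: "fsv \<Rightarrow> fsv \<Rightarrow> real" where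
  "inner_fsv f g = (\<Sum>y | coord f y \<noteq> 0. coord f y * coord g y)"

definition norm_fsv :: "fsv \<Rightarrow> real" where
  "norm_fsv f = sqrt (inner f f)"

definition sgn_fsv :: "fsv \<Rightarrow> fsv" where
  "sgn_fsv f = f /\<^sub>R norm f"

definition dist_fsv :: "fsv \<Rightarrow> fsv \<Rightarrow> real" where
  "dist_fsv f g = norm (f - g)"

definition uniformity_fsv :: "(fsv \<times> fsv) filter" where
  "uniformity_fsv = (INF e\<in>{0 <..}. principal {(x, y). dist x y < e})"

definition open_fsv :: "fsv set \<Rightarrow> bool" where
  "open_fsv A = (\<forall>x\<in>A. \<forall>\<^sub>F (x', y) in uniformity. x' = x \<longrightarrow> y \<in> A)"

lemma inner_fsv_on:
  assumes "finite A" "\<And>y. y \<notin> A \<Longrightarrow> coord f y * coord g y = 0"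
  shows "inner f g = (\<Sum>y\<in>A. coord f y * coord g y)"
  unfolding inner_fsv_def
  by (rule sum.mono_neutral_cong) (use assms in auto)

instance
proof
  fix x y z :: fsv and r :: real and A :: "fsv set"
  show "dist x y = norm (x - y)" by (rule dist_fsv_def)
  show "sgn x = x /\<^sub>R norm x" by (rule sgn_fsv_def)
  show "uniformity = (INF e\<in>{0 <..}. principal {(x :: fsv, y). dist x y < e})"
    by (rule uniformity_fsv_def)
  show "open A = (\<forall>x\<in>A. \<forall>\<^sub>F (x', y) in uniformity. x' = x \<longrightarrow> y \<in> A)"
    by (rule open_fsv_def)
  show "norm x = sqrt (inner x x)" by (rule norm_fsv_def)
  define S where "S = {i. coord x i \<noteq> 0} \<union> {i. coord y i \<noteq> 0} \<union> {i. coord z i \<noteq> 0}"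
  have S: "finite S" by (simp add: S_def)
  show "inner x y = inner y x"
    by (subst (1 2) inner_fsv_on[OF S]) (auto simp: S_def mult.commute)
  show "inner (x + y) z = inner x z + inner y z"
    by (subst (1 2 3) inner_fsv_on[OF S]) (auto simp: S_def sum.distrib distrib_right)
  show "inner (r *\<^sub>R x) y = r * inner x y"
    by (subst (1 2) inner_fsv_on[OF S]) (auto simp: S_def sum_distrib_left mult.assoc)
  show "0 \<le> inner x x"
    by (auto simp: inner_fsv_def intro: sum_nonneg)
  show "(inner x x = 0) = (x = 0)"
  proof
    assume "inner x x = 0"
    hence "\<forall>i\<in>{i. coord x i \<noteq> 0}. coord x i * coord x i = 0"
      unfolding inner_fsv_def by (subst (asm) sum_nonneg_eq_0_iff) auto
    thus "x = 0" by (intro fsv_eqI) auto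
  qed (simp add: inner_fsv_def)
qed

end

lift_definition site :: "int \<Rightarrow> fsv" is "\<lambda>x y. if y = x then 1 else 0" by simp

lemma coord_site: "coord (site x) y = (if y = x then 1 else 0)"
  by transfer simp

lemma inner_site: "inner (site x) f = coord f x"
  by (subst inner_fsv_on[of "{x}"]) (auto simp: coord_site)

definition supp_in :: "nat \<Rightarrow> fsv \<Rightarrow> bool" where
  "supp_in n f \<longleftrightarrow> (\<forall>y. \<bar>y\<bar> > int n \<longrightarrow> coord f y = 0)"

lemma supp_inD: "supp_in n f \<Longrightarrow> \<bar>y\<bar> > int n \<Longrightarrow> coord f y = 0"
  by (simp add: supp_in_def)

lemma supp_in_mono: "supp_in n f \<Longrightarrow> n \<le> m \<Longrightarrow> supp_in m f"
  by (auto simp: supp_in_def)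

lemma supp_in_linear [intro]:
  "supp_in n f \<Longrightarrow> supp_in n g \<Longrightarrow> supp_in n (f + g)"
  "supp_in n f \<Longrightarrow> supp_in n g \<Longrightarrow> supp_in n (f - g)"
  "supp_in n f \<Longrightarrow> supp_in n (c *\<^sub>R f)"
  by (auto simp: supp_in_def)

lemma supp_in_exists: "\<exists>n. supp_in n f"
proof -
  have "finite (insert 0 ((\<lambda>y. nat \<bar>y\<bar>) ` {y. coord f y \<noteq> 0}))" by simp
  then obtain n where n: "\<And>k. k \<in> (\<lambda>y. nat \<bar>y\<bar>) ` {y. coord f y \<noteq> 0} \<Longrightarrow> k \<le> n"
    by (meson finite_nat_set_iff_bounded_le insertCI)
  have "supp_in n f"
    unfolding supp_in_def
  proof (intro allI impI)
    fix y assume "int n < \<bar>y\<bar>"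
    thus "coord f y = 0" using n[of "nat \<bar>y\<bar>"] by force
  qed
  thus ?thesis ..
qed

lemma inner_supp_in:
  assumes "supp_in n f \<or> supp_in n g"
  shows "inner f g = (\<Sum>y\<in>{- int n..int n}. coord f y * coord g y)"
  by (rule inner_fsv_on) (use assms in \<open>auto simp: supp_in_def\<close>)

text \<open>An l1 bound: decay in time is known coordinate by coordinate, and this turns it into
  decay of norms for vectors of bounded support.\<close>

lemma norm_le_sum_coord:
  assumes "supp_in n f"
  shows "norm f \<le> (\<Sum>y\<in>{- int n..int n}. \<bar>coord f y\<bar>)"
proof -
  have "f = (\<Sum>x\<in>{- int n..int n}. coord f x *\<^sub>R site x)"
  proof (rule fsv_eqI)
    fix y
    have "coord (\<Sum>x\<in>A. coord f x *\<^sub>R site x) y = (\<Sum>x\<in>A. coord f x * coord (site x) y)" for A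
      by (induction A rule: infinite_finite_induct) auto
    thus "coord f y = coord (\<Sum>x\<in>{- int n..int n}. coord f x *\<^sub>R site x) y"
      using supp_inD[OF assms, of y] by (auto simp: coord_site if_distrib cong: if_cong)
  qed
  also have "norm \<dots> \<le> (\<Sum>x\<in>{- int n..int n}. norm (coord f x *\<^sub>R site x))"
    by (rule norm_sum)
  also have "\<dots> = (\<Sum>y\<in>{- int n..int n}. \<bar>coord f y\<bar>)"
    by (simp add: norm_eq_sqrt_inner inner_site coord_site)
  finally show ?thesis .
qed

lemma norm_le_of_coord_le:
  assumes "\<And>y. \<bar>coord f y\<bar> \<le> c * \<bar>coord g y\<bar>" "c \<ge> 0"
  shows "norm f \<le> c * norm g"
proof -
  have "inner f f = (\<Sum>y | coord g y \<noteq> 0. coord f y * coord f y)"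
  proof (rule inner_fsv_on)
    fix y assume "y \<notin> {y. coord g y \<noteq> 0}"
    thus "coord f y * coord f y = 0" using assms(1)[of y] by simp
  qed simp
  also have "\<dots> \<le> (\<Sum>y | coord g y \<noteq> 0. c\<^sup>2 * (coord g y * coord g y))"
  proof (rule sum_mono)
    fix y
    show "coord f y * coord f y \<le> c\<^sup>2 * (coord g y * coord g y)"
      using power_mono[OF assms(1)[of y], of 2]
      by (simp add: power_mult_distrib) (simp add: power2_eq_square)
  qed
  also have "\<dots> = c\<^sup>2 * inner g g"
    by (simp add: inner_fsv_def sum_distrib_left)
  finally have "sqrt (inner f f) \<le> sqrt (c\<^sup>2 * inner g g)" by simp
  thus ?thesis using assms(2) by (simp add: norm_eq_sqrt_inner real_sqrt_mult)
qed

section \<open>The walk as an operator on the integers\<close>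

text \<open>A state of the walk is stored on the integers: the site \<open>y \<ge> 1\<close> holds the coordinate
  \<open>(y, R)\<close> and the site \<open>y \<le> 0\<close> the coordinate \<open>(-y, L)\<close>, so that the distance from the wall is
  \<open>\<bar>y\<bar>\<close>; \<open>s\<close> is the phase \<open>e^(i \<gamma>) = \<plusminus>1\<close>.\<close>

lemma finite_vimage_shift:
  assumes "finite {y. f y \<noteq> (0::real)}"
  shows "finite {y::int. f (y + c) \<noteq> 0}" "finite {y::int. f (c - y) \<noteq> 0}"
proof -
  have "finite ((\<lambda>y. y + c) -` {y. f y \<noteq> 0})" "finite ((\<lambda>y. c - y) -` {y. f y \<noteq> 0})"
    using assms by (intro finite_vimageI; simp add: inj_def)+
  thus "finite {y::int. f (y + c) \<noteq> 0}" "finite {y::int. f (c - y) \<noteq> 0}"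
    by (simp_all add: vimage_def)
qed

lift_definition walk_op :: "real \<Rightarrow> real \<Rightarrow> real \<Rightarrow> fsv \<Rightarrow> fsv" is
  "\<lambda>a b s f y. if y \<le> 0 then a * f (y - 1) - b * f (1 - y)
     else if y = 1 then s * f 0 else b * f (1 - y) + a * f (y - 1)"
proof -
  fix a b s and f :: "int \<Rightarrow> real"
  assume "finite {y. f y \<noteq> 0}"
  from finite_vimage_shift[OF this]
  have "finite ({y. f (y + - 1) \<noteq> 0} \<union> {y. f (1 - y) \<noteq> 0} \<union> {1})" by blast
  thus "finite {y. (if y \<le> 0 then a * f (y - 1) - b * f (1 - y)
     else if y = 1 then s * f 0 else b * f (1 - y) + a * f (y - 1)) \<noteq> 0}"
    by (rule rev_finite_subset) (auto split: if_splits)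
qed

lift_definition walk_inv :: "real \<Rightarrow> real \<Rightarrow> real \<Rightarrow> fsv \<Rightarrow> fsv" is
  "\<lambda>a b s f y. if y < 0 then a * f (y + 1) + b * f (1 - y)
     else if y = 0 then s * f 1 else a * f (y + 1) - b * f (1 - y)"
proof -
  fix a b s and f :: "int \<Rightarrow> real"
  assume "finite {y. f y \<noteq> 0}"
  from finite_vimage_shift[OF this]
  have "finite ({y. f (y + 1) \<noteq> 0} \<union> {y. f (1 - y) \<noteq> 0} \<union> {0})" by blast
  thus "finite {y. (if y < 0 then a * f (y + 1) + b * f (1 - y)
     else if y = 0 then s * f 1 else a * f (y + 1) - b * f (1 - y)) \<noteq> 0}"
    by (rule rev_finite_subset) (auto split: if_splits)
qed

lift_definition mult_op :: "(int \<Rightarrow> real) \<Rightarrow> fsv \<Rightarrow> fsv" is "\<lambda>c f y. c y * f y"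
  by (rule rev_finite_subset) auto

lemma coord_mult_op [simp]: "coord (mult_op c f) y = c y * coord f y"
  by transfer simp

definition position :: "fsv \<Rightarrow> fsv" where "position = mult_op (\<lambda>y. \<bar>real_of_int y\<bar>)"

text \<open>The increment of the distance in the step that led to the site: \<open>+1\<close> for R, \<open>-1\<close> for L.\<close>
definition direction :: "fsv \<Rightarrow> fsv" where "direction = mult_op (\<lambda>y. if y \<ge> 1 then 1 else -1)"

lemma coord_XE [simp]:
  "coord (position f) y = \<bar>real_of_int y\<bar> * coord f y"
  "coord (direction f) y = (if y \<ge> 1 then 1 else -1) * coord f y"
  by (simp_all add: position_def direction_def)

lemma linear_XE [simp]:
  "position (f + g) = position f + position g" "position (f - g) = position f - position g" "position (c *\<^sub>R f) = c *\<^sub>R position f"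
  "direction (f + g) = direction f + direction g" "direction (f - g) = direction f - direction g" "direction (c *\<^sub>R f) = c *\<^sub>R direction f"
  by (rule fsv_eqI; simp add: algebra_simps)+

lemma E_E [simp]: "direction (direction f) = f"
  by (rule fsv_eqI) simp

lemma X_E: "position (direction f) = direction (position f)"
  by (rule fsv_eqI) simp

lemma norm_E [simp]: "norm (direction f) = norm f"
proof -
  have "norm (direction g) \<le> 1 * norm g" for g by (rule norm_le_of_coord_le) auto
  from this[of f] this[of "direction f"] show ?thesis by simp
qed

lemma inner_X: "inner (position f) g = inner f (position g)"
proof -
  obtain n where n: "supp_in n f" using supp_in_exists by blast
  hence "supp_in n (position f)" by (simp add: supp_in_def)
  thus ?thesis using n
    by (simp add: inner_supp_in[of n] algebra_simps)
qed

lemma supp_in_XE [intro]: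
  "supp_in n f \<Longrightarrow> supp_in n (position f)" "supp_in n f \<Longrightarrow> supp_in n (direction f)"
  by (simp_all add: supp_in_def)

lemma norm_X_le:
  assumes "supp_in n f"
  shows "norm (position f) \<le> real n * norm f"
proof (rule norm_le_of_coord_le)
  fix y
  show "\<bar>coord (position f) y\<bar> \<le> real n * \<bar>coord f y\<bar>"
  proof (cases "\<bar>y\<bar> > int n")
    case True
    thus ?thesis using supp_inD[OF assms] by simp
  next
    case False
    hence "\<bar>real_of_int y\<bar> \<le> real n" by linarith
    thus ?thesis by (simp add: abs_mult mult_right_mono)
  qed
qed simp

locale wall_walk =
  fixes a b s :: real
  assumes a_pos: "a > 0" and b_pos: "b > 0" and a2: "a\<^sup>2 = 1 - b\<^sup>2" and s: "s = 1 \<or> s = -1"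
begin

abbreviation U :: "fsv \<Rightarrow> fsv" where "U \<equiv> walk_op a b s"
abbreviation Ui :: "fsv \<Rightarrow> fsv" where "Ui \<equiv> walk_inv a b s"

definition M :: "fsv \<Rightarrow> fsv" where "M f = U f + Ui f"
definition D :: "fsv \<Rightarrow> fsv" where "D f = U f - Ui f"
text \<open>\<open>K\<close> is the commutator of \<open>position\<close> and \<open>M\<close>.\<close>
definition K :: "fsv \<Rightarrow> fsv" where "K f = direction (U f) - Ui (direction f)"

lemma s_s [simp]: "s * s = 1" "s * (s * x) = x"
  using s by auto

lemma aa: "a * a = 1 - b * b"
  using a2 by (simp add: power2_eq_square)

lemma aa': "a * (a * x) = x - b * (b * x)"
  using aa by (metis left_diff_distrib mult.assoc mult_1)

lemma b_less_1: "b < 1"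
proof -
  have "b\<^sup>2 < 1\<^sup>2" using a2 a_pos by (metis diff_gt_0_iff_gt power_one zero_less_power)
  thus ?thesis by (rule power_less_imp_less_base) simp
qed

lemma a_less_1: "a < 1"
proof -
  have "a\<^sup>2 < 1\<^sup>2" using a2 b_pos by simp
  thus ?thesis by (rule power_less_imp_less_base) simp
qed

lemma coord_U: "coord (U f) y = (if y \<le> 0 then a * coord f (y - 1) - b * coord f (1 - y)
     else if y = 1 then s * coord f 0 else b * coord f (1 - y) + a * coord f (y - 1))"
  by transfer simp

lemma coord_Ui: "coord (Ui f) y = (if y < 0 then a * coord f (y + 1) + b * coord f (1 - y)
     else if y = 0 then s * coord f 1 else a * coord f (y + 1) - b * coord f (1 - y))"
  by transfer simp

lemma linear_U [simp]:
  "U (f + g) = U f + U g" "U (f - g) = U f - U g" "U (c *\<^sub>R f) = c *\<^sub>R U f"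
  by (rule fsv_eqI; simp add: coord_U algebra_simps)+

lemma linear_Ui [simp]:
  "Ui (f + g) = Ui f + Ui g" "Ui (f - g) = Ui f - Ui g" "Ui (c *\<^sub>R f) = c *\<^sub>R Ui f"
  by (rule fsv_eqI; simp add: coord_Ui algebra_simps)+

lemma U_Ui [simp]: "U (Ui f) = f"
  by (rule fsv_eqI) (auto simp: coord_U coord_Ui algebra_simps aa')

lemma Ui_U [simp]: "Ui (U f) = f"
  by (rule fsv_eqI) (auto simp: coord_U coord_Ui algebra_simps aa')

lemma supp_in_U [intro]: "supp_in n f \<Longrightarrow> supp_in (Suc n) (U f)"
  and supp_in_Ui [intro]: "supp_in n f \<Longrightarrow> supp_in (Suc n) (Ui f)"
  by (auto simp: supp_in_def coord_U coord_Ui)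

lemma inner_U: "inner (U f) g = inner f (Ui g)"
proof -
  obtain n0 m0 where "supp_in n0 f" "supp_in m0 g" using supp_in_exists by metis
  then obtain n where n: "supp_in n f" "supp_in n g" using supp_in_mono nat_le_linear by metis
  define f' g' where "f' = coord f" "g' = coord g"
  have f': "\<And>y. \<bar>y\<bar> > int n \<Longrightarrow> f' y = 0" and g': "\<And>y. \<bar>y\<bar> > int n \<Longrightarrow> g' y = 0"
    using n by (auto simp: f'_g'_def supp_in_def)
  \<comment> \<open>Coefficient tables that remove the case distinction of \<open>coord_U\<close>:
    \<open>nz\<close> switches off the hop across the bond {0, 1}, and \<open>sg\<close> is the sign
    of the reflection from 1 - y to y. The entry with phase \<open>s\<close> is carried separately
    as a term supported at y = 1. The margin 2 in the summation range keeps the reindexed intervals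
    from losing any nonzero term.\<close>
  define sg :: "int \<Rightarrow> real" where "sg = (\<lambda>y. if y \<le> 0 then -1 else if y = 1 then 0 else 1)"
  define nz :: "int \<Rightarrow> real" where "nz = (\<lambda>y. if y = 1 then 0 else 1)"
  let ?N = "int n + 2"
  let ?I = "{- ?N..?N}" and ?J = "{- ?N - 1..?N - 1}" and ?L = "{- ?N + 1..?N + 1}"
  have "inner (U f) g = (\<Sum>y\<in>?I. coord (U f) y * g' y)"
    unfolding f'_g'_def
    by (rule inner_fsv_on) (use n in \<open>auto simp: supp_in_def\<close>)
  also have "\<dots> = (\<Sum>y\<in>?I. a * nz y * f' (y - 1) * g' y + b * sg y * f' (1 - y) * g' y +
      (if y = 1 then s * f' 0 * g' 1 else 0))"
    by (rule sum.cong) (auto simp: coord_U f'_g'_def algebra_simps nz_def sg_def)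
  also have "\<dots> = (\<Sum>y\<in>?I. a * nz y * f' (y - 1) * g' y) +
      (\<Sum>y\<in>?I. b * sg y * f' (1 - y) * g' y) + s * f' 0 * g' 1"
    by (simp add: sum.distrib)
  also have "(\<Sum>y\<in>?I. a * nz y * f' (y - 1) * g' y) =
      (\<Sum>y\<in>?J. a * nz (y + 1) * f' y * g' (y + 1))"
    by (rule sum.reindex_bij_witness[of _ "\<lambda>y. y + 1" "\<lambda>y. y - 1"]) auto
  also have "\<dots> = (\<Sum>y\<in>?I. a * nz (y + 1) * f' y * g' (y + 1))"
    by (rule sum.mono_neutral_cong) (auto simp: f')
  also have "(\<Sum>y\<in>?I. b * sg y * f' (1 - y) * g' y) =
      (\<Sum>y\<in>?L. b * sg (1 - y) * f' y * g' (1 - y))"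
    by (rule sum.reindex_bij_witness[of _ "\<lambda>y. 1 - y" "\<lambda>y. 1 - y"]) auto
  also have "\<dots> = (\<Sum>y\<in>?I. b * sg (1 - y) * f' y * g' (1 - y))"
    by (rule sum.mono_neutral_cong) (auto simp: f')
  also have "(\<Sum>y\<in>?I. a * nz (y + 1) * f' y * g' (y + 1)) +
      (\<Sum>y\<in>?I. b * sg (1 - y) * f' y * g' (1 - y)) + s * f' 0 * g' 1 =
      (\<Sum>y\<in>?I. a * nz (y + 1) * f' y * g' (y + 1) + b * sg (1 - y) * f' y * g' (1 - y) +
         (if y = 0 then s * f' 0 * g' 1 else 0))"
    by (simp add: sum.distrib)
  also have "\<dots> = (\<Sum>y\<in>?I. f' y * coord (Ui g) y)"
    by (rule sum.cong) (auto simp: coord_Ui f'_g'_def algebra_simps nz_def sg_def)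
  also have "\<dots> = inner f (Ui g)"
    unfolding f'_g'_def
    by (rule inner_fsv_on[symmetric]) (use n in \<open>auto simp: supp_in_def\<close>)
  finally show ?thesis .
qed

lemma inner_U_U [simp]: "inner (U f) (U g) = inner f g"
  by (simp add: inner_U)

lemma norm_U [simp]: "norm (U f) = norm f"
  by (simp add: norm_eq_sqrt_inner)

lemma norm_Ui [simp]: "norm (Ui f) = norm f"
  by (metis U_Ui norm_U)

lemma inner_Ui: "inner (Ui f) g = inner f (U g)"
  by (metis inner_U inner_commute)

lemma linear_MDK [simp]:
  "M (f + g) = M f + M g" "M (f - g) = M f - M g" "M (c *\<^sub>R f) = c *\<^sub>R M f"
  "D (f + g) = D f + D g" "D (f - g) = D f - D g" "D (c *\<^sub>R f) = c *\<^sub>R D f"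
  "K (f + g) = K f + K g" "K (f - g) = K f - K g" "K (c *\<^sub>R f) = c *\<^sub>R K f"
  by (simp_all add: M_def D_def K_def algebra_simps)

lemma inner_M: "inner (M f) g = inner f (M g)"
  by (simp add: M_def inner_U inner_Ui inner_simps)

lemma norm_MDK_le:
  "norm (M f) \<le> 2 * norm f" "norm (D f) \<le> 2 * norm f" "norm (K f) \<le> 2 * norm f"
  unfolding M_def D_def K_def
  by (rule order_trans[OF norm_triangle_ineq] order_trans[OF norm_triangle_ineq4]; simp)+

lemma M_U: "M (U f) = U (M f)" and D_U: "D (U f) = U (D f)" and M_D: "M (D f) = D (M f)"
  by (simp_all add: M_def D_def)

lemma D_D: "D (D f) = M (M f) - 4 *\<^sub>R f"
proof -
  have "M (M f) - D (D f) = 2 *\<^sub>R f + 2 *\<^sub>R f" by (simp add: M_def D_def scaleR_2)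
  also have "\<dots> = 4 *\<^sub>R f" by (simp flip: scaleR_left.add)
  finally show ?thesis by (simp add: algebra_simps)
qed

text \<open>Every transition changes |y| by exactly one, and the sign depends only on the arrival
  site: -1 for y <= 0, +1 for y >= 1.\<close>

lemma X_U: "position (U f) = U (position f) + direction (U f)"
  by (rule fsv_eqI) (auto simp: coord_U algebra_simps abs_if)

lemma X_Ui: "position (Ui f) = Ui (position f) - Ui (direction f)"
proof -
  have "Ui (position (U (Ui f))) = Ui (U (position (Ui f)) + direction (U (Ui f)))" by (simp only: X_U)
  thus ?thesis by (simp add: algebra_simps)
qed

text \<open>Since \<open>direction\<close> is an involution commuting with \<open>position\<close>,
  the commutator of \<open>position\<close> with \<open>direction (U f)\<close> is
  \<open>U f\<close>, and that with \<open>Ui (direction f)\<close> is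
  \<open>- Ui f\<close>.\<close>

lemma X_K: "position (K f) = K (position f) + M f"
  by (simp add: M_def K_def X_U X_Ui X_E)

text \<open>In the bulk the coin matrix in momentum space has determinant 1, so U + U^(-1) is its
  trace 2 a cos k times the identity. Its commutator \<open>K\<close> with the position is then
  scalar too: \<open>K f\<close> at y is a (f (y - 1) - f (y + 1)) on the right and the negative of
  this on the left. Hence it commutes with \<open>U\<close> except near the wall.\<close>

lemma K_U_local:
  assumes "\<bar>y\<bar> \<ge> 4"
  shows "coord (K (U f) - U (K f)) y = 0"
  using assms
  by (cases "y \<ge> 4") (auto simp: K_def coord_U coord_Ui algebra_simps aa')

text \<open>In the bulk \<open>K\<close> and \<open>M\<close> are the difference and the sum of the
  two shifts, up to sign and the factor a; their squares differ by 4 a^2 since the shifts are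
  inverse to each other.\<close>

lemma K_K_local:
  assumes "\<bar>y\<bar> \<ge> 4"
  shows "coord (K (K f) - M (M f) + (4 * a\<^sup>2) *\<^sub>R f) y = 0"
  using assms
  by (cases "y \<ge> 4") (auto simp: K_def M_def coord_U coord_Ui algebra_simps aa' aa power2_eq_square)

lemma supp_in_M [intro]: "supp_in n f \<Longrightarrow> supp_in (Suc n) (M f)"
  and supp_in_D [intro]: "supp_in n f \<Longrightarrow> supp_in (Suc n) (D f)"
  and supp_in_K [intro]: "supp_in n f \<Longrightarrow> supp_in (Suc n) (K f)"
  unfolding M_def D_def K_def by blast+

lemma coord_M: "coord (M f) y =
  (if y = 0 then a * coord f (-1) + (s - b) * coord f 1
   else if y = 1 then (s - b) * coord f 0 + a * coord f 2
   else a * (coord f (y + 1) + coord f (y - 1)))"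
  by (auto simp: M_def coord_U coord_Ui algebra_simps)

end

section \<open>Ballistic growth of the position\<close>

text \<open>A case of Kronecker's lemma, by dominated convergence for series: each term vanishes as
  t grows and is dominated by \<open>c k\<close>.\<close>

lemma weighted_mean_tendsto_0:
  fixes c :: "nat \<Rightarrow> real"
  assumes "summable c" "\<And>n. c n \<ge> 0"
  shows "(\<lambda>t. (\<Sum>k<t. real k * c k) / real t) \<longlonglongrightarrow> 0"
proof -
  define f where "f = (\<lambda>k t. if k < t then real k * c k / real t else 0)"
  have lim: "(\<lambda>t. f k t) \<longlonglongrightarrow> 0" for k
  proof -
    have "(\<lambda>t. real k * c k / real t) \<longlonglongrightarrow> 0" by real_asymp
    moreover have "\<forall>\<^sub>F t in sequentially. real k * c k / real t = f k t"
      using eventually_gt_at_top[of k] by eventually_elim (simp add: f_def)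
    ultimately show ?thesis by (rule Lim_transform_eventually)
  qed
  have bound: "norm (f k t) \<le> c k" for k t
    using assms(2)[of k] by (auto simp: f_def divide_le_eq mult.commute mult_right_mono)
  have "\<forall>\<^sub>F (k, t) in sequentially \<times>\<^sub>F sequentially. norm (f k t) \<le> c k"
    by (rule always_eventually) (use bound in auto)
  from tannerys_theorem[OF lim this assms(1)]
  have "(\<lambda>t. \<Sum>k. f k t) \<longlonglongrightarrow> (\<Sum>k. 0)" by simp
  moreover have "(\<Sum>k. f k t) = (\<Sum>k<t. real k * c k) / real t" for t
  proof -
    have "(\<Sum>k. f k t) = (\<Sum>k<t. f k t)" by (rule suminf_finite) (auto simp: f_def)
    thus ?thesis by (simp add: f_def sum_divide_distrib)
  qed
  ultimately show ?thesis by simp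
qed

text \<open>No uniformity in the site is asked for, because the boundary terms to be controlled have
  support bounded independently of time.\<close>

definition locally_summable :: "(nat \<Rightarrow> fsv) \<Rightarrow> bool" where
  "locally_summable z \<longleftrightarrow> (\<forall>y. summable (\<lambda>t. \<bar>coord (z t) y\<bar>))"

lemma summable_abs_linear:
  fixes u v :: "nat \<Rightarrow> real"
  assumes "summable (\<lambda>t. \<bar>u t\<bar>)" "summable (\<lambda>t. \<bar>v t\<bar>)"
  shows "summable (\<lambda>t. \<bar>c * u t + d * v t\<bar>)"
proof (rule summable_comparison_test')
  show "summable (\<lambda>t. \<bar>c\<bar> * \<bar>u t\<bar> + \<bar>d\<bar> * \<bar>v t\<bar>)"
    by (intro summable_add summable_mult assms)
  show "norm \<bar>c * u t + d * v t\<bar> \<le> \<bar>c\<bar> * \<bar>u t\<bar> + \<bar>d\<bar> * \<bar>v t\<bar>" if "t \<ge> 0" for t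
    by (simp add: abs_triangle_ineq flip: abs_mult)
qed

lemma locally_summable_scaleR: "locally_summable z \<Longrightarrow> locally_summable (\<lambda>t. c *\<^sub>R z t)"
  by (simp add: locally_summable_def abs_mult summable_mult)

lemma locally_summable_add_diff:
  assumes "locally_summable z" "locally_summable w"
  shows "locally_summable (\<lambda>t. z t + w t)" "locally_summable (\<lambda>t. z t - w t)"
  using assms summable_abs_linear[of "\<lambda>t. coord (z t) _" "\<lambda>t. coord (w t) _" 1 1]
    summable_abs_linear[of "\<lambda>t. coord (z t) _" "\<lambda>t. coord (w t) _" 1 "-1"]
  by (auto simp: locally_summable_def)

lemmas locally_summable_linear = locally_summable_add_diff locally_summable_scaleR

lemma locally_summable_E: "locally_summable z \<Longrightarrow> locally_summable (\<lambda>t. direction (z t))"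
  by (simp add: locally_summable_def abs_mult summable_mult)

lemma locally_summable_norm:
  assumes "locally_summable z" "\<And>t. supp_in n (z t)"
  shows "summable (\<lambda>t. norm (z t))"
proof (rule summable_comparison_test')
  show "summable (\<lambda>t. \<Sum>y\<in>{- int n..int n}. \<bar>coord (z t) y\<bar>)"
    using assms(1) by (intro summable_sum) (simp add: locally_summable_def)
  show "norm (norm (z t)) \<le> (\<Sum>y\<in>{- int n..int n}. \<bar>coord (z t) y\<bar>)" for t
    using norm_le_sum_coord[OF assms(2)] by simp
qed

context wall_walk
begin

lemma locally_summable_U: "locally_summable z \<Longrightarrow> locally_summable (\<lambda>t. U (z t))"
  unfolding locally_summable_def coord_U
proof safe
  fix y assume z: "\<forall>y. summable (\<lambda>t. \<bar>coord (z t) y\<bar>)"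
  show "summable (\<lambda>t. \<bar>if y \<le> 0 then a * coord (z t) (y - 1) - b * coord (z t) (1 - y)
        else if y = 1 then s * coord (z t) 0
        else b * coord (z t) (1 - y) + a * coord (z t) (y - 1)\<bar>)"
    using z summable_abs_linear[of "\<lambda>t. coord (z t) (y - 1)" "\<lambda>t. coord (z t) (1 - y)" a "-b"]
      summable_abs_linear[of "\<lambda>t. coord (z t) (1 - y)" "\<lambda>t. coord (z t) (y - 1)" b a]
      summable_abs_linear[of "\<lambda>t. coord (z t) 0" "\<lambda>t. coord (z t) 0" s 0]
    by (cases "y \<le> 0"; cases "y = 1") simp_all
qed

lemma locally_summable_Ui: "locally_summable z \<Longrightarrow> locally_summable (\<lambda>t. Ui (z t))"
  unfolding locally_summable_def coord_Ui
proof safe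
  fix y assume z: "\<forall>y. summable (\<lambda>t. \<bar>coord (z t) y\<bar>)"
  show "summable (\<lambda>t. \<bar>if y < 0 then a * coord (z t) (y + 1) + b * coord (z t) (1 - y)
     else if y = 0 then s * coord (z t) 1 else a * coord (z t) (y + 1) - b * coord (z t) (1 - y)\<bar>)"
    using z summable_abs_linear[of "\<lambda>t. coord (z t) (y + 1)" "\<lambda>t. coord (z t) (1 - y)" a "-b"]
      summable_abs_linear[of "\<lambda>t. coord (z t) (y + 1)" "\<lambda>t. coord (z t) (1 - y)" a b]
      summable_abs_linear[of "\<lambda>t. coord (z t) 1" "\<lambda>t. coord (z t) 1" s 0]
    by (cases "y < 0"; cases "y = 0") simp_all
qed

lemma locally_summable_MDK:
  assumes "locally_summable z"
  shows "locally_summable (\<lambda>t. M (z t))" "locally_summable (\<lambda>t. D (z t))"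
    "locally_summable (\<lambda>t. K (z t))"
  unfolding M_def D_def K_def
  by (intro locally_summable_linear locally_summable_U locally_summable_Ui locally_summable_E assms)+

abbreviation orbit :: "fsv \<Rightarrow> nat \<Rightarrow> fsv" where "orbit f t \<equiv> (U ^^ t) f"

lemma orbit_linear:
  "orbit (f + g) t = orbit f t + orbit g t" "orbit (f - g) t = orbit f t - orbit g t"
  "orbit (c *\<^sub>R f) t = c *\<^sub>R orbit f t"
  by (induction t) auto

lemma orbit_U: "orbit (U f) t = U (orbit f t)"
  by (induction t) auto

lemma orbit_Ui: "orbit (Ui f) t = Ui (orbit f t)"
  by (metis U_Ui Ui_U orbit_U)

lemma orbit_MD: "orbit (M f) t = M (orbit f t)" "orbit (D f) t = D (orbit f t)"
  by (simp_all add: M_def D_def orbit_linear orbit_U orbit_Ui)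

lemma norm_orbit [simp]: "norm (orbit f t) = norm f"
  by (induction t) auto

lemma inner_orbit [simp]: "inner (orbit f t) (orbit g t) = inner f g"
  by (induction t) auto

lemma supp_in_orbit: "supp_in n f \<Longrightarrow> supp_in (n + t) (orbit f t)"
  by (induction t) auto

text \<open>\<open>X D - t K - U\<^sup>-\<^sup>1 E\<close> is conserved up to the boundary term \<open>t (K U - U K)\<close>: since
  \<open>K\<close> is \<open>D\<close> times the velocity, this says that the position grows like \<open>t\<close> times the velocity.\<close>
lemma position_velocity:
  assumes "locally_summable (orbit f)"
  shows "(\<lambda>t. norm (position (D (orbit f t)) - real t *\<^sub>R K (orbit f t)) / real t) \<longlonglongrightarrow> 0"
proof -
  define z where "z = orbit f"
  define p where "p = (\<lambda>t. position (D (z t)) - real t *\<^sub>R K (z t) - Ui (direction (z t)))"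
  define q where "q = (\<lambda>t. K (U (z t)) - U (K (z t)))"
  have p_Suc: "p (Suc t) = U (p t) - real t *\<^sub>R q t" for t
  proof -
    \<comment> \<open>Moving \<open>position\<close> past \<open>U\<close> produces
      \<open>direction (U (D (z t)))\<close>. Together with the change of the correction
      \<open>Ui (direction (z t))\<close> this is exactly one copy of \<open>K (U (z t))\<close>,
      which pays for t growing to t + 1.\<close>
    have "p (Suc t) - U (p t) + real t *\<^sub>R q t = 0"
      by (rule fsv_eqI) (simp add: p_def q_def z_def X_U X_Ui X_E D_U K_def D_def algebra_simps)
    thus ?thesis by (simp add: algebra_simps)
  qed
  have p_le: "norm (p t) \<le> norm (p 0) + (\<Sum>k<t. real k * norm (q k))" for t
  proof (induction t)
    case (Suc t)
    have "norm (p (Suc t)) \<le> norm (p t) + real t * norm (q t)"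
      unfolding p_Suc by (rule order_trans[OF norm_triangle_ineq4]) simp
    thus ?case using Suc by simp
  qed simp
  have "summable (\<lambda>t. norm (q t))"
  proof (rule locally_summable_norm)
    show "locally_summable q"
      unfolding q_def z_def
      by (intro locally_summable_linear locally_summable_U locally_summable_MDK assms)
    show "supp_in 3 (q t)" for t
      unfolding supp_in_def q_def using K_U_local by simp
  qed
  hence lim: "(\<lambda>t. norm (p 0) / real t + (\<Sum>k<t. real k * norm (q k)) / real t + norm f / real t)
      \<longlonglongrightarrow> 0 + 0 + 0"
    by (intro tendsto_add weighted_mean_tendsto_0) (real_asymp | simp)+
  show ?thesis
  proof (rule tendsto_sandwich[OF _ _ tendsto_const])
    show "\<forall>\<^sub>F t in sequentially. norm (position (D (orbit f t)) - real t *\<^sub>R K (orbit f t)) / real t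
      \<le> norm (p 0) / real t + (\<Sum>k<t. real k * norm (q k)) / real t + norm f / real t"
    proof (rule always_eventually, rule allI)
      fix t
      have "norm (position (D (orbit f t)) - real t *\<^sub>R K (orbit f t)) = norm (p t + Ui (direction (z t)))"
        by (simp add: p_def z_def)
      also have "\<dots> \<le> norm (p t) + norm f"
        by (rule order_trans[OF norm_triangle_ineq]) (simp add: z_def)
      also have "\<dots> \<le> norm (p 0) + (\<Sum>k<t. real k * norm (q k)) + norm f"
        using p_le[of t] by simp
      finally show "norm (position (D (orbit f t)) - real t *\<^sub>R K (orbit f t)) / real t
        \<le> norm (p 0) / real t + (\<Sum>k<t. real k * norm (q k)) / real t + norm f / real t"
        by (simp add: divide_right_mono flip: add_divide_distrib)
    qed
  qed (use lim in auto)
qed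

text \<open>The velocity law is used for \<open>D f\<close> and for \<open>f\<close>: X X D D is
  replaced by t X K D, then \<open>K\<close> is moved past \<open>position\<close> at the cost of
  \<open>M\<close> (\<open>X_K\<close>), and X D is replaced by t K. The outer
  \<open>position\<close> is unbounded but multiplies the first error by at most n + t + 2, as
  supports grow by one site per step; that error is o(t).\<close>

lemma position_velocity_squared:
  assumes "locally_summable (orbit f)"
  shows "(\<lambda>t. norm (position (position (D (D (orbit f t)))) -
    (real t)\<^sup>2 *\<^sub>R (M (M (orbit f t)) - (4 * a\<^sup>2) *\<^sub>R orbit f t)) / (real t)\<^sup>2) \<longlonglongrightarrow> 0"
proof -
  obtain n where n: "supp_in n f" using supp_in_exists by blast
  define z where "z = orbit f"
  define g where "g = (\<lambda>t. position (D (z t)) - real t *\<^sub>R K (z t))"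
  define h where "h = (\<lambda>t. position (D (D (z t))) - real t *\<^sub>R K (D (z t)))"
  define l where "l = (\<lambda>t. K (K (z t)) - M (M (z t)) + (4 * a\<^sup>2) *\<^sub>R z t)"
  have g: "(\<lambda>t. norm (g t) / real t) \<longlonglongrightarrow> 0"
    using position_velocity[OF assms] by (simp add: g_def z_def)
  have "locally_summable (orbit (D f))"
    using locally_summable_MDK(2)[OF assms] by (simp add: orbit_MD)
  from position_velocity[OF this] have h: "(\<lambda>t. norm (h t) / real t) \<longlonglongrightarrow> 0"
    by (simp add: h_def z_def orbit_MD)
  have "summable (\<lambda>t. norm (l t))"
  proof (rule locally_summable_norm)
    show "locally_summable l"
      unfolding l_def z_def by (intro locally_summable_linear locally_summable_MDK assms)
    show "supp_in 3 (l t)" for t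
      unfolding supp_in_def l_def using K_K_local by simp
  qed
  hence l: "(\<lambda>t. norm (l t)) \<longlonglongrightarrow> 0" by (rule summable_LIMSEQ_zero)
  have eq: "position (position (D (D (z t)))) - (real t)\<^sup>2 *\<^sub>R (M (M (z t)) - (4 * a\<^sup>2) *\<^sub>R z t) =
    (real t)\<^sup>2 *\<^sub>R l t + real t *\<^sub>R K (g t) + real t *\<^sub>R M (D (z t)) + position (h t)" for t
    by (rule fsv_eqI) (simp add: l_def g_def h_def X_K algebra_simps power2_eq_square)
  have supp_h: "supp_in (n + t + 2) (h t)" for t
  proof -
    have "supp_in (n + t) (z t)" using n by (simp add: z_def supp_in_orbit)
    hence "supp_in (Suc (Suc (n + t))) (h t)"
      unfolding h_def by (intro supp_in_linear supp_in_XE supp_in_K supp_in_D)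
    thus ?thesis by simp
  qed
  have bound: "norm (position (position (D (D (z t)))) - (real t)\<^sup>2 *\<^sub>R (M (M (z t)) - (4 * a\<^sup>2) *\<^sub>R z t)) \<le>
    (real t)\<^sup>2 * norm (l t) + 2 * real t * norm (g t) + real t * (4 * norm f)
      + real (n + t + 2) * norm (h t)" for t
  proof -
    have "norm (M (D (z t))) \<le> 4 * norm f"
      using norm_MDK_le(1)[of "D (z t)"] norm_MDK_le(2)[of "z t"] by (simp add: z_def)
    hence "real t * norm (M (D (z t))) \<le> real t * (4 * norm f)" by (rule mult_left_mono) simp
    moreover have "real t * norm (K (g t)) \<le> real t * (2 * norm (g t))"
      by (intro mult_left_mono norm_MDK_le) simp
    moreover note norm_X_le[OF supp_h[of t]]
    ultimately show ?thesis
      unfolding eq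
      by (intro order_trans[OF norm_triangle_ineq] add_mono) (simp_all add: mult_ac)
  qed
  have "(\<lambda>t. norm (l t) + 2 * (norm (g t) / real t) + 4 * norm f / real t +
      real (n + t + 2) / real t * (norm (h t) / real t)) \<longlonglongrightarrow> 0 + 2 * 0 + 0 + 1 * 0"
    by (intro tendsto_add tendsto_mult tendsto_const g h l) real_asymp+
  hence lim: "(\<lambda>t. norm (l t) + 2 * (norm (g t) / real t) + 4 * norm f / real t +
      real (n + t + 2) / real t * (norm (h t) / real t)) \<longlonglongrightarrow> 0" by simp
  show ?thesis
  proof (rule tendsto_sandwich[OF _ _ tendsto_const lim])
    show "\<forall>\<^sub>F t in sequentially. norm (position (position (D (D (orbit f t)))) -
        (real t)\<^sup>2 *\<^sub>R (M (M (orbit f t)) - (4 * a\<^sup>2) *\<^sub>R orbit f t)) / (real t)\<^sup>2 \<le>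
      norm (l t) + 2 * (norm (g t) / real t) + 4 * norm f / real t +
      real (n + t + 2) / real t * (norm (h t) / real t)"
      using eventually_gt_at_top[of 0]
    proof eventually_elim
      case (elim t)
      have "norm (position (position (D (D (z t)))) - (real t)\<^sup>2 *\<^sub>R (M (M (z t)) - (4 * a\<^sup>2) *\<^sub>R z t)) / (real t)\<^sup>2
        \<le> ((real t)\<^sup>2 * norm (l t) + 2 * real t * norm (g t) + real t * (4 * norm f)
      + real (n + t + 2) * norm (h t)) / (real t)\<^sup>2"
        by (intro divide_right_mono bound) simp
      also have "\<dots> = norm (l t) + 2 * (norm (g t) / real t) + 4 * norm f / real t +
      real (n + t + 2) / real t * (norm (h t) / real t)"
        using elim by (simp add: field_simps power2_eq_square)
      finally show ?case by (simp add: z_def)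
    qed
  qed auto
qed

end

section \<open>Decay near the wall\<close>

unbundle no vec_syntax
unbundle fps_syntax

text \<open>The recurrence of the coefficients says that c (n + 1) is twice the decrease of n c n
  from n + 1 to n + 2. The partial sums telescope, and no asymptotics of binomial coefficients are
  required.\<close>

lemma summable_abs_half_gchoose: "summable (\<lambda>n. \<bar>(1/2 :: real) gchoose n\<bar>)"
proof -
  define c where "c = (\<lambda>n. \<bar>(1/2 :: real) gchoose n\<bar>)"
  have rec: "real (Suc (Suc n)) * c (Suc (Suc n)) = (real (Suc n) - 1/2) * c (Suc n)" for n
  proof -
    have "real (Suc (Suc n)) * ((1/2 :: real) gchoose Suc (Suc n))
        = (1/2 - real (Suc n)) * ((1/2 :: real) gchoose Suc n)"
      using gbinomial_mult_1[of "1/2 :: real" "Suc n"] by (simp add: algebra_simps)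
    hence "\<bar>real (Suc (Suc n)) * ((1/2 :: real) gchoose Suc (Suc n))\<bar>
        = \<bar>(1/2 - real (Suc n)) * ((1/2 :: real) gchoose Suc n)\<bar>" by simp
    thus ?thesis by (simp add: c_def abs_mult)
  qed
  have tel: "(\<Sum>n<N. c (Suc n)) = 2 * (c 1 - real (Suc N) * c (Suc N))" for N
  proof (induction N)
    case (Suc N)
    thus ?case using rec[of N] by (simp add: algebra_simps)
  qed simp
  have "summable (\<lambda>n. c (Suc n))"
  proof (rule summableI_nonneg_bounded)
    show "0 \<le> c (Suc n)" for n by (simp add: c_def)
    show "(\<Sum>n<N. c (Suc n)) \<le> 2 * c 1" for N
      unfolding tel by (simp add: c_def)
  qed
  hence "summable c" using summable_Suc_iff[of c] by blast
  thus ?thesis by (simp add: c_def)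
qed

text \<open>Membership in the Wiener algebra of the closed disc; closure under products lets each
  singularity on the unit circle be treated alone.\<close>

definition abs_summable_fps :: "complex fps \<Rightarrow> bool" where
  "abs_summable_fps F \<longleftrightarrow> summable (\<lambda>n. norm (F $ n))"

lemma abs_summable_fps_mult:
  assumes "abs_summable_fps F" "abs_summable_fps G"
  shows "abs_summable_fps (F * G)"
  unfolding abs_summable_fps_def
proof (rule summable_comparison_test')
  show "summable (\<lambda>n. \<Sum>i\<le>n. norm (F $ i) * norm (G $ (n - i)))"
    using assms by (intro summable_Cauchy_product) (auto simp: abs_summable_fps_def)
  show "norm (norm ((F * G) $ n)) \<le> (\<Sum>i\<le>n. norm (F $ i) * norm (G $ (n - i)))" for n
    unfolding fps_mult_nth atMost_atLeast0
    by (simp add: sum_norm_le norm_mult)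
qed

definition sqrt_fps :: "complex \<Rightarrow> complex fps" where
  "sqrt_fps \<alpha> = Abs_fps (\<lambda>n. (1/2 gchoose n) * (- \<alpha>) ^ n)"

lemma sqrt_fps_square: "sqrt_fps \<alpha> * sqrt_fps \<alpha> = 1 - fps_const \<alpha> * fps_X"
proof -
  have eq: "sqrt_fps \<alpha> = fps_binomial (1/2) oo (fps_const (- \<alpha>) * fps_X)"
    unfolding sqrt_fps_def fps_compose_linear by (rule fps_ext) (simp add: mult.commute)
  have "sqrt_fps \<alpha> * sqrt_fps \<alpha> = (fps_binomial (1/2) * fps_binomial (1/2)) oo (fps_const (- \<alpha>) * fps_X)"
    unfolding eq by (simp add: fps_compose_mult_distrib)
  also have "fps_binomial (1/2) * fps_binomial (1/2) = (1 + fps_X :: complex fps)"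
    by (simp flip: fps_binomial_add_mult add: fps_binomial_1)
  finally show ?thesis by (simp add: fps_compose_add_distrib flip: fps_const_neg)
qed

lemma abs_summable_sqrt_fps:
  assumes "norm \<alpha> = 1"
  shows "abs_summable_fps (sqrt_fps \<alpha>)"
proof -
  have "(1/2 :: complex) gchoose n = of_real ((1/2 :: real) gchoose n)" for n
    by (simp add: gbinomial_prod_rev)
  thus ?thesis
    using summable_abs_half_gchoose
    by (simp add: abs_summable_fps_def sqrt_fps_def norm_mult norm_power assms)
qed

section \<open>Identities behind the generating functions, isolated in an abstract integral
  domain\<close>

lemma product_of_conjugate_factors:
  fixes u v z :: "'a :: idom"
  assumes "u * v = 1"
  shows "(1 - u * z) * (1 - v * z) * ((1 + u * z) * (1 + v * z)) =
    (1 + z * z) * (1 + z * z) - (u + v) * (u + v) * (z * z)"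
  using assms by algebra

text \<open>The quadratic formula on the minus branch, with \<open>I\<close> in the role of 1 / (2
  A) and \<open>d\<close> a square root of the discriminant.\<close>

lemma quadratic_root:
  fixes A I Y d z :: "'a :: idom"
  assumes i: "2 * A * I = 1" and d: "d * d = Y * Y - 4 * A * A * (z * z)"
  shows "A * (I * (Y - d) * (I * (Y - d))) = Y * (I * (Y - d)) - A * (z * z)"
proof -
  have "A * (I * (Y - d) * (I * (Y - d))) = (2 * A * I) * (I * (Y * (Y - d))) -
      (2 * A * I) * (2 * A * I) * (A * (z * z)) + A * I * I * (d * d - (Y * Y - 4 * A * A * (z * z)))"
    by (simp add: algebra_simps)
  also have "\<dots> = Y * (I * (Y - d)) - A * (z * z)"
    unfolding i d by (simp add: mult_ac)
  finally show ?thesis .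
qed

text \<open>With l = \<open>lam\<close> and I = 1 / b this is the recurrence of the walk at y < 0
  for amplitudes geometric in |y|, after the common factor is removed.\<close>

lemma left_site_relation:
  fixes A B I l z :: "'a :: idom"
  assumes "A * A = 1 - B * B" "B * I = 1" "A * (z * l * l) = (1 + z * z) * l - A * z"
  shows "I * (l - A * z) = z * (A * l * (I * (l - A * z)) - B * (z * l))"
  using assms by algebra

lemma right_site_relation:
  fixes A B I l z :: "'a :: idom"
  assumes "B * I = 1"
  shows "l = B * (I * (l - A * z)) + A * z"
  using assms by algebra

text \<open>The claimed equation is linear in w, with solution B / (B - S (A z l - z^2)). The
  quadratic equation of l rationalizes this to (1 - P z l) / (1 - z^2), which exhibits the possible
  poles; P stands for s a / (s - b).\<close>

lemma wall_relation:
  fixes A B I S P l w z :: "'a :: idom"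
  assumes "A * A = 1 - B * B" "B * I = 1" "S * S = 1" "P * (S - B) = S * A" "P * A = 1 + S * B"
    and l: "A * (z * l * l) = (1 + z * z) * l - A * z"
    and w: "w * (1 - z * z) = 1 - P * (z * l)" "1 - z * z \<noteq> 0"
  shows "w = 1 + z * (A * (S * w * (I * (l - A * z))) - B * (z * S * w))"
proof -
  have "(1 - P * (z * l)) * (B - S * (A * (z * l) - z * z)) = B * (1 - z * z)"
    using assms(3-5) l by algebra
  hence "(1 - z * z) * (w * (B - S * (A * (z * l) - z * z))) = (1 - z * z) * B"
    unfolding w(1)[symmetric] by (simp add: mult_ac)
  hence "w * (B - S * (A * (z * l) - z * z)) = B"
    using w(2) by simp
  from assms(1,2) this show ?thesis by algebra
qed

context wall_walk
begin

text \<open>Summability spreads outwards from site 0. The step of the walk bounds site n + 1 by the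
  sites n and -n one time unit earlier; the step into -n, solved for site -(n + 1) by dividing by a,
  bounds the new site on the left.\<close>

lemma locally_summable_of_wall:
  assumes "summable (\<lambda>t. \<bar>coord (orbit f t) 0\<bar>)"
  shows "locally_summable (orbit f)"
proof -
  define u where "u = (\<lambda>y t. coord (orbit f t) y)"
  have u_Suc: "u y (Suc t) = (if y \<le> 0 then a * u (y - 1) t - b * u (1 - y) t
     else if y = 1 then s * u 0 t else b * u (1 - y) t + a * u (y - 1) t)" for y t
    by (simp add: u_def coord_U)
  have "\<forall>y. \<bar>y\<bar> \<le> int n \<longrightarrow> summable (\<lambda>t. \<bar>u y t\<bar>)" for n
  proof (induction n)
    case 0
    thus ?case using assms by (simp add: u_def)
  next
    case (Suc n)
    hence n: "summable (\<lambda>t. \<bar>u (int n) t\<bar>)" "summable (\<lambda>t. \<bar>u (- int n) t\<bar>)" by simp_all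
    have "summable (\<lambda>t. \<bar>u (int n + 1) (Suc t)\<bar>)"
      using n summable_abs_linear[OF n(2) n(1), of b a] summable_abs_linear[OF n(1) n(1), of s 0]
      by (cases "n = 0") (simp_all add: u_Suc)
    hence pos: "summable (\<lambda>t. \<bar>u (int n + 1) t\<bar>)" by (simp add: summable_Suc_iff[of "\<lambda>t. \<bar>u _ t\<bar>"])
    have "summable (\<lambda>t. \<bar>u (- int n) (Suc t)\<bar>)"
      using n(2) by (simp add: summable_Suc_iff[of "\<lambda>t. \<bar>u _ t\<bar>"])
    from summable_abs_linear[OF this pos, of "1 / a" "b / a"]
    have "summable (\<lambda>t. \<bar>u (- int n - 1) t\<bar>)"
      using a_pos by (simp add: u_Suc field_simps)
    hence neg: "summable (\<lambda>t. \<bar>u (- (int n + 1)) t\<bar>)" by (simp only: minus_add_distrib diff_conv_add_uminus)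
    show ?case
    proof (intro allI impI)
      fix y assume "\<bar>y\<bar> \<le> int (Suc n)"
      hence "\<bar>y\<bar> \<le> int n \<or> y = int n + 1 \<or> y = - (int n + 1)" by linarith
      thus "summable (\<lambda>t. \<bar>u y t\<bar>)" using pos neg Suc by blast
    qed
  qed
  hence "summable (\<lambda>t. \<bar>u y t\<bar>)" for y
    by (metis abs_ge_zero nat_0_le order_refl)
  thus ?thesis by (simp add: locally_summable_def u_def)
qed

text \<open>\<open>disc_fps\<close> is \<open>sqrt ((1 + z\<^sup>2)\<^sup>2 - 4 a\<^sup>2 z\<^sup>2)\<close>. The four roots lie on the unit circle and
  \<open>sqrt (1 - z)\<close> has absolutely summable coefficients, hence so does \<open>disc_fps\<close>. The generating function
  (in time) of the amplitude at the sites \<open>\<plusminus> n\<close> is proportional to \<open>lam ^ n\<close>, where \<open>lam = G / z\<close> is the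
  power series solution of \<open>a z (lam + 1 / lam) = 1 + z\<^sup>2\<close>.\<close>
definition disc_fps :: "complex fps" where
  "disc_fps = sqrt_fps (Complex a b) * sqrt_fps (Complex a (- b)) *
     (sqrt_fps (- Complex a b) * sqrt_fps (- Complex a (- b)))"

definition G :: "complex fps" where
  "G = fps_const (of_real (1 / (2 * a))) * (1 + fps_X * fps_X - disc_fps)"

lemma abs_summable_disc_fps: "abs_summable_fps disc_fps"
proof -
  have "norm (Complex a b) = 1" "norm (Complex a (- b)) = 1"
    using a2 by (simp_all add: cmod_def)
  thus ?thesis
    unfolding disc_fps_def by (intro abs_summable_fps_mult abs_summable_sqrt_fps) simp_all
qed

lemma disc_fps_square: "disc_fps * disc_fps =
  (1 + fps_X * fps_X) * (1 + fps_X * fps_X) - 4 * fps_const (of_real a) * fps_const (of_real a) * (fps_X * fps_X)"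
proof -
  have sq: "sqrt_fps \<alpha> * sqrt_fps \<beta> * (sqrt_fps \<alpha> * sqrt_fps \<beta>) =
      (1 - fps_const \<alpha> * fps_X) * (1 - fps_const \<beta> * fps_X)" for \<alpha> \<beta>
  proof -
    have "sqrt_fps \<alpha> * sqrt_fps \<beta> * (sqrt_fps \<alpha> * sqrt_fps \<beta>) =
        (sqrt_fps \<alpha> * sqrt_fps \<alpha>) * (sqrt_fps \<beta> * sqrt_fps \<beta>)" by (simp add: mult_ac)
    thus ?thesis by (simp only: sqrt_fps_square)
  qed
  have ab: "fps_const (Complex a b) * fps_const (Complex a (- b)) = 1"
    unfolding fps_const_mult using aa by (simp add: complex_eq_iff)
  have apb: "fps_const (Complex a b) + fps_const (Complex a (- b)) = 2 * fps_const (of_real a)"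
    by (simp add: complex_eq_iff fps_eq_iff fps_numeral_nth)
  have minus: "- Complex a b = - (Complex a b)" "1 - fps_const (- \<alpha>) * z = 1 + fps_const \<alpha> * z"
    for \<alpha> :: complex and z by (simp_all flip: fps_const_neg)
  have "disc_fps * disc_fps =
     (sqrt_fps (Complex a b) * sqrt_fps (Complex a (- b)) *
      (sqrt_fps (Complex a b) * sqrt_fps (Complex a (- b)))) *
     (sqrt_fps (- Complex a b) * sqrt_fps (- Complex a (- b)) *
      (sqrt_fps (- Complex a b) * sqrt_fps (- Complex a (- b))))"
    by (simp add: disc_fps_def mult_ac)
  also have "\<dots> = (1 + fps_X * fps_X) * (1 + fps_X * fps_X) -
      (fps_const (Complex a b) + fps_const (Complex a (- b))) *
      (fps_const (Complex a b) + fps_const (Complex a (- b))) * (fps_X * fps_X)"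
    unfolding sq minus(2) by (rule product_of_conjugate_factors[OF ab])
  also have "\<dots> = (1 + fps_X * fps_X) * (1 + fps_X * fps_X) - 4 * fps_const (of_real a) * fps_const (of_real a) * (fps_X * fps_X)"
    unfolding apb by (simp add: algebra_simps)
  finally show ?thesis .
qed

text \<open>Only finitely many coefficients see the polynomial part of \<open>G\<close>. The shift
  by 2 is the form needed for the amplitude at time t + 2 minus that at time t.\<close>

lemma abs_summable_G: "summable (\<lambda>n. norm (G $ (n + 2)))"
proof -
  have "(fps_X * fps_X :: complex fps) $ (n + 3) = 0" for n
    by (simp add: numeral_3_eq_3)
  hence "G $ (n + 3) = - of_real (1 / (2 * a)) * disc_fps $ (n + 3)" for n
    by (simp add: G_def numeral_3_eq_3 del: fps_X_mult_nth)
  moreover have "summable (\<lambda>n. norm (disc_fps $ (n + 3)))"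
    using abs_summable_disc_fps summable_iff_shift[of "\<lambda>n. norm (disc_fps $ n)" 3]
    unfolding abs_summable_fps_def by blast
  ultimately have "summable (\<lambda>n. norm (G $ (n + 3)))"
    by (simp only: norm_mult) (intro summable_mult)
  hence "summable (\<lambda>n. norm (G $ n))" using summable_iff_shift[of "\<lambda>n. norm (G $ n)" 3] by blast
  thus ?thesis using summable_iff_shift[of "\<lambda>n. norm (G $ n)" 2] by blast
qed

lemma G_eq: "fps_const (of_real a) * (G * G) = (1 + fps_X * fps_X) * G - fps_const (of_real a) * (fps_X * fps_X)"
proof -
  let ?A = "fps_const (of_real a) :: complex fps" and ?I = "fps_const (of_real (1 / (2 * a))) :: complex fps"
  have i: "2 * ?A * ?I = 1"
    using a_pos by (simp add: fps_eq_iff fps_numeral_nth mult.assoc) 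
  have G': "G = ?I * ((1 + fps_X * fps_X) - disc_fps)" by (simp add: G_def)
  show ?thesis
    unfolding G' by (rule quadratic_root[OF i disc_fps_square])
qed

text \<open>The minus sign before \<open>disc_fps\<close> in \<open>G\<close> selects the branch
  divisible by z, so that \<open>lam\<close> is a power series.\<close>

lemma G_0: "G $ 0 = 0" 
  by (simp add: G_def disc_fps_def sqrt_fps_def)

definition lam :: "complex fps" where "lam = fps_shift 1 G"

lemma G_lam: "G = fps_X * lam"
proof (rule fps_ext)
  fix n show "G $ n = (fps_X * lam) $ n"
    by (cases n) (simp_all add: lam_def G_0)
qed

lemma lam_eq: "fps_const (of_real a) * (fps_X * lam * lam) =
  (1 + fps_X * fps_X) * lam - fps_const (of_real a) * fps_X"
proof -
  have "fps_X * (fps_const (of_real a) * (fps_X * lam * lam)) =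
      fps_X * ((1 + fps_X * fps_X) * lam - fps_const (of_real a) * fps_X)"
    using G_eq unfolding G_lam by (simp add: algebra_simps)
  thus ?thesis by (simp only: mult_left_cancel[OF fps_X_neq_zero])
qed

text \<open>This will be the generating function of the return amplitudes to site 0. Since
  \<open>G\<close> is absolutely summable, the only obstruction to decay is the denominator, with
  zeros at z = 1 and z = -1. It is cancelled by U^2 - 1 = U D; hence decay is claimed for states in
  the range of \<open>D\<close>.\<close>

definition wall_fps :: "complex fps" where
  "wall_fps = (1 - fps_const (of_real (s * a / (s - b))) * G) * inverse (1 - fps_X * fps_X)"

lemma wall_fps_eq: "wall_fps * (1 - fps_X * fps_X) = 1 - fps_const (of_real (s * a / (s - b))) * G"
proof -
  have "(1 - fps_X * fps_X :: complex fps) $ 0 \<noteq> 0" by simp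
  from inverse_mult_eq_1[OF this] show ?thesis
    unfolding wall_fps_def by (simp add: mult.assoc)
qed

definition site_fps :: "int \<Rightarrow> complex fps" where
  "site_fps y = (if y = 0 then wall_fps
     else if y > 0 then fps_X * fps_const (of_real s) * wall_fps * lam ^ (nat y - 1)
     else fps_const (of_real s) * wall_fps * lam ^ (nat (- y) - 1) *
       (fps_const (1 / of_real b) * (lam - fps_const (of_real a) * fps_X)))"

text \<open>One step of \<open>U\<close> in generating-function form. The factor z determines the
  coefficients in time recursively, so the closed form of \<open>site_fps\<close>, an ansatz
  geometric in |y|, need only be verified.\<close>

lemma site_fps_rec: "site_fps y = (if y = 0 then 1 else 0) + fps_X *
  (if y \<le> 0 then fps_const (of_real a) * site_fps (y - 1) - fps_const (of_real b) * site_fps (1 - y)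
     else if y = 1 then fps_const (of_real s) * site_fps 0
     else fps_const (of_real b) * site_fps (1 - y) + fps_const (of_real a) * site_fps (y - 1))"
proof -
  define A B S I P :: "complex fps" where defs: "A = fps_const (of_real a)" "B = fps_const (of_real b)"
    "S = fps_const (of_real s)" "I = fps_const (1 / of_real b)" "P = fps_const (of_real (s * a / (s - b)))"
  have AA: "A * A = 1 - B * B"
    unfolding defs fps_const_mult by (simp flip: of_real_mult add: aa)
  have SS: "S * S = 1"
    unfolding defs fps_const_mult by (simp flip: of_real_mult)
  have BI: "B * I = 1"
    unfolding defs fps_const_mult using b_pos by simp
  have "s - b \<noteq> 0" using s b_pos b_less_1 by auto
  moreover have "s * a * a = (1 + s * b) * (s - b)"
    by (simp add: algebra_simps aa')
  ultimately have "s * a / (s - b) * (s - b) = s * a" "s * a / (s - b) * a = 1 + s * b"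
    by (simp_all add: nonzero_divide_eq_eq)
  moreover have "P * (S - B) = fps_const (of_real (s * a / (s - b) * (s - b)))"
    "S * A = fps_const (of_real (s * a))" "P * A = fps_const (of_real (s * a / (s - b) * a))"
    unfolding defs fps_const_mult fps_const_sub by simp_all
  moreover have "1 + S * B = fps_const (of_real (1 + s * b))"
    unfolding defs fps_const_mult by (simp flip: fps_const_add)
  ultimately have P: "P * (S - B) = S * A" "P * A = 1 + S * B" by simp_all
  have lam: "A * (fps_X * lam * lam) = (1 + fps_X * fps_X) * lam - A * fps_X"
    unfolding defs by (rule lam_eq)
  have wall: "wall_fps * (1 - fps_X * fps_X) = 1 - P * (fps_X * lam)"
    using wall_fps_eq unfolding defs G_lam .
  consider "y = 0" | "y = 1" | n where "y = 2 + int n" | n where "y = - 1 - int n"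
  proof -
    have "y = 0 \<or> y = 1 \<or> y = 2 + int (nat (y - 2)) \<or> y = - 1 - int (nat (- 1 - y))" by linarith
    thus ?thesis using that by blast
  qed
  thus ?thesis
  proof cases
    case 1
    have "wall_fps = 1 + fps_X * (A * (S * wall_fps * (I * (lam - A * fps_X))) - B * (fps_X * S * wall_fps))"
      by (rule wall_relation[OF AA BI SS P lam wall])
         (auto dest: arg_cong[of _ _ "\<lambda>F. F $ 0"])
    thus ?thesis using 1 by (simp add: site_fps_def flip: defs)
  next
    case 2
    thus ?thesis by (simp add: site_fps_def mult_ac)
  next
    case (3 n)
    have "nat (1 + int n) = Suc n" "nat (2 + int n) = Suc (Suc n)" by simp_all
    moreover have "lam = B * (I * (lam - A * fps_X)) + A * fps_X"
      using right_site_relation[OF BI] .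
    hence "fps_X * S * wall_fps * (lam ^ n * lam) =
      fps_X * (S * wall_fps * lam ^ n * (B * (I * (lam - A * fps_X)) + A * fps_X))"
      by (simp add: mult_ac)
    ultimately show ?thesis using 3 by (simp add: site_fps_def algebra_simps flip: defs)
  next
    case (4 n)
    have n: "nat (1 + int n) = Suc n" "nat (2 + int n) = Suc (Suc n)"
      "nat (int n + 1) = Suc n" "nat (int n + 2) = Suc (Suc n)" by simp_all
    have "I * (lam - A * fps_X) = fps_X * (A * lam * (I * (lam - A * fps_X)) - B * (fps_X * lam))"
      by (rule left_site_relation[OF AA BI lam])
    hence "S * wall_fps * lam ^ n * (I * (lam - A * fps_X)) =
        S * wall_fps * lam ^ n * (fps_X * (A * lam * (I * (lam - A * fps_X)) - B * (fps_X * lam)))"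
      by simp
    also have "\<dots> = fps_X * (A * (S * wall_fps * (lam ^ n * lam) * (I * (lam - A * fps_X))) -
       B * (fps_X * S * wall_fps * (lam ^ n * lam)))"
      by (simp add: algebra_simps)
    finally show ?thesis using 4 n by (simp add: site_fps_def mult_ac flip: defs)
  qed
qed

lemma coord_orbit_site_fps: "complex_of_real (coord (orbit (site 0) t) y) = site_fps y $ t"
proof (induction t arbitrary: y)
  case 0
  show ?case by (subst site_fps_rec) (simp add: coord_site)
next
  case (Suc t)
  show ?case
    by (subst site_fps_rec) (simp add: coord_U Suc.IH[symmetric])
qed

lemma locally_summable_D_site: "locally_summable (orbit (D (site 0)))"
proof -
  define p where "p = complex_of_real (s * a / (s - b))"
  \<comment> \<open>The difference over two time steps multiplies the generating function by 1 -
    z^2, up to a shift of the index, and leaves a multiple of \<open>G\<close>.\<close>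
  have "complex_of_real (coord (orbit (U (U (site 0)) - site 0) t) 0) = - p * G $ (t + 2)" for t
  proof -
    have "complex_of_real (coord (orbit (U (U (site 0)) - site 0) t) 0) =
        complex_of_real (coord (orbit (site 0) (Suc (Suc t))) 0) -
        complex_of_real (coord (orbit (site 0) t) 0)"
      by (simp add: orbit_linear orbit_U)
    also have "\<dots> = wall_fps $ (t + 2) - wall_fps $ t"
      unfolding coord_orbit_site_fps by (simp add: site_fps_def)
    also have "\<dots> = (wall_fps * (1 - fps_X * fps_X)) $ (t + 2)"
      by (simp add: right_diff_distrib mult.assoc[symmetric])
    also have "\<dots> = - p * G $ (t + 2)"
      unfolding wall_fps_eq by (simp add: p_def)
    finally show ?thesis .
  qed
  hence "\<bar>coord (orbit (U (U (site 0)) - site 0) t) 0\<bar> = norm p * norm (G $ (t + 2))" for t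
    by (metis norm_minus_cancel norm_mult norm_of_real)
  hence "locally_summable (orbit (U (U (site 0)) - site 0))"
    using summable_mult[OF abs_summable_G, of "norm p"] by (intro locally_summable_of_wall) simp
  hence "locally_summable (orbit (Ui (U (U (site 0)) - site 0)))"
    unfolding orbit_Ui by (rule locally_summable_Ui)
  thus ?thesis by (simp add: D_def)
qed

end

section \<open>The spectral measure of the initial state\<close>

text \<open>Up to normalization, \<open>wall_poly u n (c / a)\<close> is the value at the sites \<open>\<plusminus> n\<close> of the solution of
  \<open>M F = 2 c F\<close>. The solution space is two-dimensional; this solution is the one whose values at
  \<open>y \<noteq> 0\<close> integrate to zero against the spectral measure of the initial state.\<close>
fun wall_poly :: "real \<Rightarrow> nat \<Rightarrow> real \<Rightarrow> real" where
  "wall_poly u 0 x = 1 + u"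
| "wall_poly u (Suc 0) x = 2 * x"
| "wall_poly u (Suc (Suc n)) x = 2 * x * wall_poly u (Suc n) x - wall_poly u n x"

lemma continuous_wall_poly [continuous_intros]:
  "continuous_on S g \<Longrightarrow> continuous_on S (\<lambda>k. wall_poly u n (g k))"
  by (induction u n "0::real" rule: wall_poly.induct) (auto intro!: continuous_intros)

lemma wall_poly_minus: "wall_poly u n (- x) = (-1) ^ n * wall_poly u n x"
  by (induction u n x rule: wall_poly.induct) (auto simp: algebra_simps)

text \<open>In terms of Chebyshev polynomials of the second kind, \<open>wall_poly u n\<close> is
  U_n - u U_(n-2), continued to negative indices by U_(-1) = 0 and U_(-2) = -1.\<close>

lemma wall_poly_cos:
  "sin k * wall_poly u n (cos k) = sin (real_of_int (int n + 1) * k) - u * sin (real_of_int (int n - 1) * k)"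
proof (induction u n "cos k" rule: wall_poly.induct)
  case (3 u n)
  have sum: "2 * cos k * sin (x * k) = sin ((x + 1) * k) + sin ((x - 1) * k)" for x
    by (simp add: sin_add sin_diff distrib_right left_diff_distrib)
  have "sin k * wall_poly u (Suc (Suc n)) (cos k) =
      2 * cos k * (sin k * wall_poly u (Suc n) (cos k)) - sin k * wall_poly u n (cos k)"
    by (simp add: algebra_simps)
  also have "\<dots> = (2 * cos k * sin ((real n + 2) * k) - sin ((real n + 1) * k))
      - u * (2 * cos k * sin (real n * k) - sin ((real n - 1) * k))"
    unfolding 3 by (simp add: algebra_simps)
  also have "\<dots> = sin ((real n + 3) * k) - u * sin ((real n + 1) * k)"
    unfolding sum by (simp add: add.assoc flip: add_diff_eq)
  finally show ?case by (simp add: add.commute)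
qed (use sin_double[of k] in \<open>simp_all add: algebra_simps\<close>)

text \<open>The recurrence has the solutions rho^n and rho^(-n); the condition on u removes the
  second one. This is the case of a bound state.\<close>

lemma wall_poly_geometric:
  assumes "2 * x * \<rho> = 1 + \<rho>\<^sup>2" "u * \<rho>\<^sup>2 = 1"
  shows "wall_poly u n x = (1 + u) * \<rho> ^ n"
  using assms
proof (induction u n x rule: wall_poly.induct)
  case (2 u x)
  have "(2 * x) * \<rho> = ((1 + u) * \<rho>) * \<rho>"
    using 2 by (simp add: algebra_simps power2_eq_square)
  moreover have "\<rho> \<noteq> 0" using 2 by auto
  ultimately show ?case by simp
next
  case (3 u n x)
  have "wall_poly u (Suc (Suc n)) x = 2 * x * ((1 + u) * \<rho> ^ Suc n) - (1 + u) * \<rho> ^ n"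
    using 3 by simp
  also have "\<dots> = (1 + u) * \<rho> ^ n * (2 * x * \<rho> - 1)" by (simp add: algebra_simps)
  also have "2 * x * \<rho> - 1 = \<rho>\<^sup>2" using 3 by simp
  finally show ?case by (simp add: power2_eq_square)
qed simp

context wall_walk
begin

definition Cop :: "fsv \<Rightarrow> fsv" where "Cop f = (1/2) *\<^sub>R M f"

text \<open>By \<open>coord_M\<close>, \<open>M\<close> has weight a on all bonds except {0, 1},
  where it is s - b; \<open>th\<close> is the relative strength of this defect.\<close>

definition th :: real where "th = (s - b) / a"
text \<open>The root below 1 of a^2 (1 + r^2) = 2 (1 + b^2) r, the characteristic equation of the
  recurrence \<open>I_rec\<close> off the origin.\<close>

definition r :: real where "r = (1 - b) / (1 + b)"
definition atom :: real where "atom = (if s = 1 then 0 else 2 * b / (1 + b))"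

text \<open>In the coordinate \<open>c = a cos k\<close>, \<open>0 \<le> k \<le> \<pi>\<close>, of the continuous spectrum of \<open>Cop\<close>, \<open>weight\<close> is the
  normalized density of the spectral measure of \<open>site 0\<close>; \<open>atom\<close> is its mass at the eigenvalues \<open>\<plusminus>1\<close>.\<close>
definition weight :: "real \<Rightarrow> real" where
  "weight k = (1 + b) / pi * ((sin k)\<^sup>2 / (1 - a\<^sup>2 * (cos k)\<^sup>2))"

definition spectral :: "(real \<Rightarrow> real) \<Rightarrow> real" where
  "spectral g = atom * ((g 1 + g (-1)) / 2) +
     (1 - atom) * integral {0..pi} (\<lambda>k. g (a * cos k) * weight k)"

lemma den_pos: "1 - a\<^sup>2 * (cos k)\<^sup>2 > 0"
proof -
  have "a\<^sup>2 * (cos k)\<^sup>2 \<le> a\<^sup>2 * 1" by (intro mult_left_mono) (simp_all add: abs_square_le_1)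
  also have "\<dots> < 1" using a2 b_pos by simp
  finally show ?thesis by simp
qed

lemma weight_nonneg: "weight k \<ge> 0"
  using den_pos[of k] b_pos by (simp add: weight_def)

lemma continuous_weight [continuous_intros]: "continuous_on S weight"
  unfolding weight_def using den_pos
  by (intro continuous_intros) (auto simp: less_le)

lemma r_bounds: "0 < r" "r < 1"
  using b_pos b_less_1 by (auto simp: r_def field_simps)

section \<open>Cosine coefficients of 1 / (1 - a^2 cos^2 k)\<close>

definition I :: "int \<Rightarrow> real" where
  "I n = integral {0..pi} (\<lambda>k. cos (real_of_int n * k) / (1 - a\<^sup>2 * (cos k)\<^sup>2))"

lemma integrable_I: "(\<lambda>k. cos (real_of_int n * k) / (1 - a\<^sup>2 * (cos k)\<^sup>2)) integrable_on {0..pi}"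
  using den_pos by (intro integrable_continuous_real continuous_intros) (auto simp: less_le)

lemma I_minus: "I (- n) = I n"
  by (simp add: I_def)

lemma abs_I_le: "\<bar>I n\<bar> \<le> I 0"
proof -
  have "norm (integral {0..pi} (\<lambda>k. cos (real_of_int n * k) / (1 - a\<^sup>2 * (cos k)\<^sup>2)))
    \<le> integral {0..pi} (\<lambda>k. cos (real_of_int 0 * k) / (1 - a\<^sup>2 * (cos k)\<^sup>2))"
  proof (intro integral_norm_bound_integral integrable_I)
    fix k
    show "norm (cos (real_of_int n * k) / (1 - a\<^sup>2 * (cos k)\<^sup>2)) \<le>
        cos (real_of_int 0 * k) / (1 - a\<^sup>2 * (cos k)\<^sup>2)"
      using den_pos[of k] by (simp add: divide_right_mono)
  qed
  thus ?thesis by (simp add: I_def)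
qed

text \<open>The denominator equals (1 + b^2) / 2 - (a^2 / 2) cos (2 k), so multiplying it back
  couples n with n + 2 and n - 2 and leaves the integral of cos (n k).\<close>

lemma I_rec: "(1 + b\<^sup>2) / 2 * I n - a\<^sup>2 / 4 * (I (n + 2) + I (n - 2)) = (if n = 0 then pi else 0)"
proof -
  let ?d = "\<lambda>k. 1 - a\<^sup>2 * (cos k)\<^sup>2"
  have "((\<lambda>k. cos (real_of_int n * k)) has_integral (if n = 0 then pi else 0)) {0..pi}"
  proof (cases "n = 0")
    case True
    thus ?thesis using has_integral_const_real[of "1::real" 0 pi] by simp
  next
    case False
    have "((\<lambda>k. cos (real_of_int n * k)) has_integral
       (sin (real_of_int n * pi) / real_of_int n - sin (real_of_int n * 0) / real_of_int n)) {0..pi}"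
      using False
      by (intro fundamental_theorem_of_calculus)
         (auto intro!: derivative_eq_intros simp flip: has_real_derivative_iff_has_vector_derivative)
    thus ?thesis using False by (simp add: mult.commute[of _ pi])
  qed
  moreover have "cos (real_of_int n * k) = (1 + b\<^sup>2) / 2 * (cos (real_of_int n * k) / ?d k)
     - a\<^sup>2 / 4 * (cos (real_of_int (n + 2) * k) / ?d k + cos (real_of_int (n - 2) * k) / ?d k)" for k
  proof -
    have sum: "cos (real_of_int (n + 2) * k) + cos (real_of_int (n - 2) * k) =
        2 * cos (real_of_int n * k) * (2 * (cos k)\<^sup>2 - 1)"
      by (simp add: distrib_right left_diff_distrib cos_add cos_diff cos_double_cos)
    have "(1 + b\<^sup>2) / 2 * cos (real_of_int n * k) -
        a\<^sup>2 / 4 * (cos (real_of_int (n + 2) * k) + cos (real_of_int (n - 2) * k)) =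
        cos (real_of_int n * k) * ((1 + b\<^sup>2 + a\<^sup>2) / 2 - a\<^sup>2 * (cos k)\<^sup>2)"
      unfolding sum by (simp add: field_simps)
    also have "\<dots> = cos (real_of_int n * k) * ?d k" using a2 by simp
    finally have "cos (real_of_int n * k) = ((1 + b\<^sup>2) / 2 * cos (real_of_int n * k) -
        a\<^sup>2 / 4 * (cos (real_of_int (n + 2) * k) + cos (real_of_int (n - 2) * k))) / ?d k"
      using den_pos[of k] by simp
    moreover have "(x * c - y / 4 * (p + q)) / d = x * (c / d) - y / 4 * (p / d + q / d)"
      for x y c p q d :: real
      by (cases "d = 0") (simp_all add: field_simps)
    ultimately show ?thesis by metis
  qed
  moreover have "((\<lambda>k. (1 + b\<^sup>2) / 2 * (cos (real_of_int n * k) / ?d k)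
     - a\<^sup>2 / 4 * (cos (real_of_int (n + 2) * k) / ?d k + cos (real_of_int (n - 2) * k) / ?d k))
     has_integral ((1 + b\<^sup>2) / 2 * I n - a\<^sup>2 / 4 * (I (n + 2) + I (n - 2)))) {0..pi}"
    unfolding I_def
    by (intro has_integral_diff has_integral_mult_right has_integral_add integrable_integral integrable_I)
  ultimately show ?thesis by (simp add: has_integral_unique)
qed

text \<open>The recurrence has modes growing like 1 / r and decaying like r. The quantity
  \<open>d\<close> measures the growing mode, which must vanish because the coefficients are bounded
  by \<open>I 0\<close>. The bound on n keeps the source term of \<open>I_rec\<close> at 0 out of
  play.\<close>

lemma I_step:
  assumes "n \<ge> -1"
  shows "I (n + 2) = r * I n"
proof -
  define d where "d = (\<lambda>n. I (n + 2) - r * I n)"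
  have step: "r * d (m + 2) = d m" if "m \<ge> -1" for m
  proof -
    have "a\<^sup>2 * (I (m + 4) + I m) = 2 * (1 + b\<^sup>2) * I (m + 2)"
      using I_rec[of "m + 2"] that by (simp add: add.commute mult.assoc del: distrib_left_numeral distrib_right_numeral)
    hence "a\<^sup>2 * (r * (I (m + 4) + I m)) = r * (2 * (1 + b\<^sup>2)) * I (m + 2)"
      by (simp add: mult_ac)
    also have "r * (2 * (1 + b\<^sup>2)) = a\<^sup>2 * (1 + r\<^sup>2)"
    proof -
      have "a\<^sup>2 = r * (1 + b)\<^sup>2"
        unfolding a2 r_def using b_pos by (simp add: power2_eq_square) (simp add: algebra_simps)
      moreover have "2 * (1 + b\<^sup>2) = (1 + b)\<^sup>2 * (1 + r\<^sup>2)"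
        unfolding distrib_left r_def power_divide using b_pos
        by simp (simp add: power2_eq_square algebra_simps)
      ultimately show ?thesis by simp
    qed
    finally have "r * (I (m + 4) + I m) = (1 + r\<^sup>2) * I (m + 2)"
      using a_pos by (simp add: mult.assoc)
    thus ?thesis by (simp add: d_def algebra_simps power2_eq_square)
  qed
  have iter: "d n = r ^ j * d (n + 2 * int j)" for j
  proof (induction j)
    case (Suc j)
    show ?case using step[of "n + 2 * int j"] assms Suc by (simp add: algebra_simps)
  qed simp
  have "\<bar>d m\<bar> \<le> 2 * I 0" for m
  proof -
    have "\<bar>d m\<bar> \<le> \<bar>I (m + 2)\<bar> + r * \<bar>I m\<bar>" 
      using r_bounds abs_triangle_ineq4[of "I (m + 2)" "r * I m"] by (simp add: d_def abs_mult)
    also have "\<dots> \<le> I 0 + 1 * I 0"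
      using abs_I_le r_bounds by (intro add_mono mult_mono) auto
    finally show ?thesis by simp
  qed
  hence bound: "\<bar>d n\<bar> \<le> r ^ j * (2 * I 0)" for j
    unfolding iter[of j] using r_bounds by (simp add: abs_mult)
  have "(\<lambda>j. r ^ j * (2 * I 0)) \<longlonglongrightarrow> 0 * (2 * I 0)"
    using r_bounds by (intro tendsto_mult LIMSEQ_power_zero tendsto_const) simp
  hence "\<bar>d n\<bar> \<le> 0 * (2 * I 0)" using bound by (intro LIMSEQ_le_const) auto
  thus ?thesis by (simp add: d_def)
qed

text \<open>The recurrence at n = 0 closes up by the symmetry of \<open>I\<close> and the decay
  factor, since 1 + b^2 - a^2 r = 2 b.\<close>

lemma I_0: "I 0 = pi / b"
proof -
  have "I 2 = r * I 0" using I_step[of 0] by simp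
  hence eq: "(1 + b\<^sup>2) / 2 * I 0 - a\<^sup>2 / 4 * (2 * (r * I 0)) = pi"
    using I_rec[of 0] I_minus[of 2] by simp
  have "a\<^sup>2 * r = (1 - b)\<^sup>2"
    using b_pos unfolding a2 r_def by (simp add: field_simps power2_eq_square)
  have "(1 + b\<^sup>2) / 2 * I 0 - a\<^sup>2 / 4 * (2 * (r * I 0)) = ((1 + b\<^sup>2) - a\<^sup>2 * r) / 2 * I 0"
    by (simp add: algebra_simps)
  also have "\<dots> = b * I 0"
    unfolding \<open>a\<^sup>2 * r = (1 - b)\<^sup>2\<close> by (simp add: power2_eq_square algebra_simps)
  finally have "(1 + b\<^sup>2) / 2 * I 0 - a\<^sup>2 / 4 * (2 * (r * I 0)) = b * I 0" .
  with eq show ?thesis using b_pos by (simp add: field_simps)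
qed

text \<open>Stepping from -1 to 1 gives I 1 = r I 1 by symmetry, hence I 1 = 0.\<close>

lemma I_odd: "I (2 * int l + 1) = 0"
proof (induction l)
  case 0
  show ?case using I_step[of "-1"] I_minus[of 1] r_bounds by simp
next
  case (Suc l)
  thus ?case using I_step[of "2 * int l + 1"] by (simp add: algebra_simps)
qed

lemma I_even: "I (2 * int l) = r ^ l * (pi / b)"
proof (induction l)
  case (Suc l)
  thus ?case using I_step[of "2 * int l"] by (simp add: algebra_simps)
qed (simp add: I_0)

lemma integral_wall_poly: "integral {0..pi} (\<lambda>k. wall_poly (th\<^sup>2) n (cos k) * weight k) =
  (1 + b) / (2 * pi) * (I (int n) - I (int n + 2) - th\<^sup>2 * (I (int n - 2) - I (int n)))"
proof -
  let ?d = "\<lambda>k. 1 - a\<^sup>2 * (cos k)\<^sup>2"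
  let ?c = "\<lambda>m k. cos (real_of_int m * k) / ?d k"
  have eq: "wall_poly (th\<^sup>2) n (cos k) * weight k =
    (1 + b) / (2 * pi) * (?c (int n) k - ?c (int n + 2) k - th\<^sup>2 * (?c (int n - 2) k - ?c (int n) k))" for k
  proof -
    have 1: "2 * sin (x * k) * sin k = cos ((x - 1) * k) - cos ((x + 1) * k)" for x
      by (simp add: cos_add cos_diff distrib_right left_diff_distrib)
    have "2 * ((sin k)\<^sup>2 * wall_poly (th\<^sup>2) n (cos k)) =
        2 * (sin k * wall_poly (th\<^sup>2) n (cos k)) * sin k" by (simp add: power2_eq_square)
    also have "\<dots> = 2 * sin (real_of_int (int n + 1) * k) * sin k
        - th\<^sup>2 * (2 * sin (real_of_int (int n - 1) * k) * sin k)"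
      unfolding wall_poly_cos by (simp add: algebra_simps)
    also have "\<dots> = cos (real_of_int (int n) * k) - cos (real_of_int (int n + 2) * k)
        - th\<^sup>2 * (cos (real_of_int (int n - 2) * k) - cos (real_of_int (int n) * k))"
      unfolding 1 by (simp add: algebra_simps)
    finally have product: "2 * ((sin k)\<^sup>2 * wall_poly (th\<^sup>2) n (cos k)) =
        cos (real_of_int (int n) * k) - cos (real_of_int (int n + 2) * k)
        - th\<^sup>2 * (cos (real_of_int (int n - 2) * k) - cos (real_of_int (int n) * k))" .
    have "wall_poly (th\<^sup>2) n (cos k) * weight k = (1 + b) / (2 * pi) *
        (2 * ((sin k)\<^sup>2 * wall_poly (th\<^sup>2) n (cos k)) / ?d k)"
      by (simp add: weight_def)
    also note product
    finally show ?thesis by (simp add: diff_divide_distrib right_diff_distrib)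
  qed
  have "((\<lambda>k. wall_poly (th\<^sup>2) n (cos k) * weight k) has_integral
    (1 + b) / (2 * pi) * (I (int n) - I (int n + 2) - th\<^sup>2 * (I (int n - 2) - I (int n)))) {0..pi}"
    unfolding eq I_def
    by (intro has_integral_diff has_integral_mult_right integrable_integral integrable_I)
  thus ?thesis by (rule integral_unique)
qed

text \<open>Here the two phases part: for s = 1 the defect bond is weaker than the others, for s =
  -1 it is stronger, and only the stronger bond supports bound states.\<close>

lemma th2: "th\<^sup>2 = (if s = 1 then r else 1 / r)"
proof -
  have "a\<^sup>2 = (1 - b) * (1 + b)" unfolding a2 by (simp add: power2_eq_square algebra_simps)
  thus ?thesis
    using s b_pos b_less_1
    by (auto simp: th_def r_def power_divide power2_eq_square divide_simps) (simp_all add: algebra_simps)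
qed

lemma integral_wall_poly_0: "integral {0..pi} (\<lambda>k. wall_poly (th\<^sup>2) 0 (cos k) * weight k) = 1 + th\<^sup>2"
proof -
  have "I 2 = r * (pi / b)" "I (-2) = r * (pi / b)"
    using I_even[of 1] I_minus[of 2] by simp_all
  hence "integral {0..pi} (\<lambda>k. wall_poly (th\<^sup>2) 0 (cos k) * weight k) =
      (1 + b) / (2 * pi) * ((1 + th\<^sup>2) * ((1 - r) * (pi / b)))"
    unfolding integral_wall_poly by (simp add: I_0 algebra_simps)
  also have "1 - r = 2 * b / (1 + b)" using b_pos by (simp add: r_def field_simps)
  also have "(1 + b) / (2 * pi) * ((1 + th\<^sup>2) * (2 * b / (1 + b) * (pi / b))) = 1 + th\<^sup>2"
    using b_pos by simp
  finally show ?thesis .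
qed

lemma one_plus_th2: "1 + th\<^sup>2 \<noteq> 0"
  by (metis add_nonneg_eq_0_iff zero_le_one zero_le_power2 zero_neq_one)

lemma integral_weight: "integral {0..pi} weight = 1"
proof -
  have "1 + th\<^sup>2 = (1 + th\<^sup>2) * integral {0..pi} weight"
    using integral_wall_poly_0 by simp
  thus ?thesis using one_plus_th2 by simp
qed

text \<open>The smaller root of a (rho + 1 / rho) = 2, the spatial decay rate of solutions of M F =
  2 F.\<close>

definition rho :: real where "rho = a / (1 + b)"

lemma rho: "rho\<^sup>2 = r" "2 * (1 / a) * rho = 1 + rho\<^sup>2"
proof -
  have a2': "a\<^sup>2 = (1 - b) * (1 + b)" unfolding a2 by (simp add: power2_eq_square algebra_simps)
  show 1: "rho\<^sup>2 = r"
    unfolding rho_def r_def power_divide a2' using b_pos by (simp add: power2_eq_square)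
  show "2 * (1 / a) * rho = 1 + rho\<^sup>2"
    unfolding 1 using a_pos b_pos by (simp add: rho_def r_def divide_simps)
qed

text \<open>For \<open>s = -1\<close> the continuous part is not orthogonal to the constants: the deficit is made
  up by the two eigenvectors with eigenvalues \<open>\<plusminus>1\<close>, which decay like \<open>rho ^ \<bar>y\<bar>\<close>.\<close>
lemma spectral_wall_poly:
  "spectral (\<lambda>c. wall_poly (th\<^sup>2) n (c / a)) = (if n = 0 then 1 + th\<^sup>2 else 0)"
proof -
  have eq: "spectral (\<lambda>c. wall_poly (th\<^sup>2) n (c / a)) =
    atom * ((1 + (-1) ^ n) / 2) * wall_poly (th\<^sup>2) n (1 / a) +
    (1 - atom) * integral {0..pi} (\<lambda>k. wall_poly (th\<^sup>2) n (cos k) * weight k)"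
  proof -
    have "wall_poly (th\<^sup>2) n (- 1 / a) = (-1) ^ n * wall_poly (th\<^sup>2) n (1 / a)"
      using wall_poly_minus[of _ n "1 / a"] by simp
    thus ?thesis
      using a_pos unfolding spectral_def by (simp add: distrib_right)
  qed
  show ?thesis
  proof (cases "even n")
    case odd: False
    then obtain l where l: "n = 2 * l + 1" by (rule oddE)
    have "I (int n) = 0" "I (int n + 2) = 0"
      using I_odd[of l] I_odd[of "Suc l"] l by (simp_all add: algebra_simps)
    moreover have "I (int n - 2) = 0"
      using I_odd[of "l - 1"] I_odd[of 0] I_minus[of 1] l by (cases l) (simp_all add: add.commute)
    ultimately show ?thesis using odd unfolding eq integral_wall_poly by auto
  next
    case even: True
    show ?thesis
    proof (cases "n = 0")
      case True
      thus ?thesis using eq[unfolded True integral_wall_poly_0] by (simp add: algebra_simps)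
    next
      case False
      then obtain l where l: "n = 2 * Suc l"
        using even by (elim evenE) (metis mult_0_right not0_implies_Suc)
      have I: "I (int n) = r * r ^ l * (pi / b)" "I (int n + 2) = r * r * r ^ l * (pi / b)"
        "I (int n - 2) = r ^ l * (pi / b)"
        using I_even[of l] I_even[of "Suc l"] I_even[of "Suc (Suc l)"] l
        by (simp_all add: algebra_simps)
      have int: "integral {0..pi} (\<lambda>k. wall_poly (th\<^sup>2) n (cos k) * weight k) =
          (1 + b) / (2 * b) * (1 - r) * (r ^ l * (r - th\<^sup>2))"
        unfolding integral_wall_poly I using b_pos by (simp add: field_simps)
      have "1 - r = 2 * b / (1 + b)" using b_pos by (simp add: r_def field_simps)
      hence one: "(1 + b) / (2 * b) * (1 - r) = 1" using b_pos by simp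
      have int: "integral {0..pi} (\<lambda>k. wall_poly (th\<^sup>2) n (cos k) * weight k) =
          r ^ l * (r - th\<^sup>2)" unfolding int one by simp
      show ?thesis
      proof (cases "s = 1")
        case True
        have "atom = 0" "th\<^sup>2 = r"
          unfolding atom_def th2 using True by auto
        thus ?thesis using False unfolding eq int by simp
      next
        case s: False
        have "th\<^sup>2 * rho\<^sup>2 = 1" "1 + th\<^sup>2 = 1 + 1 / r"
          using s r_bounds unfolding rho(1) th2 by auto
        moreover have "rho ^ n = r * r ^ l" unfolding l power_mult rho(1) by simp
        ultimately have "wall_poly (th\<^sup>2) n (1 / a) = (1 + 1 / r) * (r * r ^ l)"
          using wall_poly_geometric[OF rho(2), of "th\<^sup>2" n] by metis
        moreover have "atom = 1 - r" using s b_pos by (simp add: atom_def r_def field_simps)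
        moreover have "th\<^sup>2 = 1 / r" "(1 + (-1 :: real) ^ n) / 2 = 1"
          using s even by (auto simp: th2)
        \<comment> \<open>The atoms contribute (1 - r^2) r^l and the continuous part (r^2 - 1)
          r^l.\<close>
        moreover have "(1 - r) * 1 * ((1 + 1 / r) * (r * r ^ l)) + (1 - (1 - r)) * (r ^ l * (r - 1 / r)) = 0"
          using r_bounds by (simp add: field_simps)
        ultimately have "spectral (\<lambda>c. wall_poly (th\<^sup>2) n (c / a)) = 0"
          unfolding eq int by metis
        thus ?thesis using False by simp
      qed
    qed
  qed
qed

lemma spectral_add:
  assumes "continuous_on UNIV g" "continuous_on UNIV h"
  shows "spectral (\<lambda>c. g c + h c) = spectral g + spectral h"
proof -
  have "(\<lambda>k. g (a * cos k) * weight k) integrable_on {0..pi}"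
    "(\<lambda>k. h (a * cos k) * weight k) integrable_on {0..pi}"
    by (intro integrable_continuous_real continuous_intros
        continuous_on_compose2[OF assms(1)] continuous_on_compose2[OF assms(2)]; simp)+
  from integral_add[OF this] show ?thesis
    by (simp add: spectral_def algebra_simps add_divide_distrib)
qed

lemma spectral_cmult: "spectral (\<lambda>c. x * g c) = x * spectral g"
  by (simp add: spectral_def algebra_simps mult.assoc add_divide_distrib)

text \<open>The generalized eigenfunction of \<open>Cop\<close> with eigenvalue c, normalized to 1
  at site 0; crossing the defect bond to the right costs the factor \<open>th\<close>.\<close>

definition eigenfun :: "int \<Rightarrow> real \<Rightarrow> real" where
  "eigenfun y c = (if y \<le> 0 then 1 else th) * wall_poly (th\<^sup>2) (nat \<bar>y\<bar>) (c / a) / (1 + th\<^sup>2)"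

lemma continuous_eigenfun [continuous_intros]: "continuous_on S (eigenfun y)"
  using a_pos one_plus_th2 unfolding eigenfun_def by (intro continuous_intros) auto

text \<open>Away from the defect this is the three-term recurrence of \<open>wall_poly\<close>. At
  site 0 both neighbours contribute \<open>wall_poly\<close> of index 1, with weights 1 and
  \<open>th\<^sup>2\<close>, and this forces the starting value 1 + u.\<close>

lemma eigenfun_M: "2 * c * eigenfun y c =
  (if y = 0 then a * eigenfun (-1) c + (s - b) * eigenfun 1 c
   else if y = 1 then (s - b) * eigenfun 0 c + a * eigenfun 2 c
   else a * (eigenfun (y + 1) c + eigenfun (y - 1) c))"
proof -
  let ?P = "\<lambda>n. wall_poly (th\<^sup>2) n (c / a)"
  have P: "2 * c * ?P (Suc n) = a * (?P (Suc (Suc n)) + ?P n)" for n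
    using a_pos by simp
  note pos = one_plus_th2
  have sb: "s - b = a * th" using a_pos by (simp add: th_def)
  consider "y = 0" | "y = 1" | n where "y = 2 + int n" | n where "y = - 1 - int n"
  proof -
    have "y = 0 \<or> y = 1 \<or> y = 2 + int (nat (y - 2)) \<or> y = - 1 - int (nat (- 1 - y))" by linarith
    thus ?thesis using that by blast
  qed
  thus ?thesis
  proof cases
    case 1
    have "a * eigenfun (-1) c = 2 * c * (1 / (1 + th\<^sup>2))"
      "a * th * eigenfun 1 c = 2 * c * (th\<^sup>2 / (1 + th\<^sup>2))"
      using a_pos by (simp_all add: eigenfun_def power2_eq_square)
    hence "a * eigenfun (-1) c + a * th * eigenfun 1 c = 2 * c * ((1 + th\<^sup>2) / (1 + th\<^sup>2))"
      by (simp only: add_divide_distrib distrib_left)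
    also have "\<dots> = 2 * c" using pos by simp
    finally show ?thesis using 1 pos by (simp add: eigenfun_def sb)
  next
    case 2
    have n: "nat \<bar>2\<bar> = Suc (Suc 0)" by simp
    have "eigenfun 0 c = ?P 0 / (1 + th\<^sup>2)" "eigenfun 2 c = th * ?P (Suc (Suc 0)) / (1 + th\<^sup>2)"
      unfolding eigenfun_def n by (simp_all del: wall_poly.simps)
    moreover have "2 * c * eigenfun 1 c = th * (2 * c * ?P (Suc 0)) / (1 + th\<^sup>2)"
      by (simp add: eigenfun_def del: wall_poly.simps)
    ultimately show ?thesis using 2 unfolding P sb
      by (simp add: add_divide_distrib distrib_left distrib_right mult_ac del: wall_poly.simps)
  next
    case (3 n)
    have n: "nat \<bar>2 + int n\<bar> = Suc (Suc n)" "nat \<bar>3 + int n\<bar> = Suc (Suc (Suc n))" "nat \<bar>1 + int n\<bar> = Suc n"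
      by simp_all
    have "eigenfun (1 + int n) c = th * ?P (Suc n) / (1 + th\<^sup>2)"
      "eigenfun (3 + int n) c = th * ?P (Suc (Suc (Suc n))) / (1 + th\<^sup>2)"
      unfolding eigenfun_def n by (simp_all del: wall_poly.simps)
    moreover have "2 * c * eigenfun (2 + int n) c = th * (2 * c * ?P (Suc (Suc n))) / (1 + th\<^sup>2)"
      unfolding eigenfun_def n by (simp del: wall_poly.simps)
    moreover have "y + 1 = 3 + int n" "y - 1 = 1 + int n" using 3 by simp_all
    ultimately show ?thesis using 3 unfolding P
      by (simp add: add_divide_distrib distrib_left distrib_right mult_ac del: wall_poly.simps)
  next
    case (4 n)
    have n: "nat \<bar>- 1 - int n\<bar> = Suc n" "nat \<bar>- 2 - int n\<bar> = Suc (Suc n)" "nat \<bar>- int n\<bar> = n"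
      by simp_all
    have "eigenfun (- int n) c = ?P n / (1 + th\<^sup>2)"
      "eigenfun (- 2 - int n) c = ?P (Suc (Suc n)) / (1 + th\<^sup>2)"
      unfolding eigenfun_def n by (simp_all del: wall_poly.simps)
    moreover have "2 * c * eigenfun (- 1 - int n) c = (2 * c * ?P (Suc n)) / (1 + th\<^sup>2)"
      unfolding eigenfun_def n by (simp del: wall_poly.simps)
    moreover have "y + 1 = - int n" "y - 1 = - 2 - int n" using 4 by simp_all
    ultimately show ?thesis using 4 unfolding P
      by (simp add: add_divide_distrib distrib_left distrib_right mult_ac del: wall_poly.simps)
  qed
qed

lemma linear_Cop [simp]:
  "Cop (f + g) = Cop f + Cop g" "Cop (f - g) = Cop f - Cop g" "Cop (c *\<^sub>R f) = c *\<^sub>R Cop f"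
  by (simp_all add: Cop_def algebra_simps)

lemma coord_Cop: "coord (Cop f) y = coord (M f) y / 2"
  by (simp add: Cop_def)

text \<open>This replaces the spectral theorem. For j = 0 it is the orthogonality
  \<open>spectral_wall_poly\<close>; the step lets \<open>Cop\<close> act in y, which by
  \<open>eigenfun_M\<close> is multiplication by c under the functional.\<close>

lemma coord_Cop_power_site: "coord ((Cop ^^ j) (site 0)) y = spectral (\<lambda>c. c ^ j * eigenfun y c)"
proof (induction j arbitrary: y)
  case 0
  have "spectral (\<lambda>c. c ^ 0 * eigenfun y c) =
      (if y \<le> 0 then 1 else th) / (1 + th\<^sup>2) * spectral (\<lambda>c. wall_poly (th\<^sup>2) (nat \<bar>y\<bar>) (c / a))"
    by (simp add: eigenfun_def flip: spectral_cmult)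
  with one_plus_th2 show ?case by (simp add: spectral_wall_poly coord_site)
next
  case (Suc j)
  have cont: "continuous_on UNIV (\<lambda>c. u * (c ^ j * eigenfun y c))" for y u by (intro continuous_intros)
  have lin: "spectral (\<lambda>c. c ^ Suc j * eigenfun y c) =
     u * spectral (\<lambda>c. c ^ j * eigenfun y1 c) + v * spectral (\<lambda>c. c ^ j * eigenfun y2 c)"
    if "\<And>c. 2 * c * eigenfun y c = 2 * u * eigenfun y1 c + 2 * v * eigenfun y2 c" for u v y1 y2
  proof -
    have "c ^ Suc j * eigenfun y c = u * (c ^ j * eigenfun y1 c) + v * (c ^ j * eigenfun y2 c)" for c
    proof -
      have "c ^ Suc j * eigenfun y c = c ^ j * (2 * c * eigenfun y c) / 2" by simp
      also have "\<dots> = u * (c ^ j * eigenfun y1 c) + v * (c ^ j * eigenfun y2 c)"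
        unfolding that by (simp add: algebra_simps)
      finally show ?thesis .
    qed
    thus ?thesis by (simp only: spectral_add[OF cont cont] spectral_cmult)
  qed
  consider "y = 0" | "y = 1" | "y \<noteq> 0" "y \<noteq> 1" by blast
  thus ?case
  proof cases
    case 1
    thus ?thesis
      using lin[of "a / 2" "-1" "(s - b) / 2" 1] eigenfun_M[of _ 0]
      by (simp add: coord_Cop coord_M Suc.IH add_divide_distrib)
  next
    case 2
    thus ?thesis
      using lin[of "(s - b) / 2" 0 "a / 2" 2] eigenfun_M[of _ 1]
      by (simp add: coord_Cop coord_M Suc.IH add_divide_distrib)
  next
    case 3
    thus ?thesis
      using lin[of "a / 2" "y + 1" "a / 2" "y - 1"] eigenfun_M[of _ y]
      by (simp add: coord_Cop coord_M Suc.IH add_divide_distrib distrib_left)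
  qed
qed

lemma inner_Cop: "inner (Cop f) g = inner f (Cop g)"
  by (simp add: Cop_def inner_M)

lemma inner_Cop_power: "inner ((Cop ^^ j) f) g = inner f ((Cop ^^ j) g)"
  by (induction j arbitrary: g) (simp_all add: inner_Cop flip: funpow_swap1)

lemma inner_Cop_power_site:
  "inner ((Cop ^^ i) (site 0)) ((Cop ^^ j) (site 0)) = spectral (\<lambda>c. c ^ (i + j))"
proof -
  have "inner ((Cop ^^ i) (site 0)) ((Cop ^^ j) (site 0)) = coord ((Cop ^^ (i + j)) (site 0)) 0"
    by (simp add: inner_Cop_power inner_site funpow_add)
  with one_plus_th2 show ?thesis by (simp add: coord_Cop_power_site eigenfun_def)
qed

end

section \<open>Convergence of the moments\<close>

text \<open>A difference equation in j whose boundary condition is imposed at infinity. It is used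
  twice, since the moments satisfy a second-order relation.\<close>

lemma tendsto_0_of_differences:
  fixes G :: "nat \<Rightarrow> nat \<Rightarrow> real"
  assumes diff: "\<And>j. (\<lambda>t. G j t - G (Suc j) t) \<longlonglongrightarrow> 0"
    and small: "\<And>e. e > 0 \<Longrightarrow> \<exists>J. \<forall>j\<ge>J. \<forall>\<^sub>F t in sequentially. \<bar>G j t\<bar> < e"
  shows "(\<lambda>t. G j t) \<longlonglongrightarrow> 0"
proof (rule tendstoI)
  fix e :: real assume e: "e > 0"
  then obtain J where "\<forall>j\<ge>J. \<forall>\<^sub>F t in sequentially. \<bar>G j t\<bar> < e / 2" using small[of "e / 2"] by auto
  hence J: "\<forall>\<^sub>F t in sequentially. \<bar>G (j + J) t\<bar> < e / 2" by simp
  have "(\<lambda>t. G j t - G (j + n) t) \<longlonglongrightarrow> 0" for n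
  proof (induction n)
    case (Suc n)
    from tendsto_add[OF this diff[of "j + n"]] show ?case by simp
  qed simp
  from tendstoD[OF this[of J], of "e / 2"] e
  have "\<forall>\<^sub>F t in sequentially. \<bar>G j t - G (j + J) t\<bar> < e / 2" by (simp add: dist_real_def)
  with J show "\<forall>\<^sub>F t in sequentially. dist (G j t) 0 < e"
    by eventually_elim (unfold dist_real_def, linarith)
qed

definition scaled_sq :: "nat \<Rightarrow> fsv \<Rightarrow> fsv" where "scaled_sq t f = (1 / (real t)\<^sup>2) *\<^sub>R position (position f)"

lemma linear_B [simp]:
  "scaled_sq t (f + g) = scaled_sq t f + scaled_sq t g" "scaled_sq t (f - g) = scaled_sq t f - scaled_sq t g" "scaled_sq t (c *\<^sub>R f) = c *\<^sub>R scaled_sq t f"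
  by (simp_all add: scaled_sq_def algebra_simps)

lemma inner_B: "inner (scaled_sq t f) g = inner f (scaled_sq t g)"
  by (simp add: scaled_sq_def inner_X)

lemma inner_B_power: "inner ((scaled_sq t ^^ m) f) g = inner f ((scaled_sq t ^^ m) g)"
  by (induction m arbitrary: g) (simp_all add: inner_B flip: funpow_swap1)

lemma supp_in_B: "supp_in n f \<Longrightarrow> supp_in n (scaled_sq t f)"
  unfolding scaled_sq_def by blast

lemma norm_B_le:
  assumes "supp_in n f"
  shows "norm (scaled_sq t f) \<le> (real n / real t)\<^sup>2 * norm f"
proof -
  have "norm (position (position f)) \<le> real n * (real n * norm f)"
    using norm_X_le[OF supp_in_XE(1)[OF assms]] norm_X_le[OF assms]
    by (meson mult_left_mono of_nat_0_le_iff order_trans)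
  hence "norm (position (position f)) / (real t)\<^sup>2 \<le> real n * (real n * norm f) / (real t)\<^sup>2"
    by (rule divide_right_mono) simp
  thus ?thesis by (simp add: scaled_sq_def power_divide power2_eq_square)
qed

lemma norm_B_power_le:
  assumes "supp_in n f"
  shows "norm ((scaled_sq t ^^ m) f) \<le> ((real n / real t)\<^sup>2) ^ m * norm f"
proof (induction m)
  case (Suc m)
  have "supp_in n ((scaled_sq t ^^ m) f)" by (induction m) (use assms supp_in_B in auto)
  from norm_B_le[OF this, of t] have "norm ((scaled_sq t ^^ Suc m) f) \<le> (real n / real t)\<^sup>2 * norm ((scaled_sq t ^^ m) f)"
    by simp
  also have "\<dots> \<le> (real n / real t)\<^sup>2 * (((real n / real t)\<^sup>2) ^ m * norm f)"
    by (intro mult_left_mono Suc) simp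
  finally show ?case by (simp add: mult.assoc)
qed simp

lemma coord_B_power: "coord ((scaled_sq t ^^ m) f) y = ((\<bar>real_of_int y\<bar> / real t)\<^sup>2) ^ m * coord f y"
  by (induction m) (simp_all add: scaled_sq_def power_divide power2_eq_square)

context wall_walk
begin

abbreviation psi :: "nat \<Rightarrow> fsv" where "psi t \<equiv> orbit (site 0) t"

lemma norm_site [simp]: "norm (site y) = 1"
  by (simp add: norm_eq_sqrt_inner inner_site coord_site)

lemma supp_in_psi: "supp_in t (psi t)"
  using supp_in_orbit[of 0 "site 0" t] by (simp add: supp_in_def coord_site)

lemma orbit_Cop: "orbit (Cop f) t = Cop (orbit f t)"
  by (simp add: Cop_def orbit_linear orbit_MD)

lemma orbit_Cop_power: "orbit ((Cop ^^ j) f) t = (Cop ^^ j) (orbit f t)"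
  by (induction j) (simp_all add: orbit_Cop)

lemma norm_Cop_le: "norm (Cop f) \<le> norm f"
  using norm_MDK_le(1)[of f] by (simp add: Cop_def)

lemma supp_in_Cop: "supp_in n f \<Longrightarrow> supp_in (Suc n) (Cop f)"
  unfolding Cop_def by blast

lemma locally_summable_Cop: "locally_summable z \<Longrightarrow> locally_summable (\<lambda>t. Cop (z t))"
  unfolding Cop_def by (intro locally_summable_linear locally_summable_MDK)

lemma D_Cop: "D (Cop f) = Cop (D f)"
  by (simp add: Cop_def M_D)

lemma D_D_Cop: "D (D f) = 4 *\<^sub>R (Cop (Cop f) - f)"
  by (simp add: D_D Cop_def scaleR_right_diff_distrib)

lemma norm_B_power_psi_le:
  assumes "t > 0"
  shows "norm ((scaled_sq t ^^ m) (psi t)) \<le> 1"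
  using norm_B_power_le[OF supp_in_psi, of m t t] assms by simp

definition W :: "fsv \<Rightarrow> fsv" where "W f = Cop (Cop f) - f"

text \<open>The squared velocity law at the state D D g = 4 W g, g being a power of
  \<open>Cop\<close> applied to the initial state. It says (X^2 / t^2) (1 - C^2)^2 = (a^2 - C^2) (1
  - C^2) in the limit; both sides carry a factor 16 that is divided out.\<close>

lemma velocity_relation:
  "(\<lambda>t. norm (scaled_sq t (W (W ((Cop ^^ j) (psi t)))) -
     (Cop (Cop (W ((Cop ^^ j) (psi t)))) - a\<^sup>2 *\<^sub>R W ((Cop ^^ j) (psi t))))) \<longlonglongrightarrow> 0"
proof -
  define g where "g = (Cop ^^ j) (site 0)"
  have orb_g: "orbit g t = (Cop ^^ j) (psi t)" for t by (simp add: g_def orbit_Cop_power)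
  have "locally_summable (orbit (D g))"
    unfolding g_def
  proof (induction j)
    case 0
    thus ?case using locally_summable_D_site by simp
  next
    case (Suc j)
    thus ?case using locally_summable_Cop by (simp add: D_Cop orbit_Cop)
  qed
  hence "locally_summable (orbit (D (D g)))"
    using locally_summable_MDK(2) by (simp add: orbit_MD)
  from position_velocity_squared[OF this]
  have "(\<lambda>t. norm (position (position (D (D (orbit (D (D g)) t)))) - (real t)\<^sup>2 *\<^sub>R
      (M (M (orbit (D (D g)) t)) - (4 * a\<^sup>2) *\<^sub>R orbit (D (D g)) t)) / (real t)\<^sup>2 / 16) \<longlonglongrightarrow> 0 / 16"
    by (rule tendsto_divide) simp_all
  moreover have "\<forall>\<^sub>F t in sequentially. norm (position (position (D (D (orbit (D (D g)) t)))) - (real t)\<^sup>2 *\<^sub>R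
      (M (M (orbit (D (D g)) t)) - (4 * a\<^sup>2) *\<^sub>R orbit (D (D g)) t)) / (real t)\<^sup>2 / 16 =
      norm (scaled_sq t (W (W ((Cop ^^ j) (psi t)))) -
     (Cop (Cop (W ((Cop ^^ j) (psi t)))) - a\<^sup>2 *\<^sub>R W ((Cop ^^ j) (psi t))))"
    using eventually_gt_at_top[of 0]
  proof eventually_elim
    case (elim t)
    have w: "orbit (D (D g)) t = 4 *\<^sub>R W (orbit g t)"
      by (simp add: D_D_Cop W_def orbit_linear orbit_Cop)
    have MM: "M (M f) = 4 *\<^sub>R Cop (Cop f)" for f by (simp add: Cop_def)
    have "position (position (D (D (orbit (D (D g)) t)))) - (real t)\<^sup>2 *\<^sub>R
        (M (M (orbit (D (D g)) t)) - (4 * a\<^sup>2) *\<^sub>R orbit (D (D g)) t) =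
        (16 * (real t)\<^sup>2) *\<^sub>R (scaled_sq t (W (W (orbit g t))) - (Cop (Cop (W (orbit g t))) - a\<^sup>2 *\<^sub>R W (orbit g t)))"
      unfolding w unfolding MM D_D_Cop W_def scaled_sq_def using elim
      by (intro fsv_eqI) (simp add: algebra_simps)
    thus ?case using elim by (simp add: orb_g)
  qed
  ultimately show ?thesis using Lim_transform_eventually by simp
qed

definition mom :: "nat \<Rightarrow> nat \<Rightarrow> nat \<Rightarrow> real" where
  "mom m j t = inner ((scaled_sq t ^^ m) (psi t)) ((Cop ^^ j) (psi t))"

text \<open>The squared group velocity of the dispersion relation cos omega = a cos k, that is (a^2
  - c^2) / (1 - c^2) at c = a cos k.\<close>

definition vel2 :: "real \<Rightarrow> real" where
  "vel2 k = a\<^sup>2 * (sin k)\<^sup>2 / (1 - a\<^sup>2 * (cos k)\<^sup>2)"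

definition ac_mom :: "nat \<Rightarrow> nat \<Rightarrow> real" where
  "ac_mom m j = integral {0..pi} (\<lambda>k. vel2 k ^ m * (a * cos k) ^ j * weight k)"

definition lim_mom :: "nat \<Rightarrow> nat \<Rightarrow> real" where
  "lim_mom m j = (if m = 0 then atom * ((1 + (-1) ^ j) / 2) else 0) + (1 - atom) * ac_mom m j"

lemma continuous_vel2 [continuous_intros]: "continuous_on S vel2"
  unfolding vel2_def using den_pos by (intro continuous_intros) (auto simp: less_le)

lemma vel2_bounds: "0 \<le> vel2 k" "vel2 k \<le> 1"
proof -
  show "0 \<le> vel2 k" using den_pos[of k] by (simp add: vel2_def)
  have "a\<^sup>2 * (sin k)\<^sup>2 = a\<^sup>2 - a\<^sup>2 * (cos k)\<^sup>2" by (simp add: sin_squared_eq algebra_simps)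
  moreover have "a\<^sup>2 < 1" using a2 b_pos by simp
  ultimately show "vel2 k \<le> 1" using den_pos[of k] by (simp add: vel2_def)
qed

lemma ac_mom_has_integral:
  "((\<lambda>k. vel2 k ^ m * (a * cos k) ^ j * weight k) has_integral ac_mom m j) {0..pi}"
  unfolding ac_mom_def
  by (intro integrable_integral integrable_continuous_real continuous_intros)

lemma lim_mom_rec: "lim_mom (Suc m) (j + 4) - 2 * lim_mom (Suc m) (j + 2) + lim_mom (Suc m) j =
  lim_mom m (j + 4) - (1 + a\<^sup>2) * lim_mom m (j + 2) + a\<^sup>2 * lim_mom m j"
proof -
  let ?f = "\<lambda>m j k. vel2 k ^ m * (a * cos k) ^ j * weight k"
  have v: "vel2 k * (1 - (a * cos k)\<^sup>2) = a\<^sup>2 - (a * cos k)\<^sup>2" for k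
  proof -
    have "vel2 k * (1 - (a * cos k)\<^sup>2) = a\<^sup>2 * (sin k)\<^sup>2"
      using den_pos[of k] by (simp add: vel2_def power_mult_distrib)
    thus ?thesis by (simp add: sin_squared_eq power_mult_distrib algebra_simps)
  qed
  have "?f (Suc m) (j + 4) k - 2 * ?f (Suc m) (j + 2) k + ?f (Suc m) j k =
      ?f m (j + 4) k - (1 + a\<^sup>2) * ?f m (j + 2) k + a\<^sup>2 * ?f m j k" for k
  proof -
    have poly: "(v * p) * (q * c ^ 4) * w - 2 * ((v * p) * (q * c\<^sup>2) * w) + (v * p) * q * w =
        (v * (1 - c\<^sup>2)) * (1 - c\<^sup>2) * (p * q * w)"
      "(a\<^sup>2 - c\<^sup>2) * (1 - c\<^sup>2) * (p * q * w) =
        p * (q * c ^ 4) * w - (1 + a\<^sup>2) * (p * (q * c\<^sup>2) * w) + a\<^sup>2 * (p * q * w)"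
      for v p q c w :: real
      by (simp_all add: algebra_simps power2_eq_square power4_eq_xxxx)
    have "?f (Suc m) (j + 4) k - 2 * ?f (Suc m) (j + 2) k + ?f (Suc m) j k =
        (vel2 k * (1 - (a * cos k)\<^sup>2)) * (1 - (a * cos k)\<^sup>2) * ?f m j k"
      unfolding power_Suc power_add by (rule poly)
    also have "\<dots> = ?f m (j + 4) k - (1 + a\<^sup>2) * ?f m (j + 2) k + a\<^sup>2 * ?f m j k"
      unfolding v power_add by (rule poly)
    finally show ?thesis .
  qed
  moreover have "((\<lambda>k. ?f (Suc m) (j + 4) k - 2 * ?f (Suc m) (j + 2) k + ?f (Suc m) j k) has_integral
      ac_mom (Suc m) (j + 4) - 2 * ac_mom (Suc m) (j + 2) + ac_mom (Suc m) j) {0..pi}"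
    by (intro has_integral_add has_integral_diff has_integral_mult_right ac_mom_has_integral)
  moreover have "((\<lambda>k. ?f m (j + 4) k - (1 + a\<^sup>2) * ?f m (j + 2) k + a\<^sup>2 * ?f m j k) has_integral
      ac_mom m (j + 4) - (1 + a\<^sup>2) * ac_mom m (j + 2) + a\<^sup>2 * ac_mom m j) {0..pi}"
    by (intro has_integral_add has_integral_diff has_integral_mult_right ac_mom_has_integral)
  ultimately have ac: "ac_mom (Suc m) (j + 4) - 2 * ac_mom (Suc m) (j + 2) + ac_mom (Suc m) j =
      ac_mom m (j + 4) - (1 + a\<^sup>2) * ac_mom m (j + 2) + a\<^sup>2 * ac_mom m j"
    by (simp only: has_integral_unique)
  have "lim_mom (Suc m) (j + 4) - 2 * lim_mom (Suc m) (j + 2) + lim_mom (Suc m) j =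
      (1 - atom) * (ac_mom (Suc m) (j + 4) - 2 * ac_mom (Suc m) (j + 2) + ac_mom (Suc m) j)"
    by (simp add: lim_mom_def algebra_simps)
  \<comment> \<open>The atoms, present for m = 0 only, cancel: the coefficients 1, -(1 + a^2) and
    a^2 add up to 0 and the indices have equal parity.\<close>
  also have "\<dots> = lim_mom m (j + 4) - (1 + a\<^sup>2) * lim_mom m (j + 2) + a\<^sup>2 * lim_mom m j"
    unfolding ac by (simp add: lim_mom_def algebra_simps power_add add_divide_distrib)
  finally show ?thesis .
qed

lemma ac_mom_even_bounds: "0 \<le> ac_mom m (2 * j)" "ac_mom m (2 * j) \<le> a ^ (2 * j)"
proof -
  have pos: "vel2 k ^ m * (a * cos k) ^ (2 * j) * weight k \<ge> 0" for k
    using vel2_bounds(1)[of k] weight_nonneg[of k] by (simp add: power_mult)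
  show "0 \<le> ac_mom m (2 * j)"
    unfolding ac_mom_def by (rule integral_nonneg) (use pos ac_mom_has_integral in auto)
  have "((\<lambda>k. a ^ (2 * j) * weight k) has_integral a ^ (2 * j) * integral {0..pi} weight) {0..pi}"
    by (intro has_integral_mult_right integrable_integral integrable_continuous_real continuous_intros)
  moreover have "vel2 k ^ m * (a * cos k) ^ (2 * j) * weight k \<le> a ^ (2 * j) * weight k" for k
  proof (rule mult_right_mono[OF _ weight_nonneg])
    have "(a * cos k) ^ (2 * j) \<le> a ^ (2 * j)"
      using power_mono[of "(cos k)\<^sup>2" 1 j]
      by (simp add: power_mult_distrib power_mult abs_square_le_1 mult_left_le)
    moreover have "vel2 k ^ m \<le> 1" using vel2_bounds[of k] by (simp add: power_le_one)
    ultimately show "vel2 k ^ m * (a * cos k) ^ (2 * j) \<le> a ^ (2 * j)"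
      using mult_mono[of "vel2 k ^ m" 1 "(a * cos k) ^ (2 * j)" "a ^ (2 * j)"] by (simp add: power_mult)
  qed
  ultimately show "ac_mom m (2 * j) \<le> a ^ (2 * j)"
    using has_integral_le[OF ac_mom_has_integral[of m "2 * j"]] integral_weight by fastforce
qed

section \<open>High powers of \<open>Cop\<close> as approximate projections onto the localized
  part\<close>

lemma atom_bounds: "0 \<le> atom" "atom < 1"
  using b_pos b_less_1 by (auto simp: atom_def)

lemma inner_Cop_even:
  "inner ((Cop ^^ (2 * i)) (site 0)) ((Cop ^^ (2 * j)) (site 0)) = atom + (1 - atom) * ac_mom 0 (2 * (i + j))"
  unfolding inner_Cop_power_site distrib_left[symmetric] by (simp add: spectral_def ac_mom_def)

lemma ac_part_bounds: "0 \<le> (1 - atom) * ac_mom 0 (2 * n)" "(1 - atom) * ac_mom 0 (2 * n) \<le> a ^ (2 * n)"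
  using ac_mom_even_bounds[of 0 n] atom_bounds mult_mono[of "1 - atom" 1 "ac_mom 0 (2 * n)" "a ^ (2 * n)"]
  by auto

text \<open>In even powers the atoms contribute the same constant to every inner product and cancel
  in the difference; what remains lives on [-a, a] and decays geometrically. The sequence is thus
  Cauchy.\<close>

lemma norm_Cop_even_diff_le:
  assumes "j \<le> i"
  shows "norm ((Cop ^^ (2 * i)) (site 0) - (Cop ^^ (2 * j)) (site 0)) \<le> 2 * a ^ (2 * j)"
proof (rule power2_le_imp_le)
  let ?l = "\<lambda>n. (1 - atom) * ac_mom 0 (2 * n)"
  have "(norm ((Cop ^^ (2 * i)) (site 0) - (Cop ^^ (2 * j)) (site 0)))\<^sup>2 = ?l (i + i) - 2 * ?l (i + j) + ?l (j + j)"
    unfolding power2_norm_eq_inner inner_diff_left inner_diff_right inner_Cop_even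
    by (simp add: add.commute)
  also have "\<dots> \<le> a ^ (2 * (i + i)) + a ^ (2 * (j + j))"
    using ac_part_bounds[of "i + i"] ac_part_bounds[of "i + j"] ac_part_bounds[of "j + j"] by linarith
  also have "a ^ (2 * (i + i)) \<le> a ^ (2 * (j + j))"
    using assms a_pos a_less_1 by (intro power_decreasing) auto
  also have "a ^ (2 * (j + j)) + a ^ (2 * (j + j)) = 2 * (a ^ (2 * j))\<^sup>2"
    by (simp add: power2_eq_square distrib_left flip: power_add)
  also have "\<dots> \<le> (2 * a ^ (2 * j))\<^sup>2" by (simp add: power_mult_distrib)
  finally show "(norm ((Cop ^^ (2 * i)) (site 0) - (Cop ^^ (2 * j)) (site 0)))\<^sup>2 \<le> (2 * a ^ (2 * j))\<^sup>2"
    by simp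
qed (use a_pos in simp)

text \<open>\<open>D\<close> is antisymmetric with D^2 = 4 (C^2 - 1), so its squared norm involves
  only a difference of consecutive even moments, in which the atoms cancel.\<close>

lemma norm_D_Cop_even_le: "norm (D ((Cop ^^ (2 * i)) (site 0))) \<le> 2 * a ^ (2 * i)"
proof (rule power2_le_imp_le)
  let ?l = "\<lambda>n. (1 - atom) * ac_mom 0 (2 * n)"
  define f where "f = (Cop ^^ (2 * i)) (site 0)"
  have "inner (D f) (D f) = - inner f (D (D f))"
    by (simp add: D_def inner_U inner_Ui inner_simps)
  also have "\<dots> = 4 * (inner f f - inner f (Cop (Cop f)))"
    unfolding D_D_Cop by (simp add: inner_simps)
  also have "Cop (Cop f) = (Cop ^^ (2 * Suc i)) (site 0)" by (simp add: f_def)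
  also have "4 * (inner f f - inner f ((Cop ^^ (2 * Suc i)) (site 0))) = 4 * (?l (i + i) - ?l (i + Suc i))"
    unfolding f_def inner_Cop_even by simp
  also have "\<dots> \<le> 4 * a ^ (2 * (i + i))"
  proof -
    have "4 * (x - y) \<le> 4 * z" if "x \<le> z" "0 \<le> y" for x y z :: real using that by simp
    thus ?thesis using ac_part_bounds(2)[of "i + i"] ac_part_bounds(1)[of "i + Suc i"] by blast
  qed
  also have "\<dots> = (2 * a ^ (2 * i))\<^sup>2" by (simp add: power2_eq_square distrib_left flip: power_add)
  finally show "(norm (D ((Cop ^^ (2 * i)) (site 0))))\<^sup>2 \<le> (2 * a ^ (2 * i))\<^sup>2"
    by (simp add: power2_norm_eq_inner f_def)
qed (use a_pos in simp)

text \<open>Two steps of the walk move a vector by U D f, of norm at most that of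
  \<open>D f\<close>. An almost-eigenvector is therefore nearly periodic with period 2 (the
  eigenvalues of \<open>U\<close> in question are 1 and -1).\<close>

lemma norm_orbit_mod2_le: "norm (orbit f t - orbit f (t mod 2)) \<le> real t * norm (D f)"
proof -
  have even: "norm (orbit f (2 * n) - f) \<le> real n * norm (D f)" for n
  proof (induction n)
    case (Suc n)
    have "orbit f (2 * Suc n) - f = U (U (orbit f (2 * n) - f)) + U (D f)"
      by (simp add: D_def)
    also have "norm \<dots> \<le> norm (orbit f (2 * n) - f) + norm (D f)"
      by (rule order_trans[OF norm_triangle_ineq]) (simp only: norm_U)
    finally show ?case using Suc by (simp add: algebra_simps)
  qed simp
  have "orbit f t = orbit (orbit f (2 * (t div 2))) (t mod 2)"
    using funpow_add[of "t mod 2" "2 * (t div 2)" U] by simp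
  hence "orbit f t - orbit f (t mod 2) = orbit (orbit f (2 * (t div 2)) - f) (t mod 2)"
    by (simp add: orbit_linear)
  hence "norm (orbit f t - orbit f (t mod 2)) = norm (orbit f (2 * (t div 2)) - f)" by simp
  also have "\<dots> \<le> real (t div 2) * norm (D f)" by (rule even)
  also have "\<dots> \<le> real t * norm (D f)" by (intro mult_right_mono) auto
  finally show ?thesis .
qed

text \<open>The eigenvectors of \<open>Cop\<^sup>2\<close> for the eigenvalue \<open>1\<close> are localized near the wall and do not contribute
  to the moments with \<open>m \<ge> 1\<close>. They are not finitely supported; \<open>Cop ^ (2 i)\<close> applied to the initial
  state with \<open>i\<close> of order \<open>sqrt t\<close> is used instead.\<close>
lemma mom_bound:
  assumes "t > 0" "j \<le> i" "2 * i + 1 \<le> t"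
  shows "\<bar>mom (Suc m) (2 * j) t\<bar> \<le> 2 * a ^ (2 * j) + real t * (2 * a ^ (2 * i)) + (real (2 * i + 1) / real t)\<^sup>2"
proof -
  define f where "f = (\<lambda>i. (Cop ^^ (2 * i)) (site 0))"
  define g where "g = (scaled_sq t ^^ Suc m) (psi t)"
  have g: "norm g \<le> 1" using norm_B_power_psi_le[OF assms(1)] by (simp add: g_def del: funpow.simps)
  have CS: "\<bar>inner g h\<bar> \<le> norm h" for h
    using Cauchy_Schwarz_ineq2[of g h] mult_right_mono[OF g, of "norm h"] by simp
  have "mom (Suc m) (2 * j) t = inner g (orbit (f j) t)"
    by (simp add: mom_def g_def f_def orbit_Cop_power)
  \<comment> \<open>Three errors: the part of f j off the localized states, the drift of f i over t
    steps, and a vector supported within 2 i + 1 of the wall, on which X / t is small.\<close>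
  also have "\<dots> = inner g (orbit (f j - f i) t) + inner g (orbit (f i) t - orbit (f i) (t mod 2))
      + inner g (orbit (f i) (t mod 2))"
    by (simp add: orbit_linear inner_simps)
  finally have mom_eq: "mom (Suc m) (2 * j) t = inner g (orbit (f j - f i) t) +
      inner g (orbit (f i) t - orbit (f i) (t mod 2)) + inner g (orbit (f i) (t mod 2))" .
  have 1: "\<bar>inner g (orbit (f j - f i) t)\<bar> \<le> 2 * a ^ (2 * j)"
    using CS[of "orbit (f j - f i) t"] norm_Cop_even_diff_le[OF assms(2)]
    by (simp add: f_def norm_minus_commute)
  have "\<bar>inner g (orbit (f i) t - orbit (f i) (t mod 2))\<bar> \<le> real t * norm (D (f i))"
    using CS norm_orbit_mod2_le order_trans by blast
  also have "\<dots> \<le> real t * (2 * a ^ (2 * i))"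
    unfolding f_def by (intro mult_left_mono norm_D_Cop_even_le) simp
  finally have 2: "\<bar>inner g (orbit (f i) t - orbit (f i) (t mod 2))\<bar> \<le> real t * (2 * a ^ (2 * i))" .
  have Cop_n: "norm ((Cop ^^ n) (site 0)) \<le> 1" "supp_in n ((Cop ^^ n) (site 0))" for n
  proof (induction n)
    case (Suc n)
    case 1 show ?case using Suc(1) norm_Cop_le by (simp, meson order_trans)
    case 2 show ?case using Suc(2) by (simp add: supp_in_Cop)
  qed (simp_all add: supp_in_def coord_site)
  have "supp_in (2 * i + t mod 2) (orbit (f i) (t mod 2))"
    unfolding f_def by (intro supp_in_orbit Cop_n)
  hence "supp_in (2 * i + 1) (orbit (f i) (t mod 2))"
    by (rule supp_in_mono) simp
  from norm_B_power_le[OF this, of "Suc m" t]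
  have "norm ((scaled_sq t ^^ Suc m) (orbit (f i) (t mod 2))) \<le> ((real (2 * i + 1) / real t)\<^sup>2) ^ Suc m * norm (f i)"
    by (simp del: funpow.simps)
  also have "\<dots> \<le> (real (2 * i + 1) / real t)\<^sup>2 * 1"
  proof (intro mult_mono)
    have "(real (2 * i + 1) / real t)\<^sup>2 \<le> 1"
      using assms(1,3) by (intro power_le_one) (auto simp: field_simps)
    thus "((real (2 * i + 1) / real t)\<^sup>2) ^ Suc m \<le> (real (2 * i + 1) / real t)\<^sup>2"
      using power_decreasing[of 1 "Suc m" "(real (2 * i + 1) / real t)\<^sup>2"] by simp
  qed (use Cop_n in \<open>auto simp: f_def\<close>)
  finally have "norm ((scaled_sq t ^^ Suc m) (orbit (f i) (t mod 2))) \<le> (real (2 * i + 1) / real t)\<^sup>2" by simp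
  moreover have "inner g (orbit (f i) (t mod 2)) = inner (psi t) ((scaled_sq t ^^ Suc m) (orbit (f i) (t mod 2)))"
    unfolding g_def by (rule inner_B_power)
  ultimately have 3: "\<bar>inner g (orbit (f i) (t mod 2))\<bar> \<le> (real (2 * i + 1) / real t)\<^sup>2"
    using Cauchy_Schwarz_ineq2[of "psi t" "(scaled_sq t ^^ Suc m) (orbit (f i) (t mod 2))"]
    by (simp del: funpow.simps)
  show ?thesis unfolding mom_eq using 1 2 3 by linarith
qed

lemma eventually_mom_le:
  assumes "d > 0"
  shows "\<forall>\<^sub>F t in sequentially. \<bar>mom (Suc m) (2 * j) t\<bar> \<le> 2 * a ^ (2 * j) + d"
proof -
  \<comment> \<open>The order sqrt t is large enough for t a^(2i) to vanish and small enough for (2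
    i + 1) / t to vanish.\<close>
  define i where "i = floor_sqrt"
  have i_top: "filterlim i at_top sequentially"
    unfolding filterlim_at_top i_def
    by (intro allI eventually_sequentiallyI) (auto simp: le_floor_sqrt_iff)
  have "(\<lambda>n. (real n * a ^ n + a ^ n)\<^sup>2) \<longlonglongrightarrow> (0 + 0)\<^sup>2"
    using a_pos a_less_1 by (intro tendsto_intros powser_times_n_limit_0 LIMSEQ_power_zero) auto
  hence "(\<lambda>t. (real (i t) * a ^ i t + a ^ i t)\<^sup>2) \<longlonglongrightarrow> 0"
    using filterlim_compose[OF _ i_top] by fastforce
  moreover have "(\<lambda>t. ((2 * sqrt (real t) + 1) / real t)\<^sup>2) \<longlonglongrightarrow> 0" by real_asymp
  ultimately have "(\<lambda>t. 2 * (real (i t) * a ^ i t + a ^ i t)\<^sup>2 + ((2 * sqrt (real t) + 1) / real t)\<^sup>2) \<longlonglongrightarrow> 2 * 0 + 0"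
    by (intro tendsto_intros)
  hence "\<forall>\<^sub>F t in sequentially. 2 * (real (i t) * a ^ i t + a ^ i t)\<^sup>2 + ((2 * sqrt (real t) + 1) / real t)\<^sup>2 < d"
    using assms by (simp add: order_tendsto_iff)
  moreover have "\<forall>\<^sub>F t in sequentially. i t \<ge> j" using i_top by (simp add: filterlim_at_top)
  moreover have "\<forall>\<^sub>F t in sequentially. t \<ge> 9" by (rule eventually_ge_at_top)
  ultimately show ?thesis
  proof eventually_elim
    case (elim t)
    have sq: "(i t)\<^sup>2 \<le> t" "t < (Suc (i t))\<^sup>2"
      unfolding i_def by (simp_all add: Suc_floor_sqrt_power2_gt)
    \<comment> \<open>From i >= 3 follows 2 i + 1 <= 3 i <= i^2 <= t, as \<open>mom_bound\<close>
      requires.\<close>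
    have "i t \<ge> 3" using elim by (simp add: i_def le_floor_sqrt_iff)
    hence "3 * i t \<le> (i t)\<^sup>2" by (simp add: power2_eq_square)
    hence "2 * i t + 1 \<le> t" using sq \<open>i t \<ge> 3\<close> by linarith
    from mom_bound[OF _ elim(2) this, of m]
    have "\<bar>mom (Suc m) (2 * j) t\<bar> \<le> 2 * a ^ (2 * j) + real t * (2 * a ^ (2 * i t)) + (real (2 * i t + 1) / real t)\<^sup>2"
      using elim by simp
    moreover have "real t * (2 * a ^ (2 * i t)) \<le> 2 * (real (i t) * a ^ i t + a ^ i t)\<^sup>2"
    proof -
      have "real t \<le> (real (i t) + 1)\<^sup>2"
        using sq(2) by (metis Suc_eq_plus1 less_imp_le of_nat_1 of_nat_add of_nat_le_iff of_nat_power)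
      hence "real t * (2 * a ^ (2 * i t)) \<le> (real (i t) + 1)\<^sup>2 * (2 * a ^ (2 * i t))"
        using a_pos by (intro mult_right_mono) auto
      also have "\<dots> = 2 * ((real (i t) + 1) * a ^ i t)\<^sup>2"
        by (simp add: power_mult_distrib power_even_eq)
      also have "(real (i t) + 1) * a ^ i t = real (i t) * a ^ i t + a ^ i t"
        by (simp add: distrib_right)
      finally show ?thesis .
    qed
    moreover have "(real (2 * i t + 1) / real t)\<^sup>2 \<le> ((2 * sqrt (real t) + 1) / real t)\<^sup>2"
    proof (intro power_mono divide_right_mono)
      have "real (i t) \<le> sqrt (real t)"
        using sq(1) by (metis of_nat_le_iff of_nat_power real_le_rsqrt)
      thus "real (2 * i t + 1) \<le> 2 * sqrt (real t) + 1" by simp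
    qed auto
    ultimately show ?case using elim(1) by linarith
  qed
qed

lemma mom_rec: "(\<lambda>t. mom (Suc m) (j + 4) t - 2 * mom (Suc m) (j + 2) t + mom (Suc m) j t -
  (mom m (j + 4) t - (1 + a\<^sup>2) * mom m (j + 2) t + a\<^sup>2 * mom m j t)) \<longlonglongrightarrow> 0"
proof (rule Lim_null_comparison[OF _ velocity_relation[of j]])
  show "\<forall>\<^sub>F t in sequentially. norm (mom (Suc m) (j + 4) t - 2 * mom (Suc m) (j + 2) t + mom (Suc m) j t -
    (mom m (j + 4) t - (1 + a\<^sup>2) * mom m (j + 2) t + a\<^sup>2 * mom m j t)) \<le>
    norm (scaled_sq t (W (W ((Cop ^^ j) (psi t)))) -
     (Cop (Cop (W ((Cop ^^ j) (psi t)))) - a\<^sup>2 *\<^sub>R W ((Cop ^^ j) (psi t))))"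
    using eventually_gt_at_top[of 0]
  proof eventually_elim
    case (elim t)
    define g where "g = (scaled_sq t ^^ m) (psi t)"
    define c where "c = (Cop ^^ j) (psi t)"
    have g: "norm g \<le> 1" using norm_B_power_psi_le[OF elim] by (simp add: g_def)
    have Suc: "mom (Suc m) i t = inner g (scaled_sq t ((Cop ^^ i) (psi t)))" for i
      by (simp add: mom_def g_def inner_B)
    have Cop4: "(Cop ^^ (j + 2)) (psi t) = Cop (Cop c)"
      "(Cop ^^ (j + 4)) (psi t) = Cop (Cop (Cop (Cop c)))"
      by (simp_all add: c_def eval_nat_numeral)
    have "mom (Suc m) (j + 4) t - 2 * mom (Suc m) (j + 2) t + mom (Suc m) j t -
      (mom m (j + 4) t - (1 + a\<^sup>2) * mom m (j + 2) t + a\<^sup>2 * mom m j t) =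
      inner g (scaled_sq t (W (W c)) - (Cop (Cop (W c)) - a\<^sup>2 *\<^sub>R W c))"
      unfolding Suc unfolding mom_def g_def[symmetric] Cop4 c_def[symmetric] W_def
      by (simp add: inner_simps algebra_simps)
    also have "norm \<dots> \<le> norm g * norm (scaled_sq t (W (W c)) - (Cop (Cop (W c)) - a\<^sup>2 *\<^sub>R W c))"
      using Cauchy_Schwarz_ineq2 by simp
    also have "\<dots> \<le> 1 * norm (scaled_sq t (W (W c)) - (Cop (Cop (W c)) - a\<^sup>2 *\<^sub>R W c))"
      by (intro mult_right_mono g) simp
    finally show ?case by (simp add: c_def)
  qed
qed

text \<open>The error against \<open>lim_mom\<close> has vanishing second differences in j by
  \<open>mom_rec\<close> and the induction hypothesis, and is small for large j. Descending from
  large j twice gives first its first differences and then the error itself. The recursion moves j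
  by 2, so the even exponents form a closed system.\<close>

theorem moments_converge: "(\<lambda>t. mom m (2 * j) t) \<longlonglongrightarrow> lim_mom m (2 * j)"
proof (induction m arbitrary: j)
  case 0
  have "mom 0 (2 * j) t = lim_mom 0 (2 * j)" for t
    using inner_Cop_even[of 0 j]
    by (simp add: mom_def lim_mom_def flip: orbit_Cop_power)
  thus ?case by simp
next
  case (Suc m)
  define G where "G = (\<lambda>j t. mom (Suc m) (2 * j) t - lim_mom (Suc m) (2 * j))"
  have small: "\<exists>J. \<forall>j\<ge>J. \<forall>\<^sub>F t in sequentially. \<bar>G j t\<bar> < e" if e: "e > 0" for e
  proof -
    \<comment> \<open>The constant leaves room for 2 from \<open>eventually_mom_le\<close>, 1 for
      its slack d = a^(2j), and 1 for \<open>lim_mom\<close>.\<close>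
    have "(\<lambda>j. 5 * (a\<^sup>2) ^ j) \<longlonglongrightarrow> 5 * 0"
      using a_pos a_less_1 by (intro tendsto_intros LIMSEQ_power_zero) (simp add: abs_square_less_1)
    hence "\<forall>\<^sub>F j in sequentially. 5 * (a\<^sup>2) ^ j < e" using e by (simp add: order_tendsto_iff)
    then obtain J where J: "\<And>j. j \<ge> J \<Longrightarrow> 5 * (a\<^sup>2) ^ j < e" by (auto simp: eventually_sequentially)
    have "\<forall>\<^sub>F t in sequentially. \<bar>G j t\<bar> < e" if "j \<ge> J" for j
    proof -
      have aj: "a ^ (2 * j) > 0" using a_pos by simp
      have "0 \<le> lim_mom (Suc m) (2 * j)" "lim_mom (Suc m) (2 * j) \<le> a ^ (2 * j)"
        using ac_mom_even_bounds[of "Suc m" j] atom_bounds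
          mult_mono[of "1 - atom" 1 "ac_mom (Suc m) (2 * j)" "a ^ (2 * j)"]
        by (auto simp: lim_mom_def)
      moreover have "5 * a ^ (2 * j) < e" using J[OF that] by (simp add: power_mult)
      ultimately show ?thesis
        using eventually_mom_le[OF aj, of m j] aj by (auto simp: G_def elim!: eventually_mono)
    qed
    thus ?thesis by blast
  qed
  have second: "(\<lambda>t. (G j t - G (Suc j) t) - (G (Suc j) t - G (Suc (Suc j)) t)) \<longlonglongrightarrow> 0" for j
  proof -
    have idx: "2 * Suc j = 2 * j + 2" "2 * Suc (Suc j) = 2 * j + 4" by simp_all
    have "(\<lambda>t. mom m (2 * j + 4) t - (1 + a\<^sup>2) * mom m (2 * j + 2) t + a\<^sup>2 * mom m (2 * j) t) \<longlonglongrightarrow>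
        lim_mom m (2 * j + 4) - (1 + a\<^sup>2) * lim_mom m (2 * j + 2) + a\<^sup>2 * lim_mom m (2 * j)"
      unfolding idx[symmetric] by (intro tendsto_intros Suc.IH)
    from tendsto_diff[OF tendsto_add[OF mom_rec[of m "2 * j"] this] tendsto_const[of "lim_mom (Suc m) (2 * j + 4) -
        2 * lim_mom (Suc m) (2 * j + 2) + lim_mom (Suc m) (2 * j)"]]
    have "(\<lambda>t. mom (Suc m) (2 * j + 4) t - 2 * mom (Suc m) (2 * j + 2) t + mom (Suc m) (2 * j) t -
        (lim_mom (Suc m) (2 * j + 4) - 2 * lim_mom (Suc m) (2 * j + 2) + lim_mom (Suc m) (2 * j))) \<longlonglongrightarrow> 0"
      unfolding lim_mom_rec by simp
    moreover have "G j t - G (Suc j) t - (G (Suc j) t - G (Suc (Suc j)) t) =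
        mom (Suc m) (2 * j + 4) t - 2 * mom (Suc m) (2 * j + 2) t + mom (Suc m) (2 * j) t -
        (lim_mom (Suc m) (2 * j + 4) - 2 * lim_mom (Suc m) (2 * j + 2) + lim_mom (Suc m) (2 * j))" for t
      unfolding G_def idx by simp
    ultimately show ?thesis by simp
  qed
  have first: "(\<lambda>t. G j t - G (Suc j) t) \<longlonglongrightarrow> 0" for j
  proof (rule tendsto_0_of_differences[of "\<lambda>j t. G j t - G (Suc j) t"])
    show "(\<lambda>t. G j t - G (Suc j) t - (G (Suc j) t - G (Suc (Suc j)) t)) \<longlonglongrightarrow> 0" for j
      by (rule second)
    fix e :: real assume "e > 0"
    then obtain J where J: "\<forall>j\<ge>J. \<forall>\<^sub>F t in sequentially. \<bar>G j t\<bar> < e / 2" using small[of "e / 2"] by auto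
    have "\<forall>\<^sub>F t in sequentially. \<bar>G j t - G (Suc j) t\<bar> < e" if "j \<ge> J" for j
    proof -
      have "\<forall>\<^sub>F t in sequentially. \<bar>G j t\<bar> < e / 2" "\<forall>\<^sub>F t in sequentially. \<bar>G (Suc j) t\<bar> < e / 2"
        using J that by auto
      thus ?thesis by eventually_elim linarith
    qed
    thus "\<exists>J. \<forall>j\<ge>J. \<forall>\<^sub>F t in sequentially. \<bar>G j t - G (Suc j) t\<bar> < e" by blast
  qed
  have "(\<lambda>t. G j t) \<longlonglongrightarrow> 0" using first small by (rule tendsto_0_of_differences)
  thus ?case unfolding G_def by (simp add: LIM_zero_iff)
qed

end

section \<open>Convergence of expectations\<close>

context wall_walk
begin

definition expect :: "nat \<Rightarrow> (real \<Rightarrow> real) \<Rightarrow> real" where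
  "expect t g = (\<Sum>y\<in>{- int t..int t}. (coord (psi t) y)\<^sup>2 * g (\<bar>real_of_int y\<bar> / real t))"

definition lim_expect :: "(real \<Rightarrow> real) \<Rightarrow> real" where
  "lim_expect g = atom * g 0 + (1 - atom) * integral {0..pi} (\<lambda>k. g (sqrt (vel2 k)) * weight k)"

lemma expect_power: "expect t (\<lambda>x. (x\<^sup>2) ^ m) = mom m 0 t"
proof -
  have "supp_in t ((scaled_sq t ^^ m) (psi t)) \<or> supp_in t (psi t)" using supp_in_psi by blast
  from inner_supp_in[OF this] show ?thesis
    by (simp add: expect_def mom_def coord_B_power power2_eq_square mult_ac)
qed

lemma expect_1: "expect t (\<lambda>_. 1) = 1"
  using expect_power[of t 0] by (simp add: mom_def flip: power2_norm_eq_inner)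

lemma expect_poly_tendsto:
  "(\<lambda>t. expect t (\<lambda>x. \<Sum>i\<le>n. c i * (x\<^sup>2) ^ i)) \<longlonglongrightarrow> lim_expect (\<lambda>x. \<Sum>i\<le>n. c i * (x\<^sup>2) ^ i)"
proof -
  have "expect t (\<lambda>x. \<Sum>i\<le>n. c i * (x\<^sup>2) ^ i) = (\<Sum>i\<le>n. c i * mom i 0 t)" for t
    unfolding expect_power[symmetric] expect_def sum_distrib_left
    by (subst sum.swap) (simp add: mult_ac)
  moreover have "lim_expect (\<lambda>x. \<Sum>i\<le>n. c i * (x\<^sup>2) ^ i) = (\<Sum>i\<le>n. c i * lim_mom i 0)"
  proof -
    have "((\<lambda>k. \<Sum>i\<le>n. c i * (vel2 k ^ i * (a * cos k) ^ 0 * weight k)) has_integral (\<Sum>i\<le>n. c i * ac_mom i 0)) {0..pi}"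
      by (intro has_integral_sum has_integral_mult_right ac_mom_has_integral) simp
    moreover have "(\<lambda>k. (\<Sum>i\<le>n. c i * ((sqrt (vel2 k))\<^sup>2) ^ i) * weight k) =
        (\<lambda>k. \<Sum>i\<le>n. c i * (vel2 k ^ i * (a * cos k) ^ 0 * weight k))"
      using vel2_bounds by (simp add: sum_distrib_right mult.assoc)
    ultimately have "integral {0..pi} (\<lambda>k. (\<Sum>i\<le>n. c i * ((sqrt (vel2 k))\<^sup>2) ^ i) * weight k) =
        (\<Sum>i\<le>n. c i * ac_mom i 0)" by (simp add: integral_unique)
    moreover have "(\<Sum>i\<le>n. c i * (0\<^sup>2) ^ i) = c 0"
      by (simp add: power_0_left if_distrib cong: if_cong)
    moreover have "(\<Sum>i\<le>n. c i * (if i = 0 then atom else 0)) = c 0 * atom"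
      by (simp add: if_distrib cong: if_cong)
    moreover have "lim_mom i 0 = (if i = 0 then atom else 0) + (1 - atom) * ac_mom i 0" for i
      by (simp add: lim_mom_def)
    ultimately show ?thesis
      by (simp add: lim_expect_def distrib_left sum.distrib sum_distrib_left mult_ac)
  qed
  moreover have "(\<lambda>t. \<Sum>i\<le>n. c i * mom i 0 t) \<longlonglongrightarrow> (\<Sum>i\<le>n. c i * lim_mom i 0)"
    using moments_converge[of _ 0] by (intro tendsto_sum tendsto_mult tendsto_const) simp
  ultimately show ?thesis by simp
qed

lemma expect_diff_le:
  assumes "t > 0" "\<And>x. 0 \<le> x \<Longrightarrow> x \<le> 1 \<Longrightarrow> \<bar>g x - h x\<bar> \<le> e"
  shows "\<bar>expect t g - expect t h\<bar> \<le> e"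
proof -
  have "\<bar>expect t g - expect t h\<bar> = \<bar>\<Sum>y\<in>{- int t..int t}. (coord (psi t) y)\<^sup>2 *
      (g (\<bar>real_of_int y\<bar> / real t) - h (\<bar>real_of_int y\<bar> / real t))\<bar>"
    by (simp add: expect_def sum_subtractf right_diff_distrib)
  also have "\<dots> \<le> (\<Sum>y\<in>{- int t..int t}. (coord (psi t) y)\<^sup>2 * e)"
  proof (intro order_trans[OF sum_abs] sum_mono)
    fix y assume "y \<in> {- int t..int t}"
    hence "\<bar>real_of_int y\<bar> / real t \<le> 1" using assms(1) by (auto simp: abs_le_iff)
    hence "\<bar>g (\<bar>real_of_int y\<bar> / real t) - h (\<bar>real_of_int y\<bar> / real t)\<bar> \<le> e"
      by (intro assms(2)) simp_all
    thus "\<bar>(coord (psi t) y)\<^sup>2 * (g (\<bar>real_of_int y\<bar> / real t) - h (\<bar>real_of_int y\<bar> / real t))\<bar>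
      \<le> (coord (psi t) y)\<^sup>2 * e"
      by (simp add: abs_mult mult_left_mono)
  qed
  also have "\<dots> = expect t (\<lambda>_. 1) * e" by (simp add: expect_def sum_distrib_right)
  finally show ?thesis by (simp add: expect_1)
qed

lemma sqrt_vel2_bounds: "0 \<le> sqrt (vel2 k)" "sqrt (vel2 k) \<le> 1"
  using vel2_bounds by simp_all

lemma integrable_lim_expect:
  assumes "continuous_on {0..1} g"
  shows "(\<lambda>k. g (sqrt (vel2 k)) * weight k) integrable_on {0..pi}"
  using sqrt_vel2_bounds
  by (intro integrable_continuous_real continuous_intros continuous_on_compose2[OF assms]) auto

lemma lim_expect_diff_le:
  assumes "continuous_on {0..1} g" "continuous_on {0..1} h"
    "\<And>x. 0 \<le> x \<Longrightarrow> x \<le> 1 \<Longrightarrow> \<bar>g x - h x\<bar> \<le> e"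
  shows "\<bar>lim_expect g - lim_expect h\<bar> \<le> e"
proof -
  have int: "((\<lambda>k. e * weight k) has_integral e * integral {0..pi} weight) {0..pi}"
    by (intro has_integral_mult_right integrable_integral integrable_continuous_real continuous_intros)
  have "norm (integral {0..pi} (\<lambda>k. g (sqrt (vel2 k)) * weight k - h (sqrt (vel2 k)) * weight k))
      \<le> integral {0..pi} (\<lambda>k. e * weight k)"
  proof (rule integral_norm_bound_integral)
    fix k
    show "norm (g (sqrt (vel2 k)) * weight k - h (sqrt (vel2 k)) * weight k) \<le> e * weight k"
      using assms(3)[OF sqrt_vel2_bounds] weight_nonneg[of k]
      by (simp add: abs_mult mult_right_mono flip: left_diff_distrib)
  qed (use int in \<open>auto intro!: integrable_diff integrable_lim_expect assms\<close>)
  hence I: "\<bar>integral {0..pi} (\<lambda>k. g (sqrt (vel2 k)) * weight k) -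
      integral {0..pi} (\<lambda>k. h (sqrt (vel2 k)) * weight k)\<bar> \<le> e"
    using int by (simp add: integral_diff integrable_lim_expect assms integral_weight integral_unique)
  have "\<bar>lim_expect g - lim_expect h\<bar> = \<bar>atom * (g 0 - h 0) + (1 - atom) *
     (integral {0..pi} (\<lambda>k. g (sqrt (vel2 k)) * weight k) -
      integral {0..pi} (\<lambda>k. h (sqrt (vel2 k)) * weight k))\<bar>"
    by (simp add: lim_expect_def algebra_simps)
  also have "\<dots> \<le> atom * \<bar>g 0 - h 0\<bar> + (1 - atom) * \<bar>integral {0..pi} (\<lambda>k. g (sqrt (vel2 k)) * weight k) -
      integral {0..pi} (\<lambda>k. h (sqrt (vel2 k)) * weight k)\<bar>"
    using atom_bounds by (intro order_trans[OF abs_triangle_ineq]) (simp add: abs_mult)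
  also have "\<dots> \<le> atom * e + (1 - atom) * e"
    using atom_bounds assms(3)[of 0] I by (intro add_mono mult_left_mono) auto
  finally show ?thesis by (simp add: algebra_simps)
qed

lemma expect_tendsto:
  assumes "continuous_on {0..1} g"
  shows "(\<lambda>t. expect t g) \<longlonglongrightarrow> lim_expect g"
proof (rule tendstoI)
  fix e :: real assume e: "e > 0"
  \<comment> \<open>Only even moments of X / t are known, so the approximating polynomial is taken
    in u = x^2.\<close>
  have "continuous_on {0..1} (\<lambda>u. g (sqrt u))"
    by (intro continuous_on_compose2[OF assms] continuous_intros) auto
  from Stone_Weierstrass_polynomial_function[OF compact_Icc this, of "e / 4"] e
  obtain p where p: "polynomial_function p" "\<And>x. x \<in> {0..1} \<Longrightarrow> \<bar>g (sqrt x) - p x\<bar> < e / 4"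
    by (auto simp: real_norm_def)
  from p(1) obtain c n where p_eq: "p = (\<lambda>x. \<Sum>i\<le>n. c i * x ^ i)"
    unfolding real_polynomial_function_eq[symmetric] real_polynomial_function_iff_sum by auto
  define h where "h = (\<lambda>x. \<Sum>i\<le>n. c i * (x\<^sup>2) ^ i)"
  have near: "\<bar>g x - h x\<bar> \<le> e / 4" if "0 \<le> x" "x \<le> 1" for x
    using p(2)[of "x\<^sup>2"] that by (simp add: p_eq h_def power_le_one less_imp_le)
  have lim_near: "\<bar>lim_expect g - lim_expect h\<bar> \<le> e / 4"
    by (intro lim_expect_diff_le assms near) (auto simp: h_def intro!: continuous_intros)
  have "\<forall>\<^sub>F t in sequentially. \<bar>expect t h - lim_expect h\<bar> < e / 4"
    using tendstoD[OF expect_poly_tendsto[of c n], of "e / 4"] e by (simp add: h_def dist_real_def)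
  moreover have "\<forall>\<^sub>F t in sequentially. t > (0::nat)" by (rule eventually_gt_at_top)
  ultimately show "\<forall>\<^sub>F t in sequentially. dist (expect t g) (lim_expect g) < e"
  proof eventually_elim
    case (elim t)
    have "\<bar>expect t g - expect t h\<bar> \<le> e / 4" by (intro expect_diff_le near elim)
    thus ?case using elim e lim_near unfolding dist_real_def by linarith
  qed
qed

section \<open>Change of variables from \<open>k\<close> to the velocity
  \<open>vel k\<close>\<close>

definition vel :: "real \<Rightarrow> real" where
  "vel k = a * sin k / sqrt (1 - a\<^sup>2 * (cos k)\<^sup>2)"

lemma sqrt_vel2: "k \<in> {0..pi} \<Longrightarrow> sqrt (vel2 k) = vel k"
  using a_pos by (simp add: vel2_def vel_def real_sqrt_divide real_sqrt_mult sin_ge_zero)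

lemma vel_has_derivative:
  "(vel has_real_derivative a * b\<^sup>2 * cos k / (1 - a\<^sup>2 * (cos k)\<^sup>2) / sqrt (1 - a\<^sup>2 * (cos k)\<^sup>2)) (at k)"
proof -
  define d where "d = 1 - a\<^sup>2 * (cos k)\<^sup>2"
  have d: "d > 0" using den_pos by (simp add: d_def)
  have "(vel has_real_derivative (a * cos k * sqrt d - a * sin k * ((2 * a\<^sup>2 * cos k * sin k) * (inverse (sqrt d) / 2))) /
      (sqrt d * sqrt d)) (at k)"
    unfolding vel_def d_def using d
    by (auto intro!: derivative_eq_intros simp: d_def mult_ac)
  also have "(a * cos k * sqrt d - a * sin k * ((2 * a\<^sup>2 * cos k * sin k) * (inverse (sqrt d) / 2))) / (sqrt d * sqrt d) =
      a * cos k * (sqrt d * sqrt d - a\<^sup>2 * (sin k)\<^sup>2) / d / sqrt d"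
    using d by (simp add: field_simps power2_eq_square)
  also have "sqrt d * sqrt d - a\<^sup>2 * (sin k)\<^sup>2 = b\<^sup>2"
  proof -
    have "sqrt d * sqrt d - a\<^sup>2 * (sin k)\<^sup>2 = 1 - a\<^sup>2"
      using d by (simp add: d_def sin_squared_eq algebra_simps)
    thus ?thesis using a2 by simp
  qed
  finally show ?thesis by (simp add: d_def mult_ac)
qed

definition limit_density :: "real \<Rightarrow> real" where
  "limit_density x = 2 * b / (1 - b) * (x\<^sup>2 * indicator {0..<a} x) / (pi * (1 - x\<^sup>2) * sqrt (a\<^sup>2 - x\<^sup>2))"

text \<open>The Jacobian identity of x = \<open>vel k\<close>. The factor 2 reflects that k and pi -
  k have the same speed and weight; at k = pi / 2 the density is singular and the identity breaks
  down.\<close>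

lemma limit_density_vel:
  assumes "0 \<le> k" "k < pi / 2"
  shows "limit_density (vel k) * (a * b\<^sup>2 * cos k / (1 - a\<^sup>2 * (cos k)\<^sup>2) / sqrt (1 - a\<^sup>2 * (cos k)\<^sup>2)) = 2 * weight k"
proof -
  define d where "d = 1 - a\<^sup>2 * (cos k)\<^sup>2"
  have d: "d > 0" using den_pos by (simp add: d_def)
  have cos: "cos k > 0" using assms by (intro cos_gt_zero_pi) auto
  have v2: "(vel k)\<^sup>2 = a\<^sup>2 * (sin k)\<^sup>2 / d"
    using d by (simp add: vel_def d_def power_divide power_mult_distrib)
  have v_ge: "vel k \<ge> 0" using assms a_pos d by (simp add: vel_def d_def sin_ge_zero)
  have 1: "1 - (vel k)\<^sup>2 = b\<^sup>2 / d"
  proof -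
    have "d - a\<^sup>2 * (sin k)\<^sup>2 = 1 - a\<^sup>2" by (simp add: d_def sin_squared_eq algebra_simps)
    moreover have "1 - (vel k)\<^sup>2 = (d - a\<^sup>2 * (sin k)\<^sup>2) / d"
      using d by (simp add: v2 diff_divide_distrib)
    ultimately show ?thesis using a2 by simp
  qed
  have 2: "a\<^sup>2 - (vel k)\<^sup>2 = (a * b * cos k)\<^sup>2 / d"
  proof -
    have "a\<^sup>2 * d - a\<^sup>2 * (sin k)\<^sup>2 = a\<^sup>2 * (1 - (sin k)\<^sup>2 - a\<^sup>2 * (cos k)\<^sup>2)" by (simp add: d_def algebra_simps)
    also have "\<dots> = a\<^sup>2 * ((1 - a\<^sup>2) * (cos k)\<^sup>2)" by (simp add: sin_squared_eq algebra_simps)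
    also have "\<dots> = (a * b * cos k)\<^sup>2" using a2 by (simp add: power_mult_distrib)
    finally show ?thesis using d by (simp add: v2 field_simps)
  qed
  have "(vel k)\<^sup>2 < a\<^sup>2" using 2 d a_pos b_pos cos by (metis diff_gt_0_iff_gt divide_pos_pos mult_pos_pos zero_less_power)
  hence "vel k < a" using a_pos by (simp add: power2_less_imp_less)
  hence ind: "indicator {0..<a} (vel k) = (1::real)" using v_ge by simp
  have sq: "sqrt (a\<^sup>2 - (vel k)\<^sup>2) = a * b * cos k / sqrt d"
    unfolding 2 real_sqrt_divide using a_pos b_pos cos by simp
  have "limit_density (vel k) * (a * b\<^sup>2 * cos k / d / sqrt d) =
      2 * b / (1 - b) * (a\<^sup>2 * (sin k)\<^sup>2 / d) / (pi * (b\<^sup>2 / d) * (a * b * cos k / sqrt d)) * (a * b\<^sup>2 * cos k / d / sqrt d)"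
    unfolding limit_density_def ind 1 sq unfolding v2 by simp
  also have "\<dots> = 2 * (a\<^sup>2 / (1 - b)) / pi * ((sin k)\<^sup>2 / d)"
  proof -
    have "2 * b / e * (A * S / d) / (p * (b\<^sup>2 / d) * (a * b * c / q)) * (a * b\<^sup>2 * c / d / q) = 2 * (A / e) / p * (S / d)"
      if "e \<noteq> 0" "p \<noteq> 0" "q \<noteq> 0" "c \<noteq> 0" for e A S p c q :: real
      using that d a_pos b_pos by (simp add: field_simps power2_eq_square)
    from this[of "1 - b" pi "sqrt d" "cos k"] show ?thesis using b_less_1 d cos by simp
  qed
  also have "a\<^sup>2 / (1 - b) = 1 + b"
    unfolding a2 using b_less_1 by (simp add: field_simps power2_eq_square)
  finally show ?thesis by (simp add: weight_def d_def)
qed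

lemma limit_density_nonneg: "limit_density x \<ge> 0"
proof (cases "x \<in> {0..<a}")
  case True
  hence "x\<^sup>2 < 1" using a_less_1 by (simp add: abs_square_less_1)
  thus ?thesis
    using b_pos b_less_1 True by (auto simp: limit_density_def intro!: divide_nonneg_nonneg mult_nonneg_nonneg)
qed (simp add: limit_density_def)

lemma limit_density_measurable [measurable]: "limit_density \<in> borel_measurable borel"
  unfolding limit_density_def by measurable

lemma integral_symmetric_half:
  assumes "continuous_on {0..pi} g" "\<And>k. g (pi - k) = (g k :: real)"
  shows "integral {0..pi} g = 2 * integral {0..pi / 2} g"
proof -
  have int: "g integrable_on {0..pi}" using assms(1) by (rule integrable_continuous_real)
  have "integral {0..pi / 2} g + integral {pi / 2..pi} g = integral {0..pi} g"
    using int by (intro Henstock_Kurzweil_Integration.integral_combine) auto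
  moreover have "(g has_integral integral {0..pi / 2} g) {0..pi / 2}"
    by (intro integrable_integral integrable_continuous_real continuous_on_subset[OF assms(1)]) auto
  from has_integral_affinity[OF this[folded cbox_interval], of "-1" pi]
  have "((\<lambda>k. g (pi - k)) has_integral integral {0..pi / 2} g) ((\<lambda>x. pi - x) ` {0..pi / 2})"
    by (simp add: algebra_simps)
  hence "(g has_integral integral {0..pi / 2} g) ((\<lambda>x. pi - x) ` {0..pi / 2})"
    by (simp add: assms(2))
  hence "integral {pi / 2..pi} g = integral {0..pi / 2} g"
    by (simp add: integral_unique)
  ultimately show ?thesis by simp
qed

lemma nn_integral_limit_density:
  assumes "continuous_on {0..1} g" "\<And>x. g x \<ge> 0" "g \<in> borel_measurable borel"
  shows "(\<integral>\<^sup>+x. ennreal (limit_density x) * ennreal (g x) \<partial>lborel) =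
    ennreal (integral {0..pi} (\<lambda>k. g (sqrt (vel2 k)) * weight k))"
proof -
  let ?v' = "\<lambda>k. a * b\<^sup>2 * cos k / (1 - a\<^sup>2 * (cos k)\<^sup>2) / sqrt (1 - a\<^sup>2 * (cos k)\<^sup>2)"
  define h where "h = (\<lambda>x. limit_density x * g x)"
  have [measurable]: "g \<in> borel_measurable borel" by fact
  have v: "vel 0 = 0" "vel (pi / 2) = a" by (simp_all add: vel_def)
  have "(\<integral>\<^sup>+x. ennreal (limit_density x) * ennreal (g x) \<partial>lborel) =
      (\<integral>\<^sup>+x. ennreal (h x * indicator {vel 0..vel (pi / 2)} x) \<partial>lborel)"
  proof (rule nn_integral_cong)
    fix x
    have "h x * indicator {vel 0..vel (pi / 2)} x = h x"
      unfolding v by (auto simp: h_def limit_density_def split: split_indicator)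
    moreover have "ennreal (limit_density x) * ennreal (g x) = ennreal (h x)"
      by (simp add: h_def ennreal_mult' limit_density_nonneg)
    ultimately show "ennreal (limit_density x) * ennreal (g x) = ennreal (h x * indicator {vel 0..vel (pi / 2)} x)"
      by (simp only:)
  qed
  also have "\<dots> = (\<integral>\<^sup>+k. ennreal (h (vel k) * ?v' k * indicator {0..pi / 2} k) \<partial>lborel)"
  proof (rule nn_integral_substitution)
    show "set_borel_measurable borel {vel 0..vel (pi / 2)} h"
      unfolding h_def set_borel_measurable_def by measurable
    show "continuous_on {0..pi / 2} ?v'"
      using den_pos by (intro continuous_intros) (auto simp: less_le)
    show "?v' k \<ge> 0" if "k \<in> {0..pi / 2}" for k
      using that a_pos den_pos[of k] by (auto intro!: divide_nonneg_nonneg mult_nonneg_nonneg cos_ge_zero simp: less_imp_le)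
  qed (rule vel_has_derivative | simp)+
  also have "\<dots> = (\<integral>\<^sup>+k. ennreal (2 * (g (sqrt (vel2 k)) * weight k)) * indicator {0..pi / 2} k \<partial>lborel)"
  proof (rule nn_integral_cong_AE)
    \<comment> \<open>At this point x = a is cut off by the half-open indicator, while the weight
      stays positive.\<close>
    have "AE k in lborel. k \<noteq> pi / 2" by (rule AE_lborel_singleton)
    thus "AE k in lborel. ennreal (h (vel k) * ?v' k * indicator {0..pi / 2} k) =
        ennreal (2 * (g (sqrt (vel2 k)) * weight k)) * indicator {0..pi / 2} k"
    proof eventually_elim
      case (elim k)
      show ?case
      proof (cases "k \<in> {0..pi / 2}")
        case True
        have "h (vel k) * ?v' k = (limit_density (vel k) * ?v' k) * g (vel k)" by (simp add: h_def)
        also have "limit_density (vel k) * ?v' k = 2 * weight k"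
          using True elim by (intro limit_density_vel) auto
        finally have "h (vel k) * ?v' k = 2 * weight k * g (vel k)" .
        thus ?thesis using True sqrt_vel2[of k] by (simp add: mult_ac)
      qed simp
    qed
  qed
  also have "\<dots> = ennreal (integral {0..pi / 2} (\<lambda>k. 2 * (g (sqrt (vel2 k)) * weight k)))"
  proof (rule nn_integral_has_integral_lebesgue')
    show "0 \<le> 2 * (g (sqrt (vel2 k)) * weight k)" for k using assms(2) weight_nonneg by simp
    show "((\<lambda>k. 2 * (g (sqrt (vel2 k)) * weight k)) has_integral
        integral {0..pi / 2} (\<lambda>k. 2 * (g (sqrt (vel2 k)) * weight k))) {0..pi / 2}"
      using sqrt_vel2_bounds
      by (intro integrable_integral integrable_continuous_real continuous_intros
          continuous_on_compose2[OF assms(1)]) auto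
  qed
  also have "integral {0..pi / 2} (\<lambda>k. 2 * (g (sqrt (vel2 k)) * weight k)) =
      integral {0..pi} (\<lambda>k. g (sqrt (vel2 k)) * weight k)"
  proof -
    have "integral {0..pi} (\<lambda>k. g (sqrt (vel2 k)) * weight k) =
        2 * integral {0..pi / 2} (\<lambda>k. g (sqrt (vel2 k)) * weight k)"
    proof (rule integral_symmetric_half)
      show "continuous_on {0..pi} (\<lambda>k. g (sqrt (vel2 k)) * weight k)"
        using sqrt_vel2_bounds by (intro continuous_intros continuous_on_compose2[OF assms(1)]) auto
      have "vel2 (pi - k) = vel2 k" "weight (pi - k) = weight k" for k
        by (simp_all add: vel2_def weight_def)
      thus "g (sqrt (vel2 (pi - k))) * weight (pi - k) = g (sqrt (vel2 k)) * weight k" for k by simp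
    qed
    thus ?thesis by simp
  qed
  finally show ?thesis .
qed

end

section \<open>The limit theorem\<close>

lemma wall_walk_Grover:
  assumes "\<kappa> \<ge> 3" "s = 1 \<or> s = -1"
  shows "wall_walk (a_k \<kappa>) (b_k \<kappa>) s"
proof
  show "a_k \<kappa> > 0" "b_k \<kappa> > 0" using assms(1) by (simp_all add: a_k_def b_k_def field_simps)
  show "(a_k \<kappa>)\<^sup>2 = 1 - (b_k \<kappa>)\<^sup>2"
    using assms(1) by (simp add: a_k_def b_k_def power_divide power_mult_distrib field_simps power2_eq_square)
qed (fact assms(2))

text \<open>Site 0 of the integers already stands for (0, L), so the dummy coordinate (0, R) must be
  set to 0 explicitly.\<close>

lemma Phi_eq:
  assumes "cis \<gamma> = of_real s"
  shows "Phi \<kappa> \<gamma> t (x, L) = of_real (coord ((walk_op (a_k \<kappa>) (b_k \<kappa>) s ^^ t) (site 0)) (- int x))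
    \<and> Phi \<kappa> \<gamma> t (x, R) = of_real (if x = 0 then 0 else coord ((walk_op (a_k \<kappa>) (b_k \<kappa>) s ^^ t) (site 0)) (int x))"
proof (induction t arbitrary: x)
  case 0
  show ?case by (auto simp: coord_site)
next
  case (Suc t)
  have coord_U: "coord (walk_op a b s f) y = (if y \<le> 0 then a * coord f (y - 1) - b * coord f (1 - y)
     else if y = 1 then s * coord f 0 else b * coord f (1 - y) + a * coord f (y - 1))" for a b f y
    by transfer simp
  consider "x = 0" | "x = Suc 0" | n where "x = Suc (Suc n)" by (metis not0_implies_Suc)
  thus ?case
    by cases (simp_all add: Suc.IH coord_U assms add.commute)
qed

lemma walk_prob_eq:
  assumes "cis \<gamma> = of_real s"
  shows "walk_prob \<kappa> \<gamma> t x = (\<Sum>y\<in>{y. nat \<bar>y\<bar> = x}. (coord ((walk_op (a_k \<kappa>) (b_k \<kappa>) s ^^ t) (site 0)) y)\<^sup>2)"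
proof -
  have "{y. nat \<bar>y\<bar> = x} = (if x = 0 then {0} else {- int x, int x})" by auto
  thus ?thesis by (simp add: walk_prob_def Phi_eq[OF assms])
qed

lemma continuous_cts_step: "x < y \<Longrightarrow> continuous_on A (cts_step x y)"
  using uniformly_continuous_imp_continuous[OF cts_step_uniformly_continuous]
  by (meson continuous_on_subset subset_UNIV)

lemma (in wall_walk) lim_expect_nonneg:
  assumes "continuous_on {0..1} g" "\<And>x. g x \<ge> 0"
  shows "lim_expect g \<ge> 0"
  unfolding lim_expect_def using atom_bounds weight_nonneg assms
  by (intro add_nonneg_nonneg mult_nonneg_nonneg integral_nonneg integrable_lim_expect) auto

text \<open>The limit is tested only on nonnegative functions continuous on [0, 1]: the scaled
  distance never leaves [0, 1], and weak convergence follows from the piecewise linear functions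
  \<open>cts_step\<close>. The case of the constant 1 also shows that \<open>Q\<close> is a
  probability measure.\<close>

lemma weak_conv_law_scaled:
  assumes k: "\<kappa> \<ge> 3" and s: "s = 1 \<or> s = -1" and cis: "cis \<gamma> = of_real s"
    and sets_Q: "sets Q = sets borel"
    and Q: "\<And>g. continuous_on {0..1} g \<Longrightarrow> g \<in> borel_measurable borel \<Longrightarrow> (\<And>x. g x \<ge> 0) \<Longrightarrow>
      (\<integral>\<^sup>+x. ennreal (g x) \<partial>Q) = ennreal (wall_walk.lim_expect (a_k \<kappa>) (b_k \<kappa>) s g)"
  shows "weak_conv_m (law_scaled \<kappa> \<gamma>) Q"
proof -
  interpret W: wall_walk "a_k \<kappa>" "b_k \<kappa>" s by (rule wall_walk_Grover[OF k s])
  note wp = walk_prob_eq[OF cis, of \<kappa>]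
  have wp_nonneg: "walk_prob \<kappa> \<gamma> t x \<ge> 0" for t x unfolding wp by (simp add: sum_nonneg)
  have wp_0: "walk_prob \<kappa> \<gamma> t x = 0" if "x > t" for t x
    unfolding wp using supp_inD[OF W.supp_in_psi] that by (intro sum.neutral) auto
  have sum_wp: "(\<Sum>x\<le>t. walk_prob \<kappa> \<gamma> t x * g (real x / real t)) = W.expect t g" for t g
  proof -
    have "(\<Sum>x\<le>t. walk_prob \<kappa> \<gamma> t x * g (real x / real t)) =
        (\<Sum>x\<in>{..t}. \<Sum>y\<in>{y\<in>{- int t..int t}. nat \<bar>y\<bar> = x}. (coord (W.psi t) y)\<^sup>2 * g (\<bar>real_of_int y\<bar> / real t))"
    proof (rule sum.cong[OF refl])
      fix x assume "x \<in> {..t}"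
      hence "{y. nat \<bar>y\<bar> = x} = {y\<in>{- int t..int t}. nat \<bar>y\<bar> = x}" by auto
      thus "walk_prob \<kappa> \<gamma> t x * g (real x / real t) =
          (\<Sum>y\<in>{y\<in>{- int t..int t}. nat \<bar>y\<bar> = x}. (coord (W.psi t) y)\<^sup>2 * g (\<bar>real_of_int y\<bar> / real t))"
        unfolding wp sum_distrib_right by (intro sum.cong) auto
    qed
    also have "\<dots> = W.expect t g"
      unfolding W.expect_def by (rule sum.group) auto
    finally show ?thesis .
  qed
  have meas: "(\<lambda>x. real x / real t) \<in> law_X \<kappa> \<gamma> t \<rightarrow>\<^sub>M borel" for t
    by (simp add: law_X_def)
  have distr_law: "real_distribution (law_scaled \<kappa> \<gamma> t)" for t
  proof -
    have "emeasure (law_X \<kappa> \<gamma> t) (space (law_X \<kappa> \<gamma> t)) = (\<integral>\<^sup>+x. ennreal (walk_prob \<kappa> \<gamma> t x) \<partial>count_space UNIV)"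
      by (simp add: law_X_def emeasure_density)
    also have "\<dots> = (\<Sum>x\<le>t. ennreal (walk_prob \<kappa> \<gamma> t x))"
      by (rule nn_integral_count_space') (auto simp: wp_0)
    also have "\<dots> = ennreal (\<Sum>x\<le>t. walk_prob \<kappa> \<gamma> t x * 1)"
      by (simp add: wp_nonneg)
    also have "\<dots> = 1" unfolding sum_wp[of _ "\<lambda>_. 1"] by (simp add: W.expect_1)
    finally interpret X: prob_space "law_X \<kappa> \<gamma> t" by (rule prob_spaceI)
    interpret S: prob_space "law_scaled \<kappa> \<gamma> t"
      unfolding law_scaled_def by (rule X.prob_space_distr[OF meas])
    show ?thesis by unfold_locales (simp_all add: law_scaled_def)
  qed
  have integral_law: "integral\<^sup>L (law_scaled \<kappa> \<gamma> t) g = W.expect t g" if [measurable]: "g \<in> borel_measurable borel" for g t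
  proof -
    have "integral\<^sup>L (law_scaled \<kappa> \<gamma> t) g = (\<integral>x. g (real x / real t) \<partial>law_X \<kappa> \<gamma> t)"
      unfolding law_scaled_def by (rule integral_distr[OF meas that])
    also have "\<dots> = (\<integral>x. walk_prob \<kappa> \<gamma> t x * g (real x / real t) \<partial>count_space UNIV)"
      unfolding law_X_def by (subst integral_density) (simp_all add: wp_nonneg)
    also have "\<dots> = (\<Sum>x\<in>{x. walk_prob \<kappa> \<gamma> t x * g (real x / real t) \<noteq> 0}. walk_prob \<kappa> \<gamma> t x * g (real x / real t))"
    proof (subst lebesgue_integral_count_space_finite_support)
      show "finite {x \<in> UNIV. walk_prob \<kappa> \<gamma> t x * g (real x / real t) \<noteq> 0}"
        by (rule finite_subset[of _ "{..t}"]) (auto simp: not_less[symmetric] dest: wp_0)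
    qed simp
    also have "\<dots> = (\<Sum>x\<le>t. walk_prob \<kappa> \<gamma> t x * g (real x / real t))"
      by (rule sum.mono_neutral_left) (auto simp: not_less[symmetric] dest: wp_0)
    finally show ?thesis by (simp add: sum_wp)
  qed
  have integral_Q: "integral\<^sup>L Q g = W.lim_expect g"
    if "continuous_on {0..1} g" "g \<in> borel_measurable borel" "\<And>x. g x \<ge> 0" for g
  proof -
    have "g \<in> borel_measurable Q" using that(2) measurable_cong_sets[OF sets_Q refl] by blast
    hence "integral\<^sup>L Q g = enn2real (\<integral>\<^sup>+x. ennreal (g x) \<partial>Q)"
      using that(3) by (intro integral_eq_nn_integral) auto
    also have "\<dots> = W.lim_expect g"
      using Q[OF that] W.lim_expect_nonneg[OF that(1,3)] by simp
    finally show ?thesis .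
  qed
  have "emeasure Q (space Q) = 1"
    using Q[of "\<lambda>_. 1"] W.integral_weight by (simp add: W.lim_expect_def)
  then interpret QP: prob_space Q by (rule prob_spaceI)
  have distr_Q: "real_distribution Q"
    by unfold_locales (use sets_Q sets_eq_imp_space_eq[OF sets_Q] in auto)
  show ?thesis
  proof (rule integral_cts_step_conv_imp_weak_conv[OF distr_law distr_Q])
    fix x y :: real assume xy: "x < y"
    note cont = continuous_cts_step[OF xy]
    have meas_g: "cts_step x y \<in> borel_measurable borel"
      by (rule borel_measurable_continuous_onI[OF cont])
    have "cts_step x y z \<ge> 0" for z using xy by (auto simp: cts_step_def)
    from integral_Q[OF cont meas_g this]
    show "(\<lambda>t. integral\<^sup>L (law_scaled \<kappa> \<gamma> t) (cts_step x y)) \<longlonglongrightarrow> integral\<^sup>L Q (cts_step x y)"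
      unfolding integral_law[OF meas_g] using W.expect_tendsto[OF cont] by simp
  qed
qed

lemma f_k_eq:
  assumes "\<kappa> \<ge> 3"
  shows "f_k \<kappa> = wall_walk.limit_density (a_k \<kappa>) (b_k \<kappa>)"
proof
  fix x
  interpret W: wall_walk "a_k \<kappa>" "b_k \<kappa>" 1 using assms by (intro wall_walk_Grover) auto
  have "2 * b_k \<kappa> / (1 - b_k \<kappa>) = real \<kappa> - 2"
    using assms by (simp add: b_k_def field_simps)
  thus "f_k \<kappa> x = W.limit_density x" by (simp add: f_k_def W.limit_density_def)
qed

text \<open>A measure built by \<open>measure_of\<close> has the prescribed values only if the set
  function is countably additive. Recognizing that function as \<open>emeasure N\<close> for a
  genuine measure settles this and gives the integrals as well.\<close>

lemma limit_B_integral: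
  assumes k: "\<kappa> \<ge> 3"
  shows "sets (limit_B \<kappa>) = sets borel"
    and "g \<in> borel_measurable borel \<Longrightarrow> (\<integral>\<^sup>+x. g x \<partial>limit_B \<kappa>) =
      ennreal (C_k \<kappa>) * g 0 + ennreal (1 - C_k \<kappa>) * (\<integral>\<^sup>+x. g x \<partial>density lborel (\<lambda>x. ennreal (f_k \<kappa> x)))"
proof -
  interpret W: wall_walk "a_k \<kappa>" "b_k \<kappa>" 1 using k by (intro wall_walk_Grover) auto
  let ?D = "density lborel (\<lambda>x. ennreal (f_k \<kappa> x))"
  have [measurable]: "f_k \<kappa> \<in> borel_measurable borel"
    using W.limit_density_measurable by (simp add: f_k_eq[OF k])
  \<comment> \<open>\<open>limit_B\<close> is the image under \<open>max _ 0\<close> of a measure with a density: the atom is spread over \<open>[-1, 0)\<close>.\<close>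
  define q where "q = (\<lambda>x::real. ennreal (C_k \<kappa>) * indicator {-1..<0} x + ennreal (1 - C_k \<kappa>) * ennreal (f_k \<kappa> x))"
  have [measurable]: "q \<in> borel_measurable borel" unfolding q_def by measurable
  define N where "N = distr (density lborel q) borel (\<lambda>x. max x 0)"
  have N: "(\<integral>\<^sup>+x. g x \<partial>N) = ennreal (C_k \<kappa>) * g 0 + ennreal (1 - C_k \<kappa>) * (\<integral>\<^sup>+x. g x \<partial>?D)"
    if [measurable]: "g \<in> borel_measurable borel" for g
  proof -
    have "(\<integral>\<^sup>+x. g x \<partial>N) = (\<integral>\<^sup>+x. q x * g (max x 0) \<partial>lborel)"
      unfolding N_def by (simp add: nn_integral_distr nn_integral_density)
    also have "\<dots> = (\<integral>\<^sup>+x. ennreal (C_k \<kappa>) * g 0 * indicator {-1..<0} x +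
        ennreal (1 - C_k \<kappa>) * (ennreal (f_k \<kappa> x) * g x) \<partial>lborel)"
      \<comment> \<open>The density \<open>f_k\<close> vanishes on negative x, so
        \<open>max x 0\<close> is x where \<open>f_k\<close> counts and 0 on the interval carrying
        the atom.\<close>
      by (intro nn_integral_cong) (auto simp: q_def f_k_def distrib_right mult_ac max_def split: split_indicator)
    also have "\<dots> = ennreal (C_k \<kappa>) * g 0 * emeasure lborel {-1..<(0::real)} +
        ennreal (1 - C_k \<kappa>) * (\<integral>\<^sup>+x. ennreal (f_k \<kappa> x) * g x \<partial>lborel)"
      by (simp add: nn_integral_add nn_integral_cmult)
    finally show ?thesis by (simp add: nn_integral_density)
  qed
  have "limit_B \<kappa> = measure_of (space N) (sets N) (emeasure N)"
    unfolding limit_B_def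
  proof -
    have eq: "ennreal (C_k \<kappa>) * indicator A 0 + ennreal (1 - C_k \<kappa>) * emeasure ?D A = emeasure N A"
      if "A \<in> sets borel" for A
    proof -
      have [measurable]: "A \<in> sets borel" by fact
      show ?thesis
        using N[of "indicator A"] that by (simp add: N_def)
    qed
    have "sets N = sets borel" "space N = UNIV" by (simp_all add: N_def)
    thus "measure_of UNIV (sets borel) (\<lambda>A. ennreal (C_k \<kappa>) * indicator A 0
          + ennreal (1 - C_k \<kappa>) * emeasure ?D A) = measure_of (space N) (sets N) (emeasure N)"
      using eq by (auto intro!: measure_of_eq simp: sets.sigma_sets_eq[of borel, simplified])
  qed
  hence "limit_B \<kappa> = N" by (simp add: measure_of_of_measure)
  thus "sets (limit_B \<kappa>) = sets borel"
    "g \<in> borel_measurable borel \<Longrightarrow> (\<integral>\<^sup>+x. g x \<partial>limit_B \<kappa>) =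
      ennreal (C_k \<kappa>) * g 0 + ennreal (1 - C_k \<kappa>) * (\<integral>\<^sup>+x. g x \<partial>?D)"
    using N by (simp_all add: N_def)
qed

theorem theorem2:
  fixes \<kappa> :: nat
  assumes "\<kappa> \<ge> 3"
  shows "weak_conv_m (\<lambda>t. law_scaled \<kappa> 0 t) (limit_A \<kappa>)
       \<and> weak_conv_m (\<lambda>t. law_scaled \<kappa> pi t) (limit_B \<kappa>)"
proof
  interpret A: wall_walk "a_k \<kappa>" "b_k \<kappa>" 1 using assms by (intro wall_walk_Grover) auto
  interpret B: wall_walk "a_k \<kappa>" "b_k \<kappa>" "-1" using assms by (intro wall_walk_Grover) auto
  note [measurable] = A.limit_density_measurable
  \<comment> \<open>\<open>vel2\<close> and \<open>weight\<close> are built from a and b alone, so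
    one computation serves both phases; only \<open>atom\<close> differs.\<close>
  have ac: "(\<integral>\<^sup>+x. ennreal (g x) \<partial>density lborel (\<lambda>x. ennreal (f_k \<kappa> x))) =
      ennreal (integral {0..pi} (\<lambda>k. g (sqrt (A.vel2 k)) * A.weight k))"
    if "continuous_on {0..1} g" "g \<in> borel_measurable borel" "\<And>x. g x \<ge> 0" for g
    using A.nn_integral_limit_density[OF that(1,3,2)] that(2)
    by (simp add: f_k_eq[OF assms] nn_integral_density)
  show "weak_conv_m (\<lambda>t. law_scaled \<kappa> 0 t) (limit_A \<kappa>)"
  proof (rule weak_conv_law_scaled[OF assms, of 1])
    fix g :: "real \<Rightarrow> real"
    assume "continuous_on {0..1} g" "g \<in> borel_measurable borel" "\<And>x. g x \<ge> 0"
    from ac[OF this] show "(\<integral>\<^sup>+x. ennreal (g x) \<partial>limit_A \<kappa>) = ennreal (A.lim_expect g)"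
      by (simp add: limit_A_def A.lim_expect_def A.atom_def)
  qed (simp_all add: limit_A_def)
  show "weak_conv_m (\<lambda>t. law_scaled \<kappa> pi t) (limit_B \<kappa>)"
  proof (rule weak_conv_law_scaled[OF assms, of "-1"])
    fix g :: "real \<Rightarrow> real"
    assume g: "continuous_on {0..1} g" "g \<in> borel_measurable borel" "\<And>x. g x \<ge> 0"
    \<comment> \<open>With b = 1 - 2 / \<open>\<kappa>\<close>, the atom 2 b / (1 + b) equals
      (\<open>\<kappa>\<close> - 2) / (\<open>\<kappa>\<close> - 1).\<close>
    have "C_k \<kappa> = B.atom"
      unfolding B.atom_def using assms by (simp add: C_k_def b_k_def field_simps)
    moreover have "integral {0..pi} (\<lambda>k. g (sqrt (A.vel2 k)) * A.weight k) \<ge> 0"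
      using g A.weight_nonneg by (intro integral_nonneg A.integrable_lim_expect) auto
    ultimately show "(\<integral>\<^sup>+x. ennreal (g x) \<partial>limit_B \<kappa>) = ennreal (B.lim_expect g)"
      using g B.atom_bounds
      by (simp add: limit_B_integral[OF assms] ac B.lim_expect_def ennreal_mult ennreal_plus)
  qed (simp_all add: limit_B_integral[OF assms])
qed

end
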